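(* In IITT: (1) If $\Delta\vdash t:T$, $\Delta\vdash t':T$ and $\Delta\vdash t\Longleftrightarrow_{\mathsf{tm}}t':T$, then $\Delta\vdash t=t':T$. (2) If $\Delta\vdash n:T$, $\Delta\vdash n':T$ and $\Delta\vdash n\Longleftrightarrow_{\mathsf{ne}}n':U$, then $\Delta\vdash n=n':U$ and $\Delta\vdash U=T$.
   Context: Irrelevant Intensional Type Theory (IITT) is defined as follows. Sorts are $\mathsf{Set}_k$ ($k\in\mathbb{N}$), with $\mathsf{Axiom}=\{(\mathsf{Set}_i,\mathsf{Set}_{i+1})\}$ and $\mathsf{Rule}=\{(\mathsf{Set}_i,\mathsf{Set}_j,\mathsf{Set}_{\max(i,j)})\}$. Annotations $\star\in\{:,\div\}$ (relevant, irrelevant). Expressions: $t,u,T,U ::= s \mid (x\star U)\to^{s,s'}T \mid x \mid \lambda x\star U.\,t \mid t\star u$ (relevant/irrelevant dependent function types annotated with domain sort $s$ and codomain sort $s'$; abstractions; relevant application $t\,u$ and irrelevant application $t\div u$), modulo $\alpha$-equivalence; $[u/x]t$ is substitution. Contexts $\Gamma ::= ()\mid\Gamma.x\star T$. Resurrection $\Gamma^\oplus$ turns every $x\div T$ into $x:T$. Abbreviations: $\Gamma\vdash t\div T$ means $\Gamma^\oplus\vdash t:T$; $\Gamma\vdash t=t'\div T$ means $\Gamma\vdash t\div T$ and $\Gamma\vdash t'\div T$; $\Gamma\vdash T$ means $\Gamma\vdash T:s$ for some sort $s$; $\Gamma\vdash T=T'$ means $\Gamma\vdash T=T':s$ for some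 $s$. Rules: $\vdash()$; from $\vdash\Gamma$, $\Gamma\vdash T$ infer $\vdash\Gamma.x\star T$; from $\vdash\Gamma$, $(s,s')\in\mathsf{Axiom}$ infer $\Gamma\vdash s:s'$; from $\Gamma\vdash U:s_1$, $\Gamma.x\star U\vdash T:s_2$, $(s_1,s_2,s_3)\in\mathsf{Rule}$ infer $\Gamma\vdash(x\star U)\to^{s_1,s_2}T:s_3$; from $\vdash\Gamma$, $(x:U)\in\Gamma$ infer $\Gamma\vdash x:U$; from $\Gamma.x\star U\vdash t:T$, $\Gamma\vdash(x\star U)\to^{s,s'}T$ infer $\Gamma\vdash\lambda x\star U.t:(x\star U)\to^{s,s'}T$; from $\Gamma\vdash t:(x\star U)\to^{s,s'}T$, $\Gamma\vdash u\star U$ infer $\Gamma\vdash t\star u:[u/x]T$; from $\Gamma\vdash t:T$, $\Gamma\vdash T=T'$ infer $\Gamma\vdash t:T'$; $\beta$: from $\Gamma.x\star U\vdash t:T$, $\Gamma\vdash u\star U$ infer $\Gamma\vdash(\lambda x\star U.t)\star u=[u/x]t:[u/x]T$; $\eta$: from $\Gamma\vdash t:(x\star U)\to^{s,s'}T$ infer $\Gamma\vdash t=\lambda x\star U.(t\star x):(x\star U)\to^{s,s'}T$; reflexivity, symmetry, transitivity; congruence for function types (from $\Gamma\vdash U=U':s_1$, $\Gamma.x\star U\vdash T=T':s_2$, $(s_1,s_2,s_3)\in\mathsf{Rule}$), for abstractions (from $\Gamma\vdash U=U':s_1$, $\Gamma.x\star U\vdash T:s_2$, $\Gamma.x\star U\vdash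 t=t':T$ infer $\Gamma\vdash\lambda x\star U.t=\lambda x\star U'.t':(x\star U)\to^{s_1,s_2}T$), for application (from $\Gamma\vdash t=t':(x\star U)\to^{s,s'}T$ and $\Gamma\vdash u=u'\star U$ infer $\Gamma\vdash t\star u=t'\star u':[u/x]T$); conversion: from $\Gamma\vdash t=t':T$, $\Gamma\vdash T=T'$ infer $\Gamma\vdash t=t':T'$. Weak head normal forms $a,A ::= s\mid(x\star U)\to^{s,s'}T\mid\lambda x\star U.t\mid n$; neutrals $n,N ::= x\mid n\star u$. Weak head evaluation: $a\searrow a$ for whnf $a$; if $t\searrow f$ and $f\,@^\star u\searrow a$ then $t\star u\searrow a$; if $[u/x]t\searrow a$ then $(\lambda x\star U.t)\,@^\star u\searrow a$; $n\,@^\star u\searrow n\star u$. Algorithmic equality (mutually inductive; long arrows on whnf types): Type equality: $\Delta\vdash T\Longleftrightarrow_{\mathsf{ty}}T'$ if $T\searrow A$, $T'\searrow A'$, $\Delta\vdash A\longleftrightarrow_{\mathsf{ty}}A'$; $\Delta\vdash s\longleftrightarrow_{\mathsf{ty}}s$; $\Delta\vdash(x\star U)\to^{s,s'}T\longleftrightarrow_{\mathsf{ty}}(x\star U')\to^{s,s'}T'$ if $\Delta\vdash U\Longleftrightarrow_{\mathsf{ty}}U'$ and $\Delta.x\star U\vdash T\Longleftrightarrow_{\mathsf{ty}}T'$; $\Delta\vdash N\longleftrightarrow_{\mathsf{ty}}N'$ for neutrals if $\Delta\vdash N\Longleftrightarrow_{\mathsf{ne}}N':T$ for some $T$. Structural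 equality (type is output): $\Delta\vdash x\Longleftrightarrow_{\mathsf{ne}}x:T$ if $(x:T)\in\Delta$; $\Delta\vdash n\,u\Longleftrightarrow_{\mathsf{ne}}n'\,u':[u/x]T$ if $\Delta\vdash n\longleftrightarrow_{\mathsf{ne}}n':(x:U)\to^{s,s'}T$ and $\Delta\vdash u\Longleftrightarrow_{\mathsf{tm}}u':U$; $\Delta\vdash n\div u\Longleftrightarrow_{\mathsf{ne}}n'\div u':[u/x]T$ if $\Delta\vdash n\longleftrightarrow_{\mathsf{ne}}n':(x\div U)\to^{s,s'}T$; $\Delta\vdash n\longleftrightarrow_{\mathsf{ne}}n':A$ if $\Delta\vdash n\Longleftrightarrow_{\mathsf{ne}}n':T$ and $T\searrow A$. Type-directed equality: $\Delta\vdash t\Longleftrightarrow_{\mathsf{tm}}t':T$ if $T\searrow A$ and $\Delta\vdash t\longleftrightarrow_{\mathsf{tm}}t':A$; $\Delta\vdash t\longleftrightarrow_{\mathsf{tm}}t':(x\star U)\to^{s,s'}T$ if $\Delta.x\star U\vdash t\star x\Longleftrightarrow_{\mathsf{tm}}t'\star x:T$; $\Delta\vdash T\longleftrightarrow_{\mathsf{tm}}T':s$ if $\Delta\vdash T\Longleftrightarrow_{\mathsf{ty}}T'$; $\Delta\vdash t\longleftrightarrow_{\mathsf{tm}}t':N$ for neutral $N$ if $t\searrow n$, $t'\searrow n'$, and $\Delta\vdash n\Longleftrightarrow_{\mathsf{ne}}n':T$ for some $T$. *)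

theory Defs
  imports Main
begin

section \<open>Irrelevant Intensional Type Theory\<close>

subsection \<open>Syntax\<close>

datatype sort = SetS nat

definition Axiom :: "(sort \<times> sort) set" where
  "Axiom = {(SetS i, SetS (i + 1)) | i. True}"

definition Rule :: "(sort \<times> sort \<times> sort) set" where
  "Rule = {(SetS i, SetS j, SetS (max i j)) | i j. True}"

text \<open>Annotations: \<open>Rel\<close> is the colon, \<open>Irr\<close> the division sign.\<close>

datatype ann = Rel | Irr

text \<open>
  Expressions modulo \<open>\<alpha>\<close>-equivalence are represented by de Bruijn terms.
  \<open>Pi r s s' U T\<close> stands for the function type \<open>(x \<star> U) \<rightarrow>\<^sup>s\<^sup>,\<^sup>s\<^sup>' T\<close>; it binds
  one variable in \<open>T\<close>, and \<open>Lam r U t\<close> binds one variable in \<open>t\<close>.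
\<close>

datatype exp =
    Srt sort
  | Pi ann sort sort exp exp
  | Var nat
  | Lam ann exp exp
  | App ann exp exp

primrec lift_at :: "nat \<Rightarrow> exp \<Rightarrow> exp" where
  "lift_at k (Srt s) = Srt s"
| "lift_at k (Pi r s s' U T) = Pi r s s' (lift_at k U) (lift_at (Suc k) T)"
| "lift_at k (Var i) = (if i < k then Var i else Var (Suc i))"
| "lift_at k (Lam r U t) = Lam r (lift_at k U) (lift_at (Suc k) t)"
| "lift_at k (App r t u) = App r (lift_at k t) (lift_at k u)"

abbreviation lift :: "exp \<Rightarrow> exp" where
  "lift \<equiv> lift_at 0"

text \<open>
  \<open>subst_at k u t\<close> substitutes \<open>u\<close> for index \<open>k\<close> in \<open>t\<close> and removes \<open>k\<close> from the
  scope: indices above \<open>k\<close> are decremented.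
\<close>

primrec subst_at :: "nat \<Rightarrow> exp \<Rightarrow> exp \<Rightarrow> exp" where
  "subst_at k u (Srt s) = Srt s"
| "subst_at k u (Pi r s s' U T) = Pi r s s' (subst_at k u U) (subst_at (Suc k) (lift u) T)"
| "subst_at k u (Var i) = (if i < k then Var i else if i = k then u else Var (i - 1))"
| "subst_at k u (Lam r U t) = Lam r (subst_at k u U) (subst_at (Suc k) (lift u) t)"
| "subst_at k u (App r t v) = App r (subst_at k u t) (subst_at k u v)"

abbreviation subst :: "exp \<Rightarrow> exp \<Rightarrow> exp" where
  "subst \<equiv> subst_at 0"

subsection \<open>Contexts\<close>

text \<open>
  The head of the list is the most recent binding, so \<open>\<Gamma>.x\<star>T\<close> is \<open>(r, T) # \<Gamma>\<close>,
  and the type of an entry lives in the scope of the tail of the list.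
\<close>

type_synonym ctx = "(ann \<times> exp) list"

text \<open>\<open>in_ctx x r T \<Gamma>\<close>: variable \<open>x\<close> is bound in \<open>\<Gamma>\<close> with annotation \<open>r\<close> and with
  type \<open>T\<close>, where \<open>T\<close> is weakened to the scope of the whole of \<open>\<Gamma>\<close>.\<close>

inductive in_ctx :: "nat \<Rightarrow> ann \<Rightarrow> exp \<Rightarrow> ctx \<Rightarrow> bool" where
  in_ctx_here: "in_ctx 0 r (lift T) ((r, T) # \<Gamma>)"
| in_ctx_there: "in_ctx x r T \<Gamma> \<Longrightarrow> in_ctx (Suc x) r (lift T) (b # \<Gamma>)"

definition resurrect :: "ctx \<Rightarrow> ctx" where
  "resurrect \<Gamma> = map (\<lambda>(r, T). (Rel, T)) \<Gamma>"

text \<open>The judgement \<open>\<Gamma> \<turnstile> u \<star> U\<close> is typing of \<open>u\<close> in \<open>ctx_for \<star> \<Gamma>\<close>.\<close>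

primrec ctx_for :: "ann \<Rightarrow> ctx \<Rightarrow> ctx" where
  "ctx_for Rel \<Gamma> = \<Gamma>"
| "ctx_for Irr \<Gamma> = resurrect \<Gamma>"

subsection \<open>Declarative typing and equality\<close>

text \<open>
  A premise \<open>\<Gamma> \<turnstile> T\<close> (or \<open>\<Gamma> \<turnstile> T = T'\<close>) is rendered as typing (or equality) at
  \<open>Srt s\<close> with \<open>s\<close> occurring only in the premise.  Congruence of application
  is split by annotation, since \<open>\<Gamma> \<turnstile> u = u' \<div> U\<close> means that \<open>u\<close> and \<open>u'\<close>
  are both typed by \<open>U\<close> in the resurrected context.
\<close>

inductive wf_ctx :: "ctx \<Rightarrow> bool" ("\<turnstile> _" [50] 50)
  and typing :: "ctx \<Rightarrow> exp \<Rightarrow> exp \<Rightarrow> bool" ("_ \<turnstile> _ \<^bold>: _" [51, 51, 51] 50)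
  and equal :: "ctx \<Rightarrow> exp \<Rightarrow> exp \<Rightarrow> exp \<Rightarrow> bool" ("_ \<turnstile> _ \<^bold>= _ \<^bold>: _" [51, 51, 51, 51] 50)
where
  wf_nil: "\<turnstile> []"
| wf_cons: "\<turnstile> \<Gamma> \<Longrightarrow> \<Gamma> \<turnstile> T \<^bold>: Srt s \<Longrightarrow> \<turnstile> (r, T) # \<Gamma>"

| ty_sort: "\<turnstile> \<Gamma> \<Longrightarrow> (s, s') \<in> Axiom \<Longrightarrow> \<Gamma> \<turnstile> Srt s \<^bold>: Srt s'"
| ty_pi: "\<Gamma> \<turnstile> U \<^bold>: Srt s1 \<Longrightarrow> (r, U) # \<Gamma> \<turnstile> T \<^bold>: Srt s2 \<Longrightarrow> (s1, s2, s3) \<in> Rule \<Longrightarrow>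
    \<Gamma> \<turnstile> Pi r s1 s2 U T \<^bold>: Srt s3"
| ty_var: "\<turnstile> \<Gamma> \<Longrightarrow> in_ctx x Rel U \<Gamma> \<Longrightarrow> \<Gamma> \<turnstile> Var x \<^bold>: U"
| ty_lam: "(r, U) # \<Gamma> \<turnstile> t \<^bold>: T \<Longrightarrow> \<Gamma> \<turnstile> Pi r s s' U T \<^bold>: Srt s3 \<Longrightarrow>
    \<Gamma> \<turnstile> Lam r U t \<^bold>: Pi r s s' U T"
| ty_app: "\<Gamma> \<turnstile> t \<^bold>: Pi r s s' U T \<Longrightarrow> ctx_for r \<Gamma> \<turnstile> u \<^bold>: U \<Longrightarrow>
    \<Gamma> \<turnstile> App r t u \<^bold>: subst u T"
| ty_conv: "\<Gamma> \<turnstile> t \<^bold>: T \<Longrightarrow> \<Gamma> \<turnstile> T \<^bold>= T' \<^bold>: Srt s \<Longrightarrow> \<Gamma> \<turnstile> t \<^bold>: T'"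

| eq_beta: "(r, U) # \<Gamma> \<turnstile> t \<^bold>: T \<Longrightarrow> ctx_for r \<Gamma> \<turnstile> u \<^bold>: U \<Longrightarrow>
    \<Gamma> \<turnstile> App r (Lam r U t) u \<^bold>= subst u t \<^bold>: subst u T"
| eq_eta: "\<Gamma> \<turnstile> t \<^bold>: Pi r s s' U T \<Longrightarrow>
    \<Gamma> \<turnstile> t \<^bold>= Lam r U (App r (lift t) (Var 0)) \<^bold>: Pi r s s' U T"
| eq_refl: "\<Gamma> \<turnstile> t \<^bold>: T \<Longrightarrow> \<Gamma> \<turnstile> t \<^bold>= t \<^bold>: T"
| eq_sym: "\<Gamma> \<turnstile> t \<^bold>= t' \<^bold>: T \<Longrightarrow> \<Gamma> \<turnstile> t' \<^bold>= t \<^bold>: T"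
| eq_trans: "\<Gamma> \<turnstile> t1 \<^bold>= t2 \<^bold>: T \<Longrightarrow> \<Gamma> \<turnstile> t2 \<^bold>= t3 \<^bold>: T \<Longrightarrow> \<Gamma> \<turnstile> t1 \<^bold>= t3 \<^bold>: T"
| eq_pi: "\<Gamma> \<turnstile> U \<^bold>= U' \<^bold>: Srt s1 \<Longrightarrow> (r, U) # \<Gamma> \<turnstile> T \<^bold>= T' \<^bold>: Srt s2 \<Longrightarrow>
    (s1, s2, s3) \<in> Rule \<Longrightarrow> \<Gamma> \<turnstile> Pi r s1 s2 U T \<^bold>= Pi r s1 s2 U' T' \<^bold>: Srt s3"
| eq_lam: "\<Gamma> \<turnstile> U \<^bold>= U' \<^bold>: Srt s1 \<Longrightarrow> (r, U) # \<Gamma> \<turnstile> T \<^bold>: Srt s2 \<Longrightarrow>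
    (r, U) # \<Gamma> \<turnstile> t \<^bold>= t' \<^bold>: T \<Longrightarrow>
    \<Gamma> \<turnstile> Lam r U t \<^bold>= Lam r U' t' \<^bold>: Pi r s1 s2 U T"
| eq_app_rel: "\<Gamma> \<turnstile> t \<^bold>= t' \<^bold>: Pi Rel s s' U T \<Longrightarrow> \<Gamma> \<turnstile> u \<^bold>= u' \<^bold>: U \<Longrightarrow>
    \<Gamma> \<turnstile> App Rel t u \<^bold>= App Rel t' u' \<^bold>: subst u T"
| eq_app_irr: "\<Gamma> \<turnstile> t \<^bold>= t' \<^bold>: Pi Irr s s' U T \<Longrightarrow>
    resurrect \<Gamma> \<turnstile> u \<^bold>: U \<Longrightarrow> resurrect \<Gamma> \<turnstile> u' \<^bold>: U \<Longrightarrow>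
    \<Gamma> \<turnstile> App Irr t u \<^bold>= App Irr t' u' \<^bold>: subst u T"
| eq_conv: "\<Gamma> \<turnstile> t \<^bold>= t' \<^bold>: T \<Longrightarrow> \<Gamma> \<turnstile> T \<^bold>= T' \<^bold>: Srt s \<Longrightarrow> \<Gamma> \<turnstile> t \<^bold>= t' \<^bold>: T'"

definition ty_equal :: "ctx \<Rightarrow> exp \<Rightarrow> exp \<Rightarrow> bool" ("_ \<turnstile> _ \<^bold>= _" [51, 51, 51] 50) where
  "\<Gamma> \<turnstile> T \<^bold>= T' \<longleftrightarrow> (\<exists>s. \<Gamma> \<turnstile> T \<^bold>= T' \<^bold>: Srt s)"

subsection \<open>Weak head evaluation\<close>

primrec neutral :: "exp \<Rightarrow> bool" where
  "neutral (Srt s) = False"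
| "neutral (Pi r s s' U T) = False"
| "neutral (Var x) = True"
| "neutral (Lam r U t) = False"
| "neutral (App r n u) = neutral n"

inductive whnf :: "exp \<Rightarrow> bool" where
  whnf_srt: "whnf (Srt s)"
| whnf_pi: "whnf (Pi r s s' U T)"
| whnf_lam: "whnf (Lam r U t)"
| whnf_ne: "neutral n \<Longrightarrow> whnf n"

text \<open>\<open>f @[r] u \<searrow> a\<close> is active application of the weak head normal form \<open>f\<close>.\<close>

inductive eval :: "exp \<Rightarrow> exp \<Rightarrow> bool" ("_ \<searrow> _" [51, 51] 50)
  and eval_app :: "exp \<Rightarrow> ann \<Rightarrow> exp \<Rightarrow> exp \<Rightarrow> bool" ("_ @[_] _ \<searrow> _" [51, 0, 51, 51] 50)
where
  eval_whnf: "whnf a \<Longrightarrow> a \<searrow> a"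
| eval_App: "t \<searrow> f \<Longrightarrow> f @[r] u \<searrow> a \<Longrightarrow> App r t u \<searrow> a"
| eval_app_lam: "subst u t \<searrow> a \<Longrightarrow> Lam r U t @[r] u \<searrow> a"
| eval_app_ne: "neutral n \<Longrightarrow> n @[r] u \<searrow> App r n u"

subsection \<open>Algorithmic equality\<close>

text \<open>
  The double arrows are the judgements on arbitrary types, the single long arrows
  those on weak head normal types.  Premises \<open>neutral _\<close> spell out the
  convention that \<open>n\<close> and \<open>N\<close> range over neutral expressions.
\<close>

inductive
      alg_ty :: "ctx \<Rightarrow> exp \<Rightarrow> exp \<Rightarrow> bool"
        ("_ \<turnstile> _ \<Longleftrightarrow>\<^sub>t\<^sub>y _" [51, 51, 51] 50)
  and alg_ty_whnf :: "ctx \<Rightarrow> exp \<Rightarrow> exp \<Rightarrow> bool"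
        ("_ \<turnstile> _ \<longleftrightarrow>\<^sub>t\<^sub>y _" [51, 51, 51] 50)
  and alg_ne :: "ctx \<Rightarrow> exp \<Rightarrow> exp \<Rightarrow> exp \<Rightarrow> bool"
        ("_ \<turnstile> _ \<Longleftrightarrow>\<^sub>n\<^sub>e _ \<^bold>: _" [51, 51, 51, 51] 50)
  and alg_ne_whnf :: "ctx \<Rightarrow> exp \<Rightarrow> exp \<Rightarrow> exp \<Rightarrow> bool"
        ("_ \<turnstile> _ \<longleftrightarrow>\<^sub>n\<^sub>e _ \<^bold>: _" [51, 51, 51, 51] 50)
  and alg_tm :: "ctx \<Rightarrow> exp \<Rightarrow> exp \<Rightarrow> exp \<Rightarrow> bool"
        ("_ \<turnstile> _ \<Longleftrightarrow>\<^sub>t\<^sub>m _ \<^bold>: _" [51, 51, 51, 51] 50)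
  and alg_tm_whnf :: "ctx \<Rightarrow> exp \<Rightarrow> exp \<Rightarrow> exp \<Rightarrow> bool"
        ("_ \<turnstile> _ \<longleftrightarrow>\<^sub>t\<^sub>m _ \<^bold>: _" [51, 51, 51, 51] 50)
where
  alg_ty_eval: "T \<searrow> A \<Longrightarrow> T' \<searrow> A' \<Longrightarrow> \<Delta> \<turnstile> A \<longleftrightarrow>\<^sub>t\<^sub>y A' \<Longrightarrow> \<Delta> \<turnstile> T \<Longleftrightarrow>\<^sub>t\<^sub>y T'"

| alg_ty_sort: "\<Delta> \<turnstile> Srt s \<longleftrightarrow>\<^sub>t\<^sub>y Srt s"
| alg_ty_pi: "\<Delta> \<turnstile> U \<Longleftrightarrow>\<^sub>t\<^sub>y U' \<Longrightarrow> (r, U) # \<Delta> \<turnstile> T \<Longleftrightarrow>\<^sub>t\<^sub>y T' \<Longrightarrow>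
    \<Delta> \<turnstile> Pi r s s' U T \<longleftrightarrow>\<^sub>t\<^sub>y Pi r s s' U' T'"
| alg_ty_ne: "neutral N \<Longrightarrow> neutral N' \<Longrightarrow> \<Delta> \<turnstile> N \<Longleftrightarrow>\<^sub>n\<^sub>e N' \<^bold>: T \<Longrightarrow>
    \<Delta> \<turnstile> N \<longleftrightarrow>\<^sub>t\<^sub>y N'"

| alg_ne_var: "in_ctx x Rel T \<Delta> \<Longrightarrow> \<Delta> \<turnstile> Var x \<Longleftrightarrow>\<^sub>n\<^sub>e Var x \<^bold>: T"
| alg_ne_app_rel: "neutral n \<Longrightarrow> neutral n' \<Longrightarrow>
    \<Delta> \<turnstile> n \<longleftrightarrow>\<^sub>n\<^sub>e n' \<^bold>: Pi Rel s s' U T \<Longrightarrow> \<Delta> \<turnstile> u \<Longleftrightarrow>\<^sub>t\<^sub>m u' \<^bold>: U \<Longrightarrow>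
    \<Delta> \<turnstile> App Rel n u \<Longleftrightarrow>\<^sub>n\<^sub>e App Rel n' u' \<^bold>: subst u T"
| alg_ne_app_irr: "neutral n \<Longrightarrow> neutral n' \<Longrightarrow>
    \<Delta> \<turnstile> n \<longleftrightarrow>\<^sub>n\<^sub>e n' \<^bold>: Pi Irr s s' U T \<Longrightarrow>
    \<Delta> \<turnstile> App Irr n u \<Longleftrightarrow>\<^sub>n\<^sub>e App Irr n' u' \<^bold>: subst u T"

| alg_ne_eval: "neutral n \<Longrightarrow> neutral n' \<Longrightarrow> \<Delta> \<turnstile> n \<Longleftrightarrow>\<^sub>n\<^sub>e n' \<^bold>: T \<Longrightarrow> T \<searrow> A \<Longrightarrow>
    \<Delta> \<turnstile> n \<longleftrightarrow>\<^sub>n\<^sub>e n' \<^bold>: A"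

| alg_tm_eval: "T \<searrow> A \<Longrightarrow> \<Delta> \<turnstile> t \<longleftrightarrow>\<^sub>t\<^sub>m t' \<^bold>: A \<Longrightarrow> \<Delta> \<turnstile> t \<Longleftrightarrow>\<^sub>t\<^sub>m t' \<^bold>: T"

| alg_tm_pi: "(r, U) # \<Delta> \<turnstile> App r (lift t) (Var 0) \<Longleftrightarrow>\<^sub>t\<^sub>m App r (lift t') (Var 0) \<^bold>: T \<Longrightarrow>
    \<Delta> \<turnstile> t \<longleftrightarrow>\<^sub>t\<^sub>m t' \<^bold>: Pi r s s' U T"
| alg_tm_sort: "\<Delta> \<turnstile> T \<Longleftrightarrow>\<^sub>t\<^sub>y T' \<Longrightarrow> \<Delta> \<turnstile> T \<longleftrightarrow>\<^sub>t\<^sub>m T' \<^bold>: Srt s"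
| alg_tm_ne: "neutral N \<Longrightarrow> t \<searrow> n \<Longrightarrow> t' \<searrow> n' \<Longrightarrow> neutral n \<Longrightarrow> neutral n' \<Longrightarrow>
    \<Delta> \<turnstile> n \<Longleftrightarrow>\<^sub>n\<^sub>e n' \<^bold>: T \<Longrightarrow> \<Delta> \<turnstile> t \<longleftrightarrow>\<^sub>t\<^sub>m t' \<^bold>: N"

end

(*
  The crux is injectivity of function types for declarative equality, which subject reduction of weak head
  evaluation, and hence soundness of every evaluation step of the algorithm, depends on.  It is read off a
  Kripke logical relation whose worlds are contexts under renaming: related types evaluate to sorts, to
  function types with related components, or to neutral types that are declaratively equal, and terms
  of a neutral type are related when they are declaratively equal.  Predicativity lets the relation on the
  terms of Set_k be the relation on types of level k.  Irrelevant arguments are never evaluated, so the relation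
  demands of them only that they are well typed in the resurrected context.
*)
theory Submission
  imports Defs
begin

subsection \<open>Parallel renaming and substitution\<close>

text \<open>Two obstacles shape the proof. An equality derivation does not visibly type its two
  sides, so every semantic notion carries declarative equality together with both typings
  (\<open>teq\<close>); these typings are recovered for arbitrary equations only by the fundamental
  theorem at the identity substitution (\<open>equal_teq\<close>). And the relation is by nature
  inductive-recursive: the clause for function types mentions related arguments in a negative
  position. \<open>LR\<close> is therefore the graph of that recursion, with the term relation as an
  output that is shown unique afterwards. Uniqueness of sorts is itself a late result. Until then
  type equality at unspecified sorts is not known to be transitive, because two adjacent equations
  may hold at different sorts; inversion of typing has to tolerate this. The soundness statement for
  neutrals must allow two different types for the two sides: inverting two applications yields two
  function types that are not known to be equal. The inferred type is shown equal to both of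
  them.\<close>

primrec rn :: "(nat \<Rightarrow> nat) \<Rightarrow> exp \<Rightarrow> exp" where
  "rn \<rho> (Srt s) = Srt s"
| "rn \<rho> (Pi r s s' U T) = Pi r s s' (rn \<rho> U) (rn (case_nat 0 (\<lambda>x. Suc (\<rho> x))) T)"
| "rn \<rho> (Var x) = Var (\<rho> x)"
| "rn \<rho> (Lam r U t) = Lam r (rn \<rho> U) (rn (case_nat 0 (\<lambda>x. Suc (\<rho> x))) t)"
| "rn \<rho> (App r t u) = App r (rn \<rho> t) (rn \<rho> u)"

definition up :: "(nat \<Rightarrow> exp) \<Rightarrow> nat \<Rightarrow> exp" where
  "up \<sigma> = case_nat (Var 0) (\<lambda>x. rn Suc (\<sigma> x))"

primrec sb :: "(nat \<Rightarrow> exp) \<Rightarrow> exp \<Rightarrow> exp" where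
  "sb \<sigma> (Srt s) = Srt s"
| "sb \<sigma> (Pi r s s' U T) = Pi r s s' (sb \<sigma> U) (sb (up \<sigma>) T)"
| "sb \<sigma> (Var x) = \<sigma> x"
| "sb \<sigma> (Lam r U t) = Lam r (sb \<sigma> U) (sb (up \<sigma>) t)"
| "sb \<sigma> (App r t u) = App r (sb \<sigma> t) (sb \<sigma> u)"

lemma up_simps [simp]: "up \<sigma> 0 = Var 0" "up \<sigma> (Suc x) = rn Suc (\<sigma> x)"
  by (simp_all add: up_def)

lemma sb_cong: "(\<And>x. \<sigma> x = \<tau> x) \<Longrightarrow> sb \<sigma> t = sb \<tau> t"
  by (metis ext)

lemma rn_eq_sb: "rn \<rho> t = sb (\<lambda>x. Var (\<rho> x)) t"
proof (induction t arbitrary: \<rho>)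
  case (Pi r s s' U T)
  have "up (\<lambda>x. Var (\<rho> x)) = (\<lambda>x. Var (case_nat 0 (\<lambda>x. Suc (\<rho> x)) x))"
    by (rule ext) (simp add: up_def split: nat.split)
  with Pi show ?case by simp
next
  case (Lam r U t)
  have "up (\<lambda>x. Var (\<rho> x)) = (\<lambda>x. Var (case_nat 0 (\<lambda>x. Suc (\<rho> x)) x))"
    by (rule ext) (simp add: up_def split: nat.split)
  with Lam show ?case by simp
qed auto

lemma up_Var: "up Var = Var"
  by (rule ext) (simp add: up_def split: nat.split)

lemma sb_Var [simp]: "sb Var t = t"
  by (induction t) (simp_all add: up_Var)

lemma rn_id [simp]: "rn (\<lambda>x. x) t = t"
  by (simp add: rn_eq_sb)

text \<open>The fusion laws build on each other: the binder case of \<open>rn_sb\<close> needs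
  \<open>rn_rn\<close>, which comes from \<open>sb_rn\<close>, and that of \<open>sb_sb\<close>
  needs both \<open>rn_sb\<close> and \<open>sb_rn\<close>.\<close>

lemma sb_rn: "sb \<sigma> (rn \<rho> t) = sb (\<lambda>x. \<sigma> (\<rho> x)) t"
proof (induction t arbitrary: \<sigma> \<rho>)
  case (Pi r s s' U T)
  have "(\<lambda>x. up \<sigma> (case_nat 0 (\<lambda>x. Suc (\<rho> x)) x)) = up (\<lambda>x. \<sigma> (\<rho> x))"
    by (rule ext) (simp add: up_def split: nat.split)
  with Pi show ?case by simp
next
  case (Lam r U t)
  have "(\<lambda>x. up \<sigma> (case_nat 0 (\<lambda>x. Suc (\<rho> x)) x)) = up (\<lambda>x. \<sigma> (\<rho> x))"
    by (rule ext) (simp add: up_def split: nat.split)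
  with Lam show ?case by simp
qed auto

lemma rn_rn: "rn \<rho> (rn \<rho>' t) = rn (\<lambda>x. \<rho> (\<rho>' x)) t"
  by (simp add: rn_eq_sb[of \<rho>] sb_rn) (simp add: rn_eq_sb)

lemma rn_sb: "rn \<rho> (sb \<sigma> t) = sb (\<lambda>x. rn \<rho> (\<sigma> x)) t"
proof (induction t arbitrary: \<sigma> \<rho>)
  case (Pi r s s' U T)
  have "(\<lambda>x. rn (case_nat 0 (\<lambda>x. Suc (\<rho> x))) (up \<sigma> x)) = up (\<lambda>x. rn \<rho> (\<sigma> x))"
    by (rule ext) (simp add: up_def rn_rn split: nat.split)
  with Pi show ?case by simp
next
  case (Lam r U t)
  have "(\<lambda>x. rn (case_nat 0 (\<lambda>x. Suc (\<rho> x))) (up \<sigma> x)) = up (\<lambda>x. rn \<rho> (\<sigma> x))"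
    by (rule ext) (simp add: up_def rn_rn split: nat.split)
  with Lam show ?case by simp
qed auto

lemma sb_sb: "sb \<sigma> (sb \<tau> t) = sb (\<lambda>x. sb \<sigma> (\<tau> x)) t"
proof (induction t arbitrary: \<sigma> \<tau>)
  case (Pi r s s' U T)
  have "(\<lambda>x. sb (up \<sigma>) (up \<tau> x)) = up (\<lambda>x. sb \<sigma> (\<tau> x))"
    by (rule ext) (simp add: up_def rn_sb sb_rn split: nat.split)
  with Pi show ?case by simp
next
  case (Lam r U t)
  have "(\<lambda>x. sb (up \<sigma>) (up \<tau> x)) = up (\<lambda>x. sb \<sigma> (\<tau> x))"
    by (rule ext) (simp add: up_def rn_sb sb_rn split: nat.split)
  with Lam show ?case by simp
qed auto

text \<open>With \<open>subst_at_eq_sb\<close>, the bridge from the index-shifting operations of the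
  definitions to the parallel ones, for which the fusion laws hold.\<close>

lemma lift_at_eq_rn: "lift_at k t = rn (\<lambda>i. if i < k then i else Suc i) t"
proof (induction t arbitrary: k)
  case (Pi r s s' U T)
  have "case_nat 0 (\<lambda>x. Suc (if x < k then x else Suc x)) = (\<lambda>i. if i < Suc k then i else Suc i)"
    by (rule ext) (auto split: nat.split)
  with Pi show ?case by simp
next
  case (Lam r U t)
  have "case_nat 0 (\<lambda>x. Suc (if x < k then x else Suc x)) = (\<lambda>i. if i < Suc k then i else Suc i)"
    by (rule ext) (auto split: nat.split)
  with Lam show ?case by simp
qed auto

lemma lift_eq_rn: "lift t = rn Suc t"
  by (simp add: lift_at_eq_rn)

lemma subst_at_eq_sb:
  "subst_at k u t = sb (\<lambda>i. if i < k then Var i else if i = k then u else Var (i - 1)) t"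
proof (induction t arbitrary: k u)
  case (Pi r s s' U T)
  have "up (\<lambda>i. if i < k then Var i else if i = k then u else Var (i - 1)) =
    (\<lambda>i. if i < Suc k then Var i else if i = Suc k then lift u else Var (i - 1))"
    by (rule ext) (auto simp: up_def lift_eq_rn split: nat.split)
  with Pi show ?case by simp
next
  case (Lam r U t)
  have "up (\<lambda>i. if i < k then Var i else if i = k then u else Var (i - 1)) =
    (\<lambda>i. if i < Suc k then Var i else if i = Suc k then lift u else Var (i - 1))"
    by (rule ext) (auto simp: up_def lift_eq_rn split: nat.split)
  with Lam show ?case by simp
qed auto

lemma subst_eq_sb: "subst u t = sb (case_nat u Var) t"
  unfolding subst_at_eq_sb by (rule sb_cong) (auto split: nat.split)

lemmas sb_simps = lift_eq_rn subst_eq_sb sb_sb sb_rn rn_sb rn_rn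

lemma sb_subst: "sb \<sigma> (subst u t) = subst (sb \<sigma> u) (sb (up \<sigma>) t)"
  by (auto simp: sb_simps intro!: sb_cong split: nat.split)

lemma sb_lift: "sb (up \<sigma>) (lift t) = lift (sb \<sigma> t)"
  by (auto simp: sb_simps intro!: sb_cong split: nat.split)

lemma subst_sb_up: "subst u (sb (up \<sigma>) t) = sb (case_nat u \<sigma>) t"
  by (auto simp: sb_simps intro!: sb_cong split: nat.split)

lemma rn_eq_sb_up: "rn (case_nat 0 (\<lambda>x. Suc (\<rho> x))) t = sb (up (\<lambda>x. Var (\<rho> x))) t"
  by (auto simp: rn_eq_sb up_def intro!: sb_cong split: nat.split)

lemma rn_subst: "rn \<rho> (subst u t) = subst (rn \<rho> u) (rn (case_nat 0 (\<lambda>x. Suc (\<rho> x))) t)"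
  unfolding rn_eq_sb_up rn_eq_sb[of \<rho>] by (rule sb_subst)

lemma rn_lift: "rn (case_nat 0 (\<lambda>x. Suc (\<rho> x))) (lift t) = lift (rn \<rho> t)"
  by (simp add: lift_eq_rn rn_rn)

text \<open>Needed for eta: applying a weakened function to the fresh variable gives back the
  original codomain.\<close>

lemma subst_Var0_rn: "subst (Var 0) (rn (case_nat 0 (\<lambda>x. Suc (Suc x))) t) = t"
proof -
  have "sb (\<lambda>x. case_nat (Var 0) Var (case_nat 0 (\<lambda>x. Suc (Suc x)) x)) t = sb Var t"
    by (rule sb_cong) (simp split: nat.split)
  then show ?thesis by (simp add: subst_eq_sb sb_rn)
qed

subsection \<open>Renaming and substitution lemmas\<close>

lemma in_ctx_ConsE:
  assumes "in_ctx x r T ((r', U) # \<Gamma>)"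
  obtains (here) "x = 0" "r = r'" "T = lift U"
  | (there) y S where "x = Suc y" "in_ctx y r S \<Gamma>" "T = lift S"
  using assms by (cases rule: in_ctx.cases) auto

inductive_cases in_ctx_NilE: "in_ctx x r T []"
inductive_cases in_ctx_0E: "in_ctx 0 r T \<Gamma>"
inductive_cases in_ctx_SucE: "in_ctx (Suc x) r T \<Gamma>"

lemma in_ctx_fun: "in_ctx x r T \<Gamma> \<Longrightarrow> in_ctx x r' T' \<Gamma> \<Longrightarrow> r = r' \<and> T = T'"
proof (induction arbitrary: r' T' rule: in_ctx.induct)
  case (in_ctx_here r T \<Gamma>)
  then show ?case by (auto elim: in_ctx_0E)
next
  case (in_ctx_there x r T \<Gamma> b)
  from in_ctx_there.prems show ?case
    by (rule in_ctx_SucE) (use in_ctx_there.IH in auto)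
qed

section \<open>Resurrection and promotion of annotations\<close>

lemma resurrect_simps [simp]:
  "resurrect [] = []" "resurrect ((r, U) # \<Gamma>) = (Rel, U) # resurrect \<Gamma>"
  "resurrect (resurrect \<Gamma>) = resurrect \<Gamma>"
  by (auto simp: resurrect_def)

lemma resurrect_ctx_for [simp]:
  "resurrect (ctx_for r \<Gamma>) = resurrect \<Gamma>" "ctx_for r (resurrect \<Gamma>) = resurrect \<Gamma>"
  by (cases r; simp)+

text \<open>Resurrection changes every entry, but an entry added under a binder keeps the annotation
  of that binder. The induction showing that resurrection preserves judgements thus needs contexts
  in which only some entries are promoted.\<close>

definition promotes :: "ctx \<Rightarrow> ctx \<Rightarrow> bool" where
  "promotes = list_all2 (\<lambda>(r, T) (r', T'). T = T' \<and> (r = Rel \<longrightarrow> r' = Rel))"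

lemma promotes_Cons [intro]: "promotes \<Gamma> \<Gamma>' \<Longrightarrow> promotes ((r, U) # \<Gamma>) ((r, U) # \<Gamma>')"
  by (simp add: promotes_def)

lemma promotes_resurrect: "promotes \<Gamma> (resurrect \<Gamma>)"
  by (induction \<Gamma>) (auto simp: promotes_def)

lemma resurrect_promotes: "promotes \<Gamma> \<Gamma>' \<Longrightarrow> resurrect \<Gamma>' = resurrect \<Gamma>"
proof (induction \<Gamma> arbitrary: \<Gamma>')
  case (Cons a \<Gamma>)
  then show ?case by (cases \<Gamma>') (auto simp: promotes_def)
qed (auto simp: promotes_def)

lemma in_ctx_promotes:
  "in_ctx x r T \<Gamma> \<Longrightarrow> promotes \<Gamma> \<Gamma>' \<Longrightarrow> \<exists>r'. (r = Rel \<longrightarrow> r' = Rel) \<and> in_ctx x r' T \<Gamma>'"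
proof (induction arbitrary: \<Gamma>' rule: in_ctx.induct)
  case (in_ctx_here r T \<Gamma>)
  then show ?case by (cases \<Gamma>') (auto simp: promotes_def intro: in_ctx.intros)
next
  case (in_ctx_there x r T \<Gamma> b)
  then obtain b' \<Gamma>'' where "\<Gamma>' = b' # \<Gamma>''" "promotes \<Gamma> \<Gamma>''"
    by (cases \<Gamma>') (auto simp: promotes_def)
  with in_ctx_there show ?case by (blast intro: in_ctx.intros)
qed

lemma promotes_ctx_for: "promotes \<Gamma> \<Gamma>' \<Longrightarrow> promotes (ctx_for r \<Gamma>) (ctx_for r \<Gamma>')"
  by (cases r) (auto simp: resurrect_promotes promotes_def list_all2_same)

lemma promote:
  "\<turnstile> \<Gamma> \<Longrightarrow> \<forall>\<Gamma>'. promotes \<Gamma> \<Gamma>' \<longrightarrow> \<turnstile> \<Gamma>'"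
  "\<Gamma> \<turnstile> t \<^bold>: T \<Longrightarrow> \<forall>\<Gamma>'. promotes \<Gamma> \<Gamma>' \<longrightarrow> \<Gamma>' \<turnstile> t \<^bold>: T"
  "\<Gamma> \<turnstile> t \<^bold>= t' \<^bold>: T \<Longrightarrow> \<forall>\<Gamma>'. promotes \<Gamma> \<Gamma>' \<longrightarrow> \<Gamma>' \<turnstile> t \<^bold>= t' \<^bold>: T"
proof (induction rule: wf_ctx_typing_equal.inducts)
  case wf_nil
  then show ?case by (auto simp: promotes_def intro: wf_ctx_typing_equal.intros)
next
  case (wf_cons \<Gamma> T s r)
  show ?case
  proof (intro allI impI)
    fix \<Gamma>' assume "promotes ((r, T) # \<Gamma>) \<Gamma>'"
    then obtain r' \<Gamma>'' where "\<Gamma>' = (r', T) # \<Gamma>''" "promotes \<Gamma> \<Gamma>''"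
      by (cases \<Gamma>') (auto simp: promotes_def)
    with wf_cons show "\<turnstile> \<Gamma>'" by (auto intro: wf_ctx_typing_equal.intros)
  qed
next
  case (ty_var \<Gamma> x U)
  then show ?case by (metis in_ctx_promotes wf_ctx_typing_equal.ty_var)
next
  case (ty_app \<Gamma> t r s s' U T u)
  then show ?case by (blast intro: wf_ctx_typing_equal.ty_app promotes_ctx_for)
next
  case (eq_beta r U \<Gamma> t T u)
  then show ?case by (blast intro: wf_ctx_typing_equal.eq_beta promotes_ctx_for)
next
  case (eq_app_irr \<Gamma> t t' s s' U T u u')
  then show ?case
    using promotes_ctx_for[where r = Irr] by (fastforce intro: wf_ctx_typing_equal.eq_app_irr)
next
  case (ty_lam r U \<Gamma> t T s s' s3)
  then show ?case by (meson wf_ctx_typing_equal.ty_lam promotes_Cons)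
next
  case (ty_pi \<Gamma> U s1 r T s2 s3)
  then show ?case by (meson wf_ctx_typing_equal.ty_pi promotes_Cons)
next
  case (eq_lam \<Gamma> U U' s1 r T s2 t t')
  then show ?case by (meson wf_ctx_typing_equal.eq_lam promotes_Cons)
next
  case (eq_pi \<Gamma> U U' s1 r T T' s2 s3)
  then show ?case by (meson wf_ctx_typing_equal.eq_pi promotes_Cons)
qed (meson wf_ctx_typing_equal.intros)+

lemma resurrect_wf: "\<turnstile> \<Gamma> \<Longrightarrow> \<turnstile> resurrect \<Gamma>"
  and resurrect_typing: "\<Gamma> \<turnstile> t \<^bold>: T \<Longrightarrow> resurrect \<Gamma> \<turnstile> t \<^bold>: T"
  and resurrect_equal: "\<Gamma> \<turnstile> t \<^bold>= t' \<^bold>: T \<Longrightarrow> resurrect \<Gamma> \<turnstile> t \<^bold>= t' \<^bold>: T"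
  using promote promotes_resurrect by blast+

lemma ctx_for_wf: "\<turnstile> \<Gamma> \<Longrightarrow> \<turnstile> ctx_for r \<Gamma>"
  and ctx_for_equal: "\<Gamma> \<turnstile> t \<^bold>= t' \<^bold>: T \<Longrightarrow> ctx_for r \<Gamma> \<turnstile> t \<^bold>= t' \<^bold>: T"
  by (cases r; simp add: resurrect_wf resurrect_typing resurrect_equal)+

lemma in_ctx_resurrect: "in_ctx x r T \<Gamma> \<Longrightarrow> in_ctx x Rel T (resurrect \<Gamma>)"
proof (induction rule: in_ctx.induct)
  case (in_ctx_there x r T \<Gamma> b)
  then show ?case by (cases b) (auto intro: in_ctx.intros)
qed (auto intro: in_ctx.intros)

lemma in_ctx_resurrectD: "in_ctx x r T (resurrect \<Gamma>) \<Longrightarrow> r = Rel \<and> (\<exists>r'. in_ctx x r' T \<Gamma>)"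
proof (induction \<Gamma> arbitrary: x T)
  case (Cons a \<Gamma>)
  then show ?case by (cases a) (fastforce elim!: in_ctx_ConsE intro: in_ctx.intros)
qed (auto elim: in_ctx_NilE)

lemma in_ctx_for: "in_ctx x r T \<Gamma> \<Longrightarrow> in_ctx x Rel T (ctx_for r \<Gamma>)"
  by (cases r) (auto intro: in_ctx_resurrect)

text \<open>A renaming may turn irrelevant variables into relevant ones, so the identity is a renaming from
  \<open>\<Gamma>\<close> into its resurrection.\<close>

definition ren :: "ctx \<Rightarrow> (nat \<Rightarrow> nat) \<Rightarrow> ctx \<Rightarrow> bool" where
  "ren \<Delta> \<rho> \<Gamma> \<longleftrightarrow> \<turnstile> \<Delta> \<and>
     (\<forall>x r T. in_ctx x r T \<Gamma> \<longrightarrow> (\<exists>r'. (r = Rel \<longrightarrow> r' = Rel) \<and> in_ctx (\<rho> x) r' (rn \<rho> T) \<Delta>))"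

lemma ren_wf: "ren \<Delta> \<rho> \<Gamma> \<Longrightarrow> \<turnstile> \<Delta>"
  by (simp add: ren_def)

lemma ren_in_ctx:
  "ren \<Delta> \<rho> \<Gamma> \<Longrightarrow> in_ctx x r T \<Gamma> \<Longrightarrow> \<exists>r'. (r = Rel \<longrightarrow> r' = Rel) \<and> in_ctx (\<rho> x) r' (rn \<rho> T) \<Delta>"
  by (simp add: ren_def)

lemma ren_id: "\<turnstile> \<Gamma> \<Longrightarrow> ren \<Gamma> (\<lambda>x. x) \<Gamma>"
  by (auto simp: ren_def)

lemma ren_comp:
  assumes "ren \<Delta>' \<rho>' \<Delta>" "ren \<Delta> \<rho> \<Gamma>"
  shows "ren \<Delta>' (\<lambda>x. \<rho>' (\<rho> x)) \<Gamma>"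
  unfolding ren_def
proof (intro conjI allI impI)
  show "\<turnstile> \<Delta>'" using assms by (simp add: ren_def)
  fix x r T assume "in_ctx x r T \<Gamma>"
  then obtain r' where r': "r = Rel \<longrightarrow> r' = Rel" "in_ctx (\<rho> x) r' (rn \<rho> T) \<Delta>"
    using ren_in_ctx[OF assms(2)] by blast
  from ren_in_ctx[OF assms(1) this(2)] r'(1)
  show "\<exists>r'. (r = Rel \<longrightarrow> r' = Rel) \<and> in_ctx (\<rho>' (\<rho> x)) r' (rn (\<lambda>x. \<rho>' (\<rho> x)) T) \<Delta>'"
    by (auto simp: rn_rn)
qed

lemma ren_resurrect: "ren \<Delta> \<rho> \<Gamma> \<Longrightarrow> ren (resurrect \<Delta>) \<rho> (resurrect \<Gamma>)"
  unfolding ren_def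
  by (meson in_ctx_resurrect in_ctx_resurrectD resurrect_wf)

lemma ren_ctx_for: "ren \<Delta> \<rho> \<Gamma> \<Longrightarrow> ren (ctx_for r \<Delta>) \<rho> (ctx_for r \<Gamma>)"
  by (cases r) (auto intro: ren_resurrect)

lemma ren_Suc: "\<turnstile> (r, U) # \<Gamma> \<Longrightarrow> ren ((r, U) # \<Gamma>) Suc \<Gamma>"
  by (auto simp: ren_def lift_eq_rn[symmetric] intro: in_ctx.intros)

lemma ren_up:
  assumes "ren \<Delta> \<rho> \<Gamma>" "\<Delta> \<turnstile> rn \<rho> U \<^bold>: Srt s"
  shows "ren ((r, rn \<rho> U) # \<Delta>) (case_nat 0 (\<lambda>x. Suc (\<rho> x))) ((r, U) # \<Gamma>)"
  unfolding ren_def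
proof (intro conjI allI impI)
  show "\<turnstile> (r, rn \<rho> U) # \<Delta>" using assms by (auto simp: ren_def intro: wf_cons)
  fix x r' T assume "in_ctx x r' T ((r, U) # \<Gamma>)"
  then show "\<exists>r''. (r' = Rel \<longrightarrow> r'' = Rel) \<and>
    in_ctx (case_nat 0 (\<lambda>x. Suc (\<rho> x)) x) r'' (rn (case_nat 0 (\<lambda>x. Suc (\<rho> x))) T) ((r, rn \<rho> U) # \<Delta>)"
  proof (cases rule: in_ctx_ConsE)
    case here
    then show ?thesis by (auto simp: rn_lift intro: in_ctx_here)
  next
    case (there y S)
    with ren_in_ctx[OF assms(1) there(2)] show ?thesis by (auto simp: rn_lift intro: in_ctx_there)
  qed
qed

text \<open>The rules do not repeat the well-formedness of a bound variable's type, so inductions that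
  go under a binder carry their motive for the types stored in the context.\<close>

fun ctx_all :: "(ctx \<Rightarrow> exp \<Rightarrow> bool) \<Rightarrow> ctx \<Rightarrow> bool" where
  "ctx_all P [] = True"
| "ctx_all P ((r, U) # \<Gamma>) = (ctx_all P \<Gamma> \<and> P \<Gamma> U)"

definition ren_motive :: "ctx \<Rightarrow> exp \<Rightarrow> bool" where
  "ren_motive \<Gamma> U \<longleftrightarrow> (\<forall>\<Delta> \<rho>. ren \<Delta> \<rho> \<Gamma> \<longrightarrow> (\<exists>s. \<Delta> \<turnstile> rn \<rho> U \<^bold>: Srt s))"

lemma ren_motiveD:
  "ctx_all ren_motive ((r, U) # \<Gamma>) \<Longrightarrow> ren \<Delta> \<rho> \<Gamma> \<Longrightarrow> \<exists>s. \<Delta> \<turnstile> rn \<rho> U \<^bold>: Srt s"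
  by (simp add: ren_motive_def)

lemma renaming:
  "\<turnstile> \<Gamma> \<Longrightarrow> ctx_all ren_motive \<Gamma>"
  "\<Gamma> \<turnstile> t \<^bold>: T \<Longrightarrow> ctx_all ren_motive \<Gamma> \<and> (\<forall>\<Delta> \<rho>. ren \<Delta> \<rho> \<Gamma> \<longrightarrow> \<Delta> \<turnstile> rn \<rho> t \<^bold>: rn \<rho> T)"
  "\<Gamma> \<turnstile> t \<^bold>= t' \<^bold>: T \<Longrightarrow> ctx_all ren_motive \<Gamma> \<and>
     (\<forall>\<Delta> \<rho>. ren \<Delta> \<rho> \<Gamma> \<longrightarrow> \<Delta> \<turnstile> rn \<rho> t \<^bold>= rn \<rho> t' \<^bold>: rn \<rho> T)"
proof (induction rule: wf_ctx_typing_equal.inducts)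
  case (wf_cons \<Gamma> T s r)
  then show ?case by (auto simp: ren_motive_def)
next
  case (ty_sort \<Gamma> s s')
  then show ?case by (auto intro: wf_ctx_typing_equal.ty_sort ren_wf)
next
  case (ty_pi \<Gamma> U s1 r T s2 s3)
  then show ?case by (fastforce intro: wf_ctx_typing_equal.ty_pi ren_up)
next
  case (ty_var \<Gamma> x U)
  then show ?case
    by (auto intro: ren_wf wf_ctx_typing_equal.ty_var dest: ren_in_ctx)
next
  case (ty_lam r U \<Gamma> t T s s' s3)
  show ?case
  proof (intro conjI allI impI)
    show "ctx_all ren_motive \<Gamma>" using ty_lam by blast
    fix \<Delta> \<rho> assume r: "ren \<Delta> \<rho> \<Gamma>"
    then obtain s0 where "\<Delta> \<turnstile> rn \<rho> U \<^bold>: Srt s0" using ty_lam.IH(1) by (blast dest: ren_motiveD)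
    from ren_up[OF r this] ty_lam.IH(1)
    have "(r, rn \<rho> U) # \<Delta> \<turnstile> rn (case_nat 0 (\<lambda>x. Suc (\<rho> x))) t \<^bold>: rn (case_nat 0 (\<lambda>x. Suc (\<rho> x))) T" by blast
    moreover have "\<Delta> \<turnstile> rn \<rho> (Pi r s s' U T) \<^bold>: rn \<rho> (Srt s3)" using ty_lam.IH(2) r by blast
    ultimately show "\<Delta> \<turnstile> rn \<rho> (Lam r U t) \<^bold>: rn \<rho> (Pi r s s' U T)"
      by (auto intro: wf_ctx_typing_equal.ty_lam)
  qed
next
  case (ty_app \<Gamma> t r s s' U T u)
  then show ?case
    by (fastforce simp: rn_subst intro: wf_ctx_typing_equal.ty_app ren_ctx_for)
next
  case (ty_conv \<Gamma> t T T' s)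
  then show ?case by (fastforce intro: wf_ctx_typing_equal.ty_conv)
next
  case (eq_beta r U \<Gamma> t T u)
  show ?case
  proof (intro conjI allI impI)
    show "ctx_all ren_motive \<Gamma>" using eq_beta by auto
    fix \<Delta> \<rho> assume r: "ren \<Delta> \<rho> \<Gamma>"
    then obtain s0 where "\<Delta> \<turnstile> rn \<rho> U \<^bold>: Srt s0" using eq_beta.IH(1) by (blast dest: ren_motiveD)
    from ren_up[OF r this] eq_beta.IH ren_ctx_for[OF r]
    show "\<Delta> \<turnstile> rn \<rho> (App r (Lam r U t) u) \<^bold>= rn \<rho> (subst u t) \<^bold>: rn \<rho> (subst u T)"
      by (auto simp: rn_subst intro: wf_ctx_typing_equal.eq_beta)
  qed
next
  case (eq_eta \<Gamma> t r s s' U T)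
  then show ?case by (fastforce simp: rn_lift intro: wf_ctx_typing_equal.eq_eta)
next
  case (eq_pi \<Gamma> U U' s1 r T T' s2 s3)
  show ?case
  proof (intro conjI allI impI)
    show "ctx_all ren_motive \<Gamma>" using eq_pi by auto
    fix \<Delta> \<rho> assume r: "ren \<Delta> \<rho> \<Gamma>"
    then obtain s0 where "\<Delta> \<turnstile> rn \<rho> U \<^bold>: Srt s0" using eq_pi.IH(2) by (blast dest: ren_motiveD)
    from ren_up[OF r this] eq_pi.IH r eq_pi.hyps
    show "\<Delta> \<turnstile> rn \<rho> (Pi r s1 s2 U T) \<^bold>= rn \<rho> (Pi r s1 s2 U' T') \<^bold>: rn \<rho> (Srt s3)"
      by (fastforce intro: wf_ctx_typing_equal.eq_pi)
  qed
next
  case (eq_lam \<Gamma> U U' s1 r T s2 t t')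
  show ?case
  proof (intro conjI allI impI)
    show "ctx_all ren_motive \<Gamma>" using eq_lam by auto
    fix \<Delta> \<rho> assume r: "ren \<Delta> \<rho> \<Gamma>"
    then obtain s0 where "\<Delta> \<turnstile> rn \<rho> U \<^bold>: Srt s0" using eq_lam.IH(2) by (blast dest: ren_motiveD)
    from ren_up[OF r this] eq_lam.IH r eq_lam.hyps
    show "\<Delta> \<turnstile> rn \<rho> (Lam r U t) \<^bold>= rn \<rho> (Lam r U' t') \<^bold>: rn \<rho> (Pi r s1 s2 U T)"
      by (fastforce intro: wf_ctx_typing_equal.eq_lam)
  qed
next
  case (eq_app_rel \<Gamma> t t' s s' U T u u')
  then show ?case by (fastforce simp: rn_subst intro: wf_ctx_typing_equal.eq_app_rel)
next
  case (eq_app_irr \<Gamma> t t' s s' U T u u')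
  then show ?case
    by (fastforce simp: rn_subst intro: wf_ctx_typing_equal.eq_app_irr ren_resurrect)
next
  case (eq_conv \<Gamma> t t' T T' s)
  then show ?case by (fastforce intro: wf_ctx_typing_equal.eq_conv)
next
  case (eq_trans \<Gamma> t1 t2 T t3)
  then show ?case by (meson wf_ctx_typing_equal.eq_trans)
qed (auto intro: wf_ctx_typing_equal.intros)

lemma rn_typing: "\<Gamma> \<turnstile> t \<^bold>: T \<Longrightarrow> ren \<Delta> \<rho> \<Gamma> \<Longrightarrow> \<Delta> \<turnstile> rn \<rho> t \<^bold>: rn \<rho> T"
  and rn_equal: "\<Gamma> \<turnstile> t \<^bold>= t' \<^bold>: T \<Longrightarrow> ren \<Delta> \<rho> \<Gamma> \<Longrightarrow> \<Delta> \<turnstile> rn \<rho> t \<^bold>= rn \<rho> t' \<^bold>: rn \<rho> T"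
  using renaming(2,3) by blast+

section \<open>Typed substitutions\<close>

inductive_cases wf_consE: "\<turnstile> (r, U) # \<Gamma>"

lemma wf_typing_equal:
  "\<turnstile> \<Gamma> \<Longrightarrow> True"
  "\<Gamma> \<turnstile> t \<^bold>: T \<Longrightarrow> \<turnstile> \<Gamma>"
  "\<Gamma> \<turnstile> t \<^bold>= t' \<^bold>: T \<Longrightarrow> \<turnstile> \<Gamma>"
  by (induction rule: wf_ctx_typing_equal.inducts) (auto elim: wf_consE)

lemmas wf_typing = wf_typing_equal(2) and wf_equal = wf_typing_equal(3)

text \<open>The image of an irrelevant variable need only be typed after resurrection, because such
  a variable can be used only where the context has been resurrected.\<close>

definition sbok :: "ctx \<Rightarrow> (nat \<Rightarrow> exp) \<Rightarrow> ctx \<Rightarrow> bool" where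
  "sbok \<Delta> \<sigma> \<Gamma> \<longleftrightarrow> \<turnstile> \<Delta> \<and> (\<forall>x r T. in_ctx x r T \<Gamma> \<longrightarrow> ctx_for r \<Delta> \<turnstile> \<sigma> x \<^bold>: sb \<sigma> T)"

lemma sbok_wf: "sbok \<Delta> \<sigma> \<Gamma> \<Longrightarrow> \<turnstile> \<Delta>"
  by (simp add: sbok_def)

lemma sbok_resurrect: "sbok \<Delta> \<sigma> \<Gamma> \<Longrightarrow> sbok (resurrect \<Delta>) \<sigma> (resurrect \<Gamma>)"
  unfolding sbok_def
  by (metis ctx_for.simps(1) in_ctx_resurrectD resurrect_ctx_for(1) resurrect_typing resurrect_wf)

lemma sbok_ctx_for: "sbok \<Delta> \<sigma> \<Gamma> \<Longrightarrow> sbok (ctx_for r \<Delta>) \<sigma> (ctx_for r \<Gamma>)"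
  by (cases r) (auto intro: sbok_resurrect)

lemma ty_var0: "\<turnstile> (r, U) # \<Gamma> \<Longrightarrow> ctx_for r ((r, U) # \<Gamma>) \<turnstile> Var 0 \<^bold>: lift U"
  by (intro ty_var ctx_for_wf in_ctx_for in_ctx_here)

lemma sbok_up:
  assumes "sbok \<Delta> \<sigma> \<Gamma>" "\<Delta> \<turnstile> sb \<sigma> U \<^bold>: Srt s"
  shows "sbok ((r, sb \<sigma> U) # \<Delta>) (up \<sigma>) ((r, U) # \<Gamma>)"
  unfolding sbok_def
proof (intro conjI allI impI)
  show wf: "\<turnstile> (r, sb \<sigma> U) # \<Delta>" using assms by (auto simp: sbok_def intro: wf_cons)
  fix x r' T assume "in_ctx x r' T ((r, U) # \<Gamma>)"
  then show "ctx_for r' ((r, sb \<sigma> U) # \<Delta>) \<turnstile> up \<sigma> x \<^bold>: sb (up \<sigma>) T"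
  proof (cases rule: in_ctx_ConsE)
    case here
    then show ?thesis using ty_var0[OF wf] by (simp only: sb_lift up_simps)
  next
    case (there y S)
    then have "ctx_for r' \<Delta> \<turnstile> \<sigma> y \<^bold>: sb \<sigma> S" using assms(1) by (simp add: sbok_def)
    from rn_typing[OF this ren_ctx_for[OF ren_Suc[OF wf]]] there
    show ?thesis by (simp add: sb_lift) (simp add: lift_eq_rn)
  qed
qed

definition sb_motive :: "ctx \<Rightarrow> exp \<Rightarrow> bool" where
  "sb_motive \<Gamma> U \<longleftrightarrow> (\<forall>\<Delta> \<sigma>. sbok \<Delta> \<sigma> \<Gamma> \<longrightarrow> (\<exists>s. \<Delta> \<turnstile> sb \<sigma> U \<^bold>: Srt s))"

lemma sb_motiveD:
  "ctx_all sb_motive ((r, U) # \<Gamma>) \<Longrightarrow> sbok \<Delta> \<sigma> \<Gamma> \<Longrightarrow> \<exists>s. \<Delta> \<turnstile> sb \<sigma> U \<^bold>: Srt s"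
  by (simp add: sb_motive_def)

lemma substitution:
  "\<turnstile> \<Gamma> \<Longrightarrow> ctx_all sb_motive \<Gamma>"
  "\<Gamma> \<turnstile> t \<^bold>: T \<Longrightarrow> ctx_all sb_motive \<Gamma> \<and> (\<forall>\<Delta> \<sigma>. sbok \<Delta> \<sigma> \<Gamma> \<longrightarrow> \<Delta> \<turnstile> sb \<sigma> t \<^bold>: sb \<sigma> T)"
  "\<Gamma> \<turnstile> t \<^bold>= t' \<^bold>: T \<Longrightarrow> ctx_all sb_motive \<Gamma> \<and>
     (\<forall>\<Delta> \<sigma>. sbok \<Delta> \<sigma> \<Gamma> \<longrightarrow> \<Delta> \<turnstile> sb \<sigma> t \<^bold>= sb \<sigma> t' \<^bold>: sb \<sigma> T)"
proof (induction rule: wf_ctx_typing_equal.inducts)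
  case (wf_cons \<Gamma> T s r)
  then show ?case by (auto simp: sb_motive_def)
next
  case (ty_sort \<Gamma> s s')
  then show ?case by (auto intro: wf_ctx_typing_equal.ty_sort sbok_wf)
next
  case (ty_pi \<Gamma> U s1 r T s2 s3)
  then show ?case by (fastforce intro: wf_ctx_typing_equal.ty_pi sbok_up)
next
  case (ty_var \<Gamma> x U)
  then show ?case by (fastforce simp: sbok_def)
next
  case (ty_lam r U \<Gamma> t T s s' s3)
  show ?case
  proof (intro conjI allI impI)
    show "ctx_all sb_motive \<Gamma>" using ty_lam by blast
    fix \<Delta> \<sigma> assume r: "sbok \<Delta> \<sigma> \<Gamma>"
    then obtain s0 where "\<Delta> \<turnstile> sb \<sigma> U \<^bold>: Srt s0" using ty_lam.IH(1) by (blast dest: sb_motiveD)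
    from sbok_up[OF r this] ty_lam.IH(1)
    have "(r, sb \<sigma> U) # \<Delta> \<turnstile> sb (up \<sigma>) t \<^bold>: sb (up \<sigma>) T" by blast
    moreover have "\<Delta> \<turnstile> sb \<sigma> (Pi r s s' U T) \<^bold>: sb \<sigma> (Srt s3)" using ty_lam.IH(2) r by blast
    ultimately show "\<Delta> \<turnstile> sb \<sigma> (Lam r U t) \<^bold>: sb \<sigma> (Pi r s s' U T)"
      by (auto intro: wf_ctx_typing_equal.ty_lam)
  qed
next
  case (ty_app \<Gamma> t r s s' U T u)
  then show ?case
    by (fastforce simp: sb_subst intro: wf_ctx_typing_equal.ty_app sbok_ctx_for)
next
  case (ty_conv \<Gamma> t T T' s)
  then show ?case by (fastforce intro: wf_ctx_typing_equal.ty_conv)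
next
  case (eq_beta r U \<Gamma> t T u)
  show ?case
  proof (intro conjI allI impI)
    show "ctx_all sb_motive \<Gamma>" using eq_beta by auto
    fix \<Delta> \<sigma> assume r: "sbok \<Delta> \<sigma> \<Gamma>"
    then obtain s0 where "\<Delta> \<turnstile> sb \<sigma> U \<^bold>: Srt s0" using eq_beta.IH(1) by (blast dest: sb_motiveD)
    from sbok_up[OF r this] eq_beta.IH sbok_ctx_for[OF r]
    show "\<Delta> \<turnstile> sb \<sigma> (App r (Lam r U t) u) \<^bold>= sb \<sigma> (subst u t) \<^bold>: sb \<sigma> (subst u T)"
      by (auto simp: sb_subst intro: wf_ctx_typing_equal.eq_beta)
  qed
next
  case (eq_eta \<Gamma> t r s s' U T)
  then show ?case by (fastforce simp: sb_lift intro: wf_ctx_typing_equal.eq_eta)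
next
  case (eq_pi \<Gamma> U U' s1 r T T' s2 s3)
  show ?case
  proof (intro conjI allI impI)
    show "ctx_all sb_motive \<Gamma>" using eq_pi by auto
    fix \<Delta> \<sigma> assume r: "sbok \<Delta> \<sigma> \<Gamma>"
    then obtain s0 where "\<Delta> \<turnstile> sb \<sigma> U \<^bold>: Srt s0" using eq_pi.IH(2) by (blast dest: sb_motiveD)
    from sbok_up[OF r this] eq_pi.IH r eq_pi.hyps
    show "\<Delta> \<turnstile> sb \<sigma> (Pi r s1 s2 U T) \<^bold>= sb \<sigma> (Pi r s1 s2 U' T') \<^bold>: sb \<sigma> (Srt s3)"
      by (fastforce intro: wf_ctx_typing_equal.eq_pi)
  qed
next
  case (eq_lam \<Gamma> U U' s1 r T s2 t t')
  show ?case
  proof (intro conjI allI impI)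
    show "ctx_all sb_motive \<Gamma>" using eq_lam by auto
    fix \<Delta> \<sigma> assume r: "sbok \<Delta> \<sigma> \<Gamma>"
    then obtain s0 where "\<Delta> \<turnstile> sb \<sigma> U \<^bold>: Srt s0" using eq_lam.IH(2) by (blast dest: sb_motiveD)
    from sbok_up[OF r this] eq_lam.IH r eq_lam.hyps
    show "\<Delta> \<turnstile> sb \<sigma> (Lam r U t) \<^bold>= sb \<sigma> (Lam r U' t') \<^bold>: sb \<sigma> (Pi r s1 s2 U T)"
      by (fastforce intro: wf_ctx_typing_equal.eq_lam)
  qed
next
  case (eq_app_rel \<Gamma> t t' s s' U T u u')
  then show ?case by (fastforce simp: sb_subst intro: wf_ctx_typing_equal.eq_app_rel)
next
  case (eq_app_irr \<Gamma> t t' s s' U T u u')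
  then show ?case
    by (fastforce simp: sb_subst intro: wf_ctx_typing_equal.eq_app_irr sbok_resurrect)
next
  case (eq_conv \<Gamma> t t' T T' s)
  then show ?case by (fastforce intro: wf_ctx_typing_equal.eq_conv)
next
  case (eq_trans \<Gamma> t1 t2 T t3)
  then show ?case by (meson wf_ctx_typing_equal.eq_trans)
qed (auto intro: wf_ctx_typing_equal.intros)

lemma sb_typing: "\<Gamma> \<turnstile> t \<^bold>: T \<Longrightarrow> sbok \<Delta> \<sigma> \<Gamma> \<Longrightarrow> \<Delta> \<turnstile> sb \<sigma> t \<^bold>: sb \<sigma> T"
  and sb_equal: "\<Gamma> \<turnstile> t \<^bold>= t' \<^bold>: T \<Longrightarrow> sbok \<Delta> \<sigma> \<Gamma> \<Longrightarrow> \<Delta> \<turnstile> sb \<sigma> t \<^bold>= sb \<sigma> t' \<^bold>: sb \<sigma> T"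
  using substitution(2,3) by blast+

subsection \<open>Weak head evaluation\<close>

inductive_cases eval_AppE: "App r t u \<searrow> a"
inductive_cases eval_SrtE: "Srt s \<searrow> a"
inductive_cases eval_PiE: "Pi r s s' U T \<searrow> a"
inductive_cases eval_LamE: "Lam r U t \<searrow> a"
inductive_cases eval_VarE: "Var x \<searrow> a"
inductive_cases whnf_AppE: "whnf (App r t u)"

lemma eval_appD: "f @[r] u \<searrow> a \<Longrightarrow> (\<exists>U t. f = Lam r U t \<and> subst u t \<searrow> a) \<or> (neutral f \<and> a = App r f u)"
  by (auto elim: eval_app.cases)

lemma eval_neutral: "neutral n \<Longrightarrow> n \<searrow> a \<Longrightarrow> a = n"
proof (induction n arbitrary: a)
  case (App r n u)
  from App.prems(2) show ?case
  proof (rule eval_AppE)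
    fix f assume "n \<searrow> f" "f @[r] u \<searrow> a"
    with App eval_appD show "a = App r n u" by fastforce
  qed auto
qed (auto elim: eval_VarE)

text \<open>The rules overlap on neutral applications, which evaluate both as weak head normal forms
  and through \<open>eval_App\<close>; \<open>eval_neutral\<close> shows that the results
  agree.\<close>

lemma eval_det:
  "t \<searrow> a \<Longrightarrow> \<forall>b. t \<searrow> b \<longrightarrow> b = a"
  "f @[r] u \<searrow> a \<Longrightarrow> \<forall>b. f @[r] u \<searrow> b \<longrightarrow> b = a"
proof (induction rule: eval_eval_app.inducts)
  case (eval_whnf a)
  then show ?case
    by cases (auto elim: eval_SrtE eval_PiE eval_LamE dest: eval_neutral)
next
  case (eval_App t f r u a)
  show ?case
  proof (intro allI impI)
    fix b assume "App r t u \<searrow> b"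
    then show "b = a"
    proof (rule eval_AppE)
      assume b: "b = App r t u" and "whnf (App r t u)"
      then have "neutral t" by (auto elim: whnf_AppE)
      moreover from this eval_App.hyps(1) have "f = t" by (rule eval_neutral)
      ultimately show ?thesis using eval_App.hyps b eval_appD by fastforce
    next
      fix g assume "t \<searrow> g" "g @[r] u \<searrow> b"
      with eval_App.IH show ?thesis by blast
    qed
  qed
next
  case (eval_app_lam u t a r U)
  then show ?case by (intro allI impI) (drule eval_appD, auto)
next
  case (eval_app_ne n r u)
  then show ?case by (intro allI impI) (drule eval_appD, auto)
qed

lemma eval_fun: "t \<searrow> a \<Longrightarrow> t \<searrow> b \<Longrightarrow> a = b"
  using eval_det(1) by blast

lemma neutral_rn [simp]: "neutral (rn \<rho> t) = neutral t"
  by (induction t) auto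

lemma whnf_rn: "whnf a \<Longrightarrow> whnf (rn \<rho> a)"
  by (auto elim!: whnf.cases intro: whnf.intros)

lemma eval_rn:
  "t \<searrow> a \<Longrightarrow> rn \<rho> t \<searrow> rn \<rho> a"
  "f @[r] u \<searrow> a \<Longrightarrow> rn \<rho> f @[r] rn \<rho> u \<searrow> rn \<rho> a"
proof (induction rule: eval_eval_app.inducts)
  case (eval_App t f r u a)
  then show ?case by (auto intro: eval_eval_app.eval_App)
next
  case (eval_app_lam u t a r U)
  then show ?case by (auto simp: rn_subst intro: eval_eval_app.eval_app_lam)
qed (auto intro: eval_eval_app.intros whnf_rn)

lemma eval_Srt: "Srt s \<searrow> Srt s" and eval_Pi: "Pi r s s' U T \<searrow> Pi r s s' U T"
  and eval_ne: "neutral n \<Longrightarrow> n \<searrow> n"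
  by (auto intro: eval_whnf whnf.intros)

text \<open>Big-step evaluation is too coarse for closure of the logical relation under beta
  expansion; single head steps suffice there, and \<open>whr_eval\<close> pulls evaluation back
  along one.\<close>

inductive whr :: "exp \<Rightarrow> exp \<Rightarrow> bool" where
  whr_beta: "whr (App r (Lam r U t) u) (subst u t)"
| whr_app: "whr t t' \<Longrightarrow> whr (App r t u) (App r t' u)"

lemma whr_eval: "whr t t' \<Longrightarrow> t' \<searrow> a \<Longrightarrow> t \<searrow> a"
proof (induction arbitrary: a rule: whr.induct)
  case (whr_beta r U t u)
  then show ?case by (auto intro: eval_eval_app.intros whnf.intros)
next
  case (whr_app t t' r u)
  from whr_app.prems show ?case
  proof (rule eval_AppE)
    assume a: "a = App r t' u" and "whnf (App r t' u)"
    then have "neutral t'" by (auto elim: whnf_AppE)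
    then show ?thesis using whr_app.IH a by (auto intro: eval_App eval_app_ne eval_ne)
  next
    fix f assume "t' \<searrow> f" "f @[r] u \<searrow> a"
    then show ?thesis using whr_app.IH by (auto intro: eval_App)
  qed
qed

lemma whr_rn: "whr t t' \<Longrightarrow> whr (rn \<rho> t) (rn \<rho> t')"
  by (induction rule: whr.induct) (auto simp: rn_subst intro: whr.intros)

subsection \<open>Typed equality\<close>

abbreviation Set' :: "nat \<Rightarrow> exp" where "Set' n \<equiv> Srt (SetS n)"

text \<open>Both typings are kept because they cannot yet be extracted from the equation alone.
  Conversion also goes through for all three components at once.\<close>

definition teq :: "ctx \<Rightarrow> exp \<Rightarrow> exp \<Rightarrow> exp \<Rightarrow> bool" where
  "teq \<Gamma> t u A \<longleftrightarrow> \<Gamma> \<turnstile> t \<^bold>= u \<^bold>: A \<and> \<Gamma> \<turnstile> t \<^bold>: A \<and> \<Gamma> \<turnstile> u \<^bold>: A"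

lemma teq_equal: "teq \<Gamma> t u A \<Longrightarrow> \<Gamma> \<turnstile> t \<^bold>= u \<^bold>: A"
  and teq_left: "teq \<Gamma> t u A \<Longrightarrow> \<Gamma> \<turnstile> t \<^bold>: A"
  and teq_right: "teq \<Gamma> t u A \<Longrightarrow> \<Gamma> \<turnstile> u \<^bold>: A"
  by (simp_all add: teq_def)

lemma teq_refl: "\<Gamma> \<turnstile> t \<^bold>: A \<Longrightarrow> teq \<Gamma> t t A"
  by (simp add: teq_def eq_refl)

lemma teq_sym: "teq \<Gamma> t u A \<Longrightarrow> teq \<Gamma> u t A"
  by (auto simp: teq_def intro: eq_sym)

lemma teq_trans: "teq \<Gamma> t u A \<Longrightarrow> teq \<Gamma> u v A \<Longrightarrow> teq \<Gamma> t v A"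
  by (auto simp: teq_def intro: eq_trans)

lemma teq_conv: "teq \<Gamma> t u A \<Longrightarrow> teq \<Gamma> A B (Srt s) \<Longrightarrow> teq \<Gamma> t u B"
  by (auto simp: teq_def intro: eq_conv ty_conv)

lemma teq_conv': "teq \<Gamma> t u A \<Longrightarrow> teq \<Gamma> B A (Srt s) \<Longrightarrow> teq \<Gamma> t u B"
  by (blast intro: teq_conv teq_sym)

lemma teq_rn: "teq \<Gamma> t u A \<Longrightarrow> ren \<Delta> \<rho> \<Gamma> \<Longrightarrow> teq \<Delta> (rn \<rho> t) (rn \<rho> u) (rn \<rho> A)"
  by (auto simp: teq_def intro: rn_typing rn_equal)

text \<open>Replacing the type of the last entry by an equal one is an instance of substitution: the
  identity is well typed between the two contexts.\<close>

lemma ctx_conv: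
  assumes "\<Gamma> \<turnstile> U' \<^bold>= U \<^bold>: Srt s" "\<Gamma> \<turnstile> U' \<^bold>: Srt s"
  shows "sbok ((r, U') # \<Gamma>) Var ((r, U) # \<Gamma>)"
  unfolding sbok_def
proof (intro conjI allI impI)
  show wf: "\<turnstile> (r, U') # \<Gamma>" using assms(2) wf_typing by (blast intro: wf_cons)
  fix x r' T assume "in_ctx x r' T ((r, U) # \<Gamma>)"
  then show "ctx_for r' ((r, U') # \<Gamma>) \<turnstile> Var x \<^bold>: sb Var T"
  proof (cases rule: in_ctx_ConsE)
    case here
    have "ctx_for r ((r, U') # \<Gamma>) \<turnstile> lift U' \<^bold>= lift U \<^bold>: Srt s"
      using rn_equal[OF assms(1) ren_Suc[OF wf]] by (auto simp: lift_eq_rn intro: ctx_for_equal)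
    with ty_var0[OF wf] here show ?thesis by (auto intro: ty_conv)
  next
    case (there y S)
    then show ?thesis using wf by (auto intro!: ty_var ctx_for_wf in_ctx_for in_ctx_there)
  qed
qed

lemma teq_ctx_conv: "teq ((r, U) # \<Gamma>) t u A \<Longrightarrow> teq \<Gamma> U U' (Srt s) \<Longrightarrow> teq ((r, U') # \<Gamma>) t u A"
  using sb_typing[OF _ ctx_conv] sb_equal[OF _ ctx_conv]
  unfolding teq_def by (metis eq_sym sb_Var)

lemma Axiom_Suc: "(SetS k, SetS (Suc k)) \<in> Axiom"
  by (auto simp: Axiom_def)

lemma Rule_max: "(SetS i, SetS j, SetS (max i j)) \<in> Rule"
  by (auto simp: Rule_def)

lemma Set'_typing: "\<turnstile> \<Gamma> \<Longrightarrow> \<Gamma> \<turnstile> Set' k \<^bold>: Set' (Suc k)"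
  by (rule ty_sort[OF _ Axiom_Suc])

lemma teq_Pi:
  assumes "teq \<Gamma> U U' (Set' i)" "teq ((r, U) # \<Gamma>) T T' (Set' j)"
  shows "teq \<Gamma> (Pi r (SetS i) (SetS j) U T) (Pi r (SetS i) (SetS j) U' T') (Set' (max i j))"
  using assms teq_ctx_conv[OF assms(2,1)] unfolding teq_def
  by (auto intro: ty_pi eq_pi Rule_max)

subsection \<open>The logical relation\<close>

definition ev :: "nat \<Rightarrow> ctx \<Rightarrow> exp \<Rightarrow> exp \<Rightarrow> bool" where
  "ev n \<Gamma> A W \<longleftrightarrow> A \<searrow> W \<and> teq \<Gamma> A W (Set' n)"

lemma ev_fun: "A \<searrow> W' \<Longrightarrow> ev n \<Gamma> A W \<Longrightarrow> W = W'"
  unfolding ev_def using eval_fun by blast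

lemma ev_rn: "ev n \<Gamma> A W \<Longrightarrow> ren \<Delta> \<rho> \<Gamma> \<Longrightarrow> ev n \<Delta> (rn \<rho> A) (rn \<rho> W)"
  unfolding ev_def using eval_rn(1) teq_rn by fastforce

lemma ev_whr: "ev n \<Gamma> A W \<Longrightarrow> whr A0 A \<Longrightarrow> teq \<Gamma> A0 A (Set' n) \<Longrightarrow> ev n \<Gamma> A0 W"
  unfolding ev_def using whr_eval teq_trans by blast

abbreviation inst :: "(nat \<Rightarrow> nat) \<Rightarrow> exp \<Rightarrow> exp \<Rightarrow> exp" where
  "inst \<rho> v T \<equiv> sb (case_nat v (\<lambda>x. Var (\<rho> x))) T"

primrec arg_rel :: "ann \<Rightarrow> ctx \<Rightarrow> exp \<Rightarrow> (exp \<Rightarrow> exp \<Rightarrow> bool) \<Rightarrow> exp \<Rightarrow> exp \<Rightarrow> bool" where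
  "arg_rel Rel \<Delta> V R v v' = R v v'"
| "arg_rel Irr \<Delta> V R v v' = (resurrect \<Delta> \<turnstile> v \<^bold>: V \<and> resurrect \<Delta> \<turnstile> v' \<^bold>: V)"

text \<open>\<open>LR L n \<Gamma> A B R\<close>: the types \<open>A\<close> and \<open>B\<close> of level \<open>n\<close> are related and \<open>R\<close> is the induced relation on
  their terms.  The parameter \<open>L\<close> supplies the relation on types of the levels below \<open>n\<close>; it occurs in \<open>R\<close>
  and so cannot be defined by the same induction.\<close>

inductive LR :: "(nat \<Rightarrow> ctx \<Rightarrow> exp \<Rightarrow> exp \<Rightarrow> bool) \<Rightarrow>
    nat \<Rightarrow> ctx \<Rightarrow> exp \<Rightarrow> exp \<Rightarrow> (exp \<Rightarrow> exp \<Rightarrow> bool) \<Rightarrow> bool" for L where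
  LR_ne: "ev n \<Gamma> A N \<Longrightarrow> ev n \<Gamma> B N' \<Longrightarrow> neutral N \<Longrightarrow> neutral N' \<Longrightarrow> teq \<Gamma> A B (Set' n) \<Longrightarrow>
    LR L n \<Gamma> A B (\<lambda>t u. teq \<Gamma> t u A)"
| LR_srt: "ev (Suc k) \<Gamma> A (Set' k) \<Longrightarrow> ev (Suc k) \<Gamma> B (Set' k) \<Longrightarrow>
    LR L (Suc k) \<Gamma> A B (\<lambda>t u. teq \<Gamma> t u A \<and> L k \<Gamma> t u)"
| LR_pi: "ev (max i j) \<Gamma> A (Pi r (SetS i) (SetS j) U T) \<Longrightarrow>
    ev (max i j) \<Gamma> B (Pi r (SetS i) (SetS j) U' T') \<Longrightarrow>
    teq \<Gamma> U U' (Set' i) \<Longrightarrow> teq ((r, U) # \<Gamma>) T T' (Set' j) \<Longrightarrow>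
    (\<And>\<Delta> \<rho>. ren \<Delta> \<rho> \<Gamma> \<Longrightarrow> LR L i \<Delta> (rn \<rho> U) (rn \<rho> U') (RU \<Delta> \<rho>)) \<Longrightarrow>
    (\<And>\<Delta> \<rho> v v'. ren \<Delta> \<rho> \<Gamma> \<Longrightarrow> arg_rel r \<Delta> (rn \<rho> U) (RU \<Delta> \<rho>) v v' \<Longrightarrow>
       LR L j \<Delta> (inst \<rho> v T) (inst \<rho> v' T') (RT \<Delta> \<rho> v v')) \<Longrightarrow>
    LR L (max i j) \<Gamma> A B (\<lambda>t u. teq \<Gamma> t u A \<and>
      (\<forall>\<Delta> \<rho> v v'. ren \<Delta> \<rho> \<Gamma> \<longrightarrow> arg_rel r \<Delta> (rn \<rho> U) (RU \<Delta> \<rho>) v v' \<longrightarrow>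
         RT \<Delta> \<rho> v v' (App r (rn \<rho> t) v) (App r (rn \<rho> u) v')))"

text \<open>Only the sort clause consults \<open>L\<close>, at \<open>k\<close> for types of level
  \<open>Suc k\<close>, and the components of a function type have no higher level than the type
  itself.\<close>

lemma LR_lower: "LR L n \<Gamma> A B R \<Longrightarrow> (\<And>k. k < n \<Longrightarrow> L k = L' k) \<Longrightarrow> LR L' n \<Gamma> A B R"
proof (induction rule: LR.induct)
  case (LR_srt k \<Gamma> A B)
  from LR.LR_srt[OF LR_srt.hyps, of L'] LR_srt.prems[of k] show ?case by simp
next
  case (LR_pi i j \<Gamma> A r U T B U' T' RU RT)
  show ?case
    by (rule LR.LR_pi[OF LR_pi.hyps(1-4)]) (simp_all add: LR_pi.IH LR_pi.prems)
qed (rule LR.LR_ne)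

text \<open>Ties the knot in the parameter \<open>L\<close>. Stage \<open>n\<close> has its final
  value on all levels below \<open>n\<close>, so the empty start never shows on the diagonal that
  \<open>lr\<close> reads.\<close>

primrec stage :: "nat \<Rightarrow> nat \<Rightarrow> ctx \<Rightarrow> exp \<Rightarrow> exp \<Rightarrow> bool" where
  "stage 0 = (\<lambda>k \<Gamma> A B. False)"
| "stage (Suc n) = (\<lambda>k \<Gamma> A B. \<exists>R. LR (stage n) k \<Gamma> A B R)"

definition lr :: "nat \<Rightarrow> ctx \<Rightarrow> exp \<Rightarrow> exp \<Rightarrow> bool" where
  "lr n = stage (Suc n) n"

lemma stage_eq_lr: "k < n \<Longrightarrow> stage n k = lr k"
proof (induction k arbitrary: n rule: less_induct)
  case (less k)
  then obtain m where m: "n = Suc m" "k \<le> m" by (cases n) auto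
  have "LR (stage m) k \<Gamma> A B R \<longleftrightarrow> LR (stage k) k \<Gamma> A B R" for \<Gamma> A B R
  proof
    assume "LR (stage m) k \<Gamma> A B R"
    then show "LR (stage k) k \<Gamma> A B R" by (rule LR_lower) (use less m in simp)
  next
    assume "LR (stage k) k \<Gamma> A B R"
    then show "LR (stage m) k \<Gamma> A B R" by (rule LR_lower) (use less m in simp)
  qed
  then show ?case unfolding lr_def m(1) stage.simps by (intro ext) blast
qed

text \<open>The fixed-point equation: from here on \<open>lr\<close> is its own parameter and the
  stages can be forgotten.\<close>

lemma lr_iff: "lr n \<Gamma> A B \<longleftrightarrow> (\<exists>R. LR lr n \<Gamma> A B R)"
proof -
  have "LR (stage n) n \<Gamma> A B R \<longleftrightarrow> LR lr n \<Gamma> A B R" for R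
  proof
    assume "LR (stage n) n \<Gamma> A B R"
    then show "LR lr n \<Gamma> A B R" by (rule LR_lower) (simp add: stage_eq_lr)
  next
    assume "LR lr n \<Gamma> A B R"
    then show "LR (stage n) n \<Gamma> A B R" by (rule LR_lower) (simp add: stage_eq_lr)
  qed
  then show ?thesis unfolding lr_def stage.simps by blast
qed

lemma lrI: "LR lr n \<Gamma> A B R \<Longrightarrow> lr n \<Gamma> A B"
  using lr_iff by blast

text \<open>Evaluation is deterministic, so the left type determines the clause and its components.
  Level and right type may differ between the two derivations, which is why \<open>tmr\<close> can
  be indexed by the left type alone.\<close>

lemma LR_fun: "LR L n \<Gamma> A B R \<Longrightarrow> LR L m \<Gamma> A B' R' \<Longrightarrow> R = R'"
proof (induction arbitrary: m B' R' rule: LR.induct)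
  case (LR_ne n \<Gamma> A N B N')
  have "A \<searrow> N" using LR_ne by (simp add: ev_def)
  from LR_ne.prems show ?case
    by cases (use eval_fun[OF \<open>A \<searrow> N\<close>] \<open>neutral N\<close> in \<open>fastforce simp: ev_def\<close>)+
next
  case (LR_srt k \<Gamma> A B)
  have "A \<searrow> Set' k" using LR_srt by (simp add: ev_def)
  from LR_srt.prems show ?case
    by cases (use eval_fun[OF \<open>A \<searrow> Set' k\<close>] in \<open>fastforce simp: ev_def\<close>)+
next
  case (LR_pi i j \<Gamma> A r U T B U' T' RU RT)
  have A: "A \<searrow> Pi r (SetS i) (SetS j) U T" using LR_pi by (simp add: ev_def)
  from LR_pi.prems show ?case
  proof cases
    case (LR_ne N N')
    then show ?thesis using eval_fun[OF A] by (fastforce simp: ev_def)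
  next
    case (LR_srt k)
    then show ?thesis using eval_fun[OF A] by (fastforce simp: ev_def)
  next
    case (LR_pi i' j' r' V S V' S' RU' RT')
    then have eqs: "r' = r" "i' = i" "j' = j" "V = U" "S = T"
      using eval_fun[OF A] by (fastforce simp: ev_def)+
    \<comment> \<open>\<open>RU\<close> and \<open>RT\<close> are unconstrained outside the
      renamings and arguments over which the clause quantifies. They are shown to agree only there,
      and the term relation looks nowhere else.\<close>
    have RU: "RU \<Delta> \<rho> = RU' \<Delta> \<rho>" if "ren \<Delta> \<rho> \<Gamma>" for \<Delta> \<rho>
      using LR_pi.IH(1)[OF that] local.LR_pi(7)[OF that] unfolding eqs by blast
    have RT: "RT \<Delta> \<rho> v v' = RT' \<Delta> \<rho> v v'"
      if "ren \<Delta> \<rho> \<Gamma>" "arg_rel r \<Delta> (rn \<rho> U) (RU \<Delta> \<rho>) v v'" for \<Delta> \<rho> v v'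
      using LR_pi.IH(2)[OF that] local.LR_pi(8)[OF that(1), of v v'] that
      unfolding eqs RU[OF that(1)] by blast
    show ?thesis
      unfolding local.LR_pi(2) eqs
      by (intro ext) (use RU RT in \<open>metis (no_types, lifting)\<close>)
  qed
qed

text \<open>By \<open>LR_fun\<close> the choice is forced whenever \<open>A\<close> is related to
  something; elsewhere the value is arbitrary, so facts about \<open>tmr\<close> come with an
  \<open>lr\<close> hypothesis or one of its clauses.\<close>

definition tmr :: "ctx \<Rightarrow> exp \<Rightarrow> exp \<Rightarrow> exp \<Rightarrow> bool" where
  "tmr \<Gamma> A = (SOME R. \<exists>n B. LR lr n \<Gamma> A B R)"

lemma tmr_eq:
  assumes "LR lr n \<Gamma> A B R"
  shows "tmr \<Gamma> A = R"
proof -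
  have "\<exists>n B. LR lr n \<Gamma> A B (tmr \<Gamma> A)"
    unfolding tmr_def by (rule someI[where P = "\<lambda>R. \<exists>n B. LR lr n \<Gamma> A B R"]) (use assms in blast)
  with LR_fun assms show ?thesis by blast
qed

abbreviation args :: "ann \<Rightarrow> ctx \<Rightarrow> exp \<Rightarrow> exp \<Rightarrow> exp \<Rightarrow> bool" where
  "args r \<Delta> V \<equiv> arg_rel r \<Delta> V (tmr \<Delta> V)"

text \<open>\<open>ne_rel\<close>, \<open>srt_rel\<close> and \<open>pi_rel\<close> are the clauses
  of \<open>LR\<close> with the relation variables replaced by \<open>lr\<close> and
  \<open>tmr\<close>, so that relations on terms no longer occur as data.\<close>

definition ne_rel :: "nat \<Rightarrow> ctx \<Rightarrow> exp \<Rightarrow> exp \<Rightarrow> exp \<Rightarrow> exp \<Rightarrow> bool" where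
  "ne_rel n \<Gamma> A B N N' \<longleftrightarrow>
     ev n \<Gamma> A N \<and> ev n \<Gamma> B N' \<and> neutral N \<and> neutral N' \<and> teq \<Gamma> A B (Set' n)"

definition srt_rel :: "nat \<Rightarrow> ctx \<Rightarrow> exp \<Rightarrow> exp \<Rightarrow> bool" where
  "srt_rel k \<Gamma> A B \<longleftrightarrow> ev (Suc k) \<Gamma> A (Set' k) \<and> ev (Suc k) \<Gamma> B (Set' k)"

definition pi_rel :: "ann \<Rightarrow> nat \<Rightarrow> nat \<Rightarrow> ctx \<Rightarrow> exp \<Rightarrow> exp \<Rightarrow> exp \<Rightarrow> exp \<Rightarrow> exp \<Rightarrow> exp \<Rightarrow> bool" where
  "pi_rel r i j \<Gamma> A B U T U' T' \<longleftrightarrow>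
     ev (max i j) \<Gamma> A (Pi r (SetS i) (SetS j) U T) \<and>
     ev (max i j) \<Gamma> B (Pi r (SetS i) (SetS j) U' T') \<and>
     teq \<Gamma> U U' (Set' i) \<and> teq ((r, U) # \<Gamma>) T T' (Set' j) \<and>
     (\<forall>\<Delta> \<rho>. ren \<Delta> \<rho> \<Gamma> \<longrightarrow> lr i \<Delta> (rn \<rho> U) (rn \<rho> U')) \<and>
     (\<forall>\<Delta> \<rho> v v'. ren \<Delta> \<rho> \<Gamma> \<longrightarrow> args r \<Delta> (rn \<rho> U) v v' \<longrightarrow> lr j \<Delta> (inst \<rho> v T) (inst \<rho> v' T'))"

definition pi_tm :: "ann \<Rightarrow> ctx \<Rightarrow> exp \<Rightarrow> exp \<Rightarrow> exp \<Rightarrow> exp \<Rightarrow> exp \<Rightarrow> bool" where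
  "pi_tm r \<Gamma> A U T t u \<longleftrightarrow> teq \<Gamma> t u A \<and>
      (\<forall>\<Delta> \<rho> v v'. ren \<Delta> \<rho> \<Gamma> \<longrightarrow> args r \<Delta> (rn \<rho> U) v v' \<longrightarrow>
         tmr \<Delta> (inst \<rho> v T) (App r (rn \<rho> t) v) (App r (rn \<rho> u) v'))"

lemma ne_rel:
  assumes "ne_rel n \<Gamma> A B N N'"
  shows "lr n \<Gamma> A B" and "tmr \<Gamma> A t u \<longleftrightarrow> teq \<Gamma> t u A"
proof -
  have "LR lr n \<Gamma> A B (\<lambda>t u. teq \<Gamma> t u A)"
    using assms unfolding ne_rel_def by (blast intro: LR_ne)
  then show "lr n \<Gamma> A B" and "tmr \<Gamma> A t u \<longleftrightarrow> teq \<Gamma> t u A" by (auto simp: lr_iff tmr_eq)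
qed

lemma srt_rel:
  assumes "srt_rel k \<Gamma> A B"
  shows "lr (Suc k) \<Gamma> A B" and "tmr \<Gamma> A t u \<longleftrightarrow> teq \<Gamma> t u A \<and> lr k \<Gamma> t u"
proof -
  have "LR lr (Suc k) \<Gamma> A B (\<lambda>t u. teq \<Gamma> t u A \<and> lr k \<Gamma> t u)"
    using assms unfolding srt_rel_def by (blast intro: LR_srt)
  then show "lr (Suc k) \<Gamma> A B" and "tmr \<Gamma> A t u \<longleftrightarrow> teq \<Gamma> t u A \<and> lr k \<Gamma> t u"
    by (auto simp: lr_iff tmr_eq)
qed

lemma LR_tmr: "lr n \<Gamma> A B \<Longrightarrow> LR lr n \<Gamma> A B (tmr \<Gamma> A)"
  using lr_iff tmr_eq by metis

lemma pi_rel: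
  assumes "pi_rel r i j \<Gamma> A B U T U' T'"
  shows "lr (max i j) \<Gamma> A B" and "tmr \<Gamma> A t u \<longleftrightarrow> pi_tm r \<Gamma> A U T t u"
proof -
  have "LR lr (max i j) \<Gamma> A B (\<lambda>t u. teq \<Gamma> t u A \<and>
      (\<forall>\<Delta> \<rho> v v'. ren \<Delta> \<rho> \<Gamma> \<longrightarrow> args r \<Delta> (rn \<rho> U) v v' \<longrightarrow>
         tmr \<Delta> (inst \<rho> v T) (App r (rn \<rho> t) v) (App r (rn \<rho> u) v')))"
    using assms unfolding pi_rel_def by (intro LR_pi) (blast intro: LR_tmr)+
  then show "lr (max i j) \<Gamma> A B" and "tmr \<Gamma> A t u \<longleftrightarrow> pi_tm r \<Gamma> A U T t u"
    by (auto simp: lr_iff tmr_eq pi_tm_def)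
qed

text \<open>Rule induction alone says nothing about types of the lower level, as \<open>L\<close> is
  a parameter of \<open>LR\<close>. Well-founded induction on the level around it provides the
  hypothesis at sorts, for all pairs in all contexts.\<close>

lemma lr_induct [consumes 1, case_names ne srt pi]:
  assumes lr: "lr n \<Gamma> A B"
    and ne: "\<And>n \<Gamma> A B N N'. ne_rel n \<Gamma> A B N N' \<Longrightarrow> P n \<Gamma> A B"
    and srt: "\<And>k \<Gamma> A B. srt_rel k \<Gamma> A B \<Longrightarrow> (\<And>\<Delta> C D. lr k \<Delta> C D \<Longrightarrow> P k \<Delta> C D) \<Longrightarrow> P (Suc k) \<Gamma> A B"
    and pi: "\<And>r i j \<Gamma> A B U T U' T'. pi_rel r i j \<Gamma> A B U T U' T' \<Longrightarrow>
      (\<And>\<Delta> \<rho>. ren \<Delta> \<rho> \<Gamma> \<Longrightarrow> P i \<Delta> (rn \<rho> U) (rn \<rho> U')) \<Longrightarrow>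
      (\<And>\<Delta> \<rho> v v'. ren \<Delta> \<rho> \<Gamma> \<Longrightarrow> args r \<Delta> (rn \<rho> U) v v' \<Longrightarrow> P j \<Delta> (inst \<rho> v T) (inst \<rho> v' T')) \<Longrightarrow>
      P (max i j) \<Gamma> A B"
  shows "P n \<Gamma> A B"
proof -
  have "LR lr n \<Gamma> A B R \<Longrightarrow> P n \<Gamma> A B" for n \<Gamma> A B R
  proof (induction n arbitrary: \<Gamma> A B R rule: less_induct)
    case (less n)
    have "LR lr m \<Gamma> A B R \<Longrightarrow> m \<le> n \<Longrightarrow> P m \<Gamma> A B" for m \<Gamma> A B R
    proof (induction rule: LR.induct)
      case (LR_ne n \<Gamma> A N B N')
      then show ?case by (intro ne) (simp add: ne_rel_def)
    next
      case (LR_srt k \<Gamma> A B)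
      then have "P k \<Delta> C D" if "lr k \<Delta> C D" for \<Delta> C D
        using that less.IH[of k] lr_iff[of k \<Delta> C D] by auto
      with LR_srt show ?case by (intro srt) (auto simp: srt_rel_def)
    next
      case (LR_pi i j \<Gamma> A r U T B U' T' RU RT)
      have RU: "tmr \<Delta> (rn \<rho> U) = RU \<Delta> \<rho>" if "ren \<Delta> \<rho> \<Gamma>" for \<Delta> \<rho>
        using LR_pi.hyps(5)[OF that] by (rule tmr_eq)
      show ?case
        by (rule pi[of r i j \<Gamma> A B U T U' T'])
          (use LR_pi.hyps(1-4) LR_pi.IH LR_pi.prems RU in
            \<open>auto simp: pi_rel_def intro: lrI LR_pi.hyps(5,6)\<close>)
    qed
    with less.prems show ?case by blast
  qed
  with lr show ?thesis by (auto simp: lr_iff)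
qed

lemma lr_cases [consumes 1, case_names ne srt pi]:
  assumes "lr n \<Gamma> A B"
  obtains N N' where "ne_rel n \<Gamma> A B N N'"
  | k where "n = Suc k" "srt_rel k \<Gamma> A B"
  | r i j U T U' T' where "n = max i j" "pi_rel r i j \<Gamma> A B U T U' T'"
proof -
  from assms have "(\<exists>N N'. ne_rel n \<Gamma> A B N N') \<or> (\<exists>k. n = Suc k \<and> srt_rel k \<Gamma> A B) \<or>
    (\<exists>r i j U T U' T'. n = max i j \<and> pi_rel r i j \<Gamma> A B U T U' T')"
    by (induction rule: lr_induct) blast+
  then show ?thesis using that by blast
qed

lemma lr_neD:
  assumes "lr n \<Gamma> A B" "A \<searrow> N" "neutral N"
  shows "\<exists>N'. ne_rel n \<Gamma> A B N N'"
  using assms(1)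
proof (cases rule: lr_cases)
  case (ne M N')
  moreover from this have "M = N" by (auto simp: ne_rel_def dest!: ev_fun[OF assms(2)])
  ultimately show ?thesis by blast
qed (use assms(3) in \<open>auto simp: srt_rel_def pi_rel_def dest!: ev_fun[OF assms(2)]\<close>)

lemma lr_srtD:
  assumes "lr n \<Gamma> A B" "A \<searrow> Set' k"
  shows "n = Suc k \<and> srt_rel k \<Gamma> A B"
  using assms(1)
proof (cases rule: lr_cases)
  case (srt k')
  moreover from this have "k' = k" by (auto simp: srt_rel_def dest!: ev_fun[OF assms(2)])
  ultimately show ?thesis by simp
qed (auto simp: ne_rel_def pi_rel_def dest!: ev_fun[OF assms(2)])

lemma lr_piD:
  assumes "lr n \<Gamma> A B" "A \<searrow> Pi r s s' U T"
  shows "\<exists>i j U' T'. s = SetS i \<and> s' = SetS j \<and> n = max i j \<and> pi_rel r i j \<Gamma> A B U T U' T'"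
  using assms(1)
proof (cases rule: lr_cases)
  case (pi r' i j V S U' T')
  moreover from this have "Pi r' (SetS i) (SetS j) V S = Pi r s s' U T"
    by (auto simp: pi_rel_def dest!: ev_fun[OF assms(2)])
  ultimately show ?thesis by auto
qed (auto simp: ne_rel_def srt_rel_def dest!: ev_fun[OF assms(2)])

text \<open>The declarative counterpart of \<open>arg_rel\<close>: what congruence of application
  asks of its two arguments, uniformly in the annotation.\<close>

primrec targ :: "ann \<Rightarrow> ctx \<Rightarrow> exp \<Rightarrow> exp \<Rightarrow> exp \<Rightarrow> bool" where
  "targ Rel \<Delta> V v v' = teq \<Delta> v v' V"
| "targ Irr \<Delta> V v v' = (resurrect \<Delta> \<turnstile> v \<^bold>: V \<and> resurrect \<Delta> \<turnstile> v' \<^bold>: V)"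

lemma targ_left: "targ r \<Delta> V v v' \<Longrightarrow> ctx_for r \<Delta> \<turnstile> v \<^bold>: V"
  and targ_right: "targ r \<Delta> V v v' \<Longrightarrow> ctx_for r \<Delta> \<turnstile> v' \<^bold>: V"
  by (cases r; auto simp: teq_def)+

lemma targ_refl: "ctx_for r \<Delta> \<turnstile> v \<^bold>: V \<Longrightarrow> targ r \<Delta> V v v"
  by (cases r) (auto intro: teq_refl)

lemma eq_app_targ: "\<Gamma> \<turnstile> t \<^bold>= t' \<^bold>: Pi r s s' U T \<Longrightarrow> targ r \<Gamma> U u u' \<Longrightarrow>
    \<Gamma> \<turnstile> App r t u \<^bold>= App r t' u' \<^bold>: subst u T"
  by (cases r) (auto simp: teq_def intro: eq_app_rel eq_app_irr)

lemma wf_head: "\<turnstile> (r, U) # \<Gamma> \<Longrightarrow> \<exists>s. \<Gamma> \<turnstile> U \<^bold>: Srt s"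
  by (auto elim: wf_consE)

lemma sbok_inst:
  assumes "ctx_for r \<Gamma> \<turnstile> u \<^bold>: U" "\<turnstile> \<Gamma>"
  shows "sbok \<Gamma> (case_nat u Var) ((r, U) # \<Gamma>)"
  unfolding sbok_def
proof (intro conjI allI impI)
  fix x r' T assume "in_ctx x r' T ((r, U) # \<Gamma>)"
  then show "ctx_for r' \<Gamma> \<turnstile> case_nat u Var x \<^bold>: sb (case_nat u Var) T"
  proof (cases rule: in_ctx_ConsE)
    case here
    then show ?thesis using assms(1) by (simp add: lift_eq_rn sb_rn)
  next
    case (there y S)
    then show ?thesis using assms(2) by (auto simp: lift_eq_rn sb_rn intro!: ty_var ctx_for_wf in_ctx_for)
  qed
qed (rule assms)

lemma subst_typing:
  assumes "(r, U) # \<Gamma> \<turnstile> t \<^bold>: T" "ctx_for r \<Gamma> \<turnstile> u \<^bold>: U"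
  shows "\<Gamma> \<turnstile> subst u t \<^bold>: subst u T"
  using sb_typing[OF assms(1) sbok_inst[OF assms(2)]] wf_typing[OF assms(1)]
  by (auto simp: subst_eq_sb elim: wf_consE)

lemma subst_equal:
  assumes "(r, U) # \<Gamma> \<turnstile> t \<^bold>= t' \<^bold>: T" "ctx_for r \<Gamma> \<turnstile> u \<^bold>: U"
  shows "\<Gamma> \<turnstile> subst u t \<^bold>= subst u t' \<^bold>: subst u T"
  using sb_equal[OF assms(1) sbok_inst[OF assms(2)]] wf_equal[OF assms(1)]
  by (auto simp: subst_eq_sb elim: wf_consE)

lemma teq_subst:
  assumes T: "(r, U) # \<Gamma> \<turnstile> T \<^bold>: Srt s" and v: "targ r \<Gamma> U v v'"
  shows "teq \<Gamma> (subst v T) (subst v' T) (Srt s)"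
proof -
  \<comment> \<open>Both sides are \<open>\<beta>\<close>-reducts of applications of the function \<open>\<lambda>x\<star>U. T\<close>.\<close>
  obtain m where m: "s = SetS m" by (cases s)
  obtain s0 where "\<Gamma> \<turnstile> U \<^bold>: Srt s0" using wf_typing[OF T] wf_head by blast
  then obtain i where U: "\<Gamma> \<turnstile> U \<^bold>: Set' i" by (cases s0) auto
  have "(r, U) # \<Gamma> \<turnstile> Set' m \<^bold>: Set' (Suc m)"
    using wf_typing[OF T] by (rule Set'_typing)
  from ty_pi[OF U this Rule_max] T
  have "\<Gamma> \<turnstile> Lam r U T \<^bold>: Pi r (SetS i) (SetS (Suc m)) U (Srt s)"
    unfolding m by (rule ty_lam[rotated])
  from eq_app_targ[OF eq_refl[OF this] v]
  have "\<Gamma> \<turnstile> App r (Lam r U T) v \<^bold>= App r (Lam r U T) v' \<^bold>: Srt s" by simp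
  with eq_beta[OF T targ_left[OF v]] eq_beta[OF T targ_right[OF v]]
  have "\<Gamma> \<turnstile> subst v T \<^bold>= subst v' T \<^bold>: Srt s"
    by simp (blast intro: eq_sym eq_trans)
  with subst_typing[OF T targ_left[OF v]] subst_typing[OF T targ_right[OF v]]
  show ?thesis by (simp add: teq_def)
qed

lemma teq_App:
  assumes t: "teq \<Gamma> t t' (Pi r s s' U T)" and T: "(r, U) # \<Gamma> \<turnstile> T \<^bold>: Srt s0" and v: "targ r \<Gamma> U v v'"
  shows "teq \<Gamma> (App r t v) (App r t' v') (subst v T)"
  unfolding teq_def
proof (intro conjI)
  show "\<Gamma> \<turnstile> App r t v \<^bold>= App r t' v' \<^bold>: subst v T"
    by (rule eq_app_targ[OF teq_equal[OF t] v])
  show "\<Gamma> \<turnstile> App r t v \<^bold>: subst v T"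
    by (rule ty_app[OF teq_left[OF t] targ_left[OF v]])
  have "\<Gamma> \<turnstile> App r t' v' \<^bold>: subst v' T"
    by (rule ty_app[OF teq_right[OF t] targ_right[OF v]])
  then show "\<Gamma> \<turnstile> App r t' v' \<^bold>: subst v T"
    by (rule ty_conv) (rule eq_sym[OF teq_equal[OF teq_subst[OF T v]]])
qed

subsection \<open>The logical relation is a Kripke partial equivalence relation\<close>

lemma lr_teq:
  assumes "lr n \<Gamma> A B"
  shows "teq \<Gamma> A B (Set' n)"
  using assms
proof (cases rule: lr_cases)
  case (srt k)
  then show ?thesis unfolding srt_rel_def ev_def by (blast intro: teq_sym teq_trans)
next
  case (pi r i j U T U' T')
  then have 1: "teq \<Gamma> A (Pi r (SetS i) (SetS j) U T) (Set' n)"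
    and 2: "teq \<Gamma> B (Pi r (SetS i) (SetS j) U' T') (Set' n)"
    by (simp_all add: pi_rel_def ev_def)
  from pi have "teq \<Gamma> (Pi r (SetS i) (SetS j) U T) (Pi r (SetS i) (SetS j) U' T') (Set' n)"
    by (simp add: pi_rel_def teq_Pi)
  from teq_trans[OF teq_trans[OF 1 this] teq_sym[OF 2]] show ?thesis .
qed (simp add: ne_rel_def)

lemma tmr_teq:
  assumes "lr n \<Gamma> A B" "tmr \<Gamma> A t u"
  shows "teq \<Gamma> t u A"
  using assms(1)
  by (cases rule: lr_cases) (use assms(2) in \<open>auto simp: ne_rel srt_rel pi_rel pi_tm_def\<close>)

lemma args_targ: "lr n \<Delta> V W \<Longrightarrow> args r \<Delta> V v v' \<Longrightarrow> targ r \<Delta> V v v'"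
  by (cases r) (auto intro: tmr_teq)

text \<open>The exchange property of the term relation is a hypothesis, so that the lemma can be
  applied to induction hypotheses inside the proof of \<open>lr_swap\<close>.\<close>

lemma args_swap:
  assumes "lr n \<Delta> V W" "\<And>t u. tmr \<Delta> V t u \<longleftrightarrow> tmr \<Delta> W u t"
  shows "args r \<Delta> W v v' \<longleftrightarrow> args r \<Delta> V v' v"
proof (cases r)
  case Irr
  have "resurrect \<Delta> \<turnstile> V \<^bold>= W \<^bold>: Set' n"
    using lr_teq[OF assms(1)] by (auto simp: teq_def intro: resurrect_equal)
  with Irr show ?thesis by (auto intro: ty_conv eq_sym)
qed (simp add: assms(2))

lemma pi_rel_ren:
  assumes "pi_rel r i j \<Gamma> A B U T U' T'" "ren \<Delta> \<rho> \<Gamma>"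
  shows "lr i \<Delta> (rn \<rho> U) (rn \<rho> U')"
    and "args r \<Delta> (rn \<rho> U) v v' \<Longrightarrow> lr j \<Delta> (inst \<rho> v T) (inst \<rho> v' T')"
  using assms unfolding pi_rel_def by blast+

text \<open>The two claims need each other: exchanging two function types also exchanges their
  related arguments, which is an exchange of the term relations of the domains. The single
  equivalence combines symmetry and conversion of terms; \<open>tmr_sym\<close> and
  \<open>tmr_conv\<close> separate them once types are known to be related to themselves.\<close>

lemma lr_swap: "lr n \<Gamma> A B \<Longrightarrow> lr n \<Gamma> B A \<and> (\<forall>t u. tmr \<Gamma> A t u \<longleftrightarrow> tmr \<Gamma> B u t)"
proof (induction rule: lr_induct)
  case (ne n \<Gamma> A B N N')
  then have BA: "ne_rel n \<Gamma> B A N' N" by (auto simp: ne_rel_def intro: teq_sym)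
  then have "teq \<Gamma> B A (Set' n)" by (simp add: ne_rel_def)
  then show ?case using ne_rel[OF ne] ne_rel[OF BA] by (blast intro: teq_sym teq_conv teq_conv')
next
  case (srt k \<Gamma> A B)
  then have BA: "srt_rel k \<Gamma> B A" by (simp add: srt_rel_def)
  have "teq \<Gamma> B A (Set' (Suc k))" using lr_teq srt_rel(1)[OF BA] by blast
  then show ?case using srt_rel[OF srt(1)] srt_rel[OF BA] srt.IH
    by (blast intro: teq_sym teq_conv teq_conv')
next
  case (pi r i j \<Gamma> A B U T U' T')
  have args: "args r \<Delta> (rn \<rho> U') v v' \<longleftrightarrow> args r \<Delta> (rn \<rho> U) v' v" if "ren \<Delta> \<rho> \<Gamma>" for \<Delta> \<rho> v v'
    using pi_rel_ren(1)[OF pi(1) that] pi.IH(1)[OF that] args_swap by blast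
  have BA: "pi_rel r i j \<Gamma> B A U' T' U T"
    unfolding pi_rel_def
  proof (intro conjI allI impI)
    show "teq ((r, U') # \<Gamma>) T' T (Set' j)"
      using pi(1) unfolding pi_rel_def by (blast intro: teq_ctx_conv teq_sym)
  qed (use pi(1) pi.IH args in \<open>auto simp: pi_rel_def intro: teq_sym\<close>)
  have AB: "teq \<Gamma> A B (Set' (max i j))" using lr_teq pi_rel(1)[OF pi(1)] by blast
  have "pi_tm r \<Gamma> A U T t u \<longleftrightarrow> pi_tm r \<Gamma> B U' T' u t" for t u
  proof -
    have "teq \<Gamma> t u A \<longleftrightarrow> teq \<Gamma> u t B" using AB by (blast intro: teq_sym teq_conv teq_conv')
    then show ?thesis unfolding pi_tm_def using args pi.IH(2) by (metis (no_types, lifting))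
  qed
  then show ?case using pi_rel[OF pi(1)] pi_rel[OF BA] by simp
qed

lemma lr_sym: "lr n \<Gamma> A B \<Longrightarrow> lr n \<Gamma> B A"
  and tmr_swap: "lr n \<Gamma> A B \<Longrightarrow> tmr \<Gamma> A t u \<longleftrightarrow> tmr \<Gamma> B u t"
  using lr_swap by blast+

lemma args_swap':
  assumes "lr n \<Delta> V W"
  shows "args r \<Delta> W v v' \<longleftrightarrow> args r \<Delta> V v' v"
  by (rule args_swap[OF assms tmr_swap[OF assms]])

text \<open>Types and terms again go together: composing two families of codomains needs an
  intermediate argument related to itself, and this comes from transitivity of the term relation on
  the domain.\<close>

lemma lr_tmr_trans: "lr n \<Gamma> A B \<Longrightarrow> (\<forall>C. lr n \<Gamma> B C \<longrightarrow> lr n \<Gamma> A C) \<and>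
    (\<forall>t u v. tmr \<Gamma> A t u \<longrightarrow> tmr \<Gamma> A u v \<longrightarrow> tmr \<Gamma> A t v)"
proof (induction rule: lr_induct)
  case (ne n \<Gamma> A B N N')
  have "lr n \<Gamma> A C" if BC: "lr n \<Gamma> B C" for C
  proof -
    obtain N'' where "ne_rel n \<Gamma> B C N' N''"
      using lr_neD[OF BC] ne by (auto simp: ne_rel_def ev_def)
    with ne have "ne_rel n \<Gamma> A C N N''" by (auto simp: ne_rel_def intro: teq_trans)
    then show ?thesis by (rule ne_rel)
  qed
  then show ?case using ne_rel(2)[OF ne] by (blast intro: teq_trans)
next
  case (srt k \<Gamma> A B)
  have "lr (Suc k) \<Gamma> A C" if "lr (Suc k) \<Gamma> B C" for C
  proof -
    have "srt_rel k \<Gamma> B C"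
      using lr_srtD[OF that] srt(1) by (auto simp: srt_rel_def ev_def)
    with srt have "srt_rel k \<Gamma> A C" by (auto simp: srt_rel_def)
    then show ?thesis by (rule srt_rel)
  qed
  then show ?case using srt_rel(2)[OF srt(1)] srt.IH by (blast intro: teq_trans)
next
  case (pi r i j \<Gamma> A B U T U' T')
  have UU: "lr i \<Delta> (rn \<rho> U) (rn \<rho> U)" if "ren \<Delta> \<rho> \<Gamma>" for \<Delta> \<rho>
    using pi_rel_ren(1)[OF pi(1) that] pi.IH(1)[OF that] lr_sym by blast
  \<comment> \<open>As in any partial equivalence relation, the right argument is related to itself
    by way of the left one. The second half transfers this to the other domain, where the next
    family of codomains expects it.\<close>
  have args: "args r \<Delta> (rn \<rho> U) v' v'" "args r \<Delta> (rn \<rho> U') v' v'"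
    if "ren \<Delta> \<rho> \<Gamma>" "args r \<Delta> (rn \<rho> U) v v'" for \<Delta> \<rho> v v'
  proof -
    have tr: "tmr \<Delta> (rn \<rho> U) x y \<Longrightarrow> tmr \<Delta> (rn \<rho> U) y z \<Longrightarrow> tmr \<Delta> (rn \<rho> U) x z" for x y z
      using conjunct2[OF pi.IH(1)[OF that(1)]] by (elim allE impE)
    have *: "args r \<Delta> (rn \<rho> U) v' v"
      using args_swap'[OF UU[OF that(1)]] that(2) by blast
    show "args r \<Delta> (rn \<rho> U) v' v'"
    proof (cases r)
      case Rel
      with * that(2) show ?thesis by (simp only: arg_rel.simps) (rule tr)
    next
      case Irr
      with that(2) show ?thesis by simp
    qed
    with args_swap'[OF pi_rel_ren(1)[OF pi(1) that(1)]]
    show "args r \<Delta> (rn \<rho> U') v' v'" by blast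
  qed
  have lr_trans: "lr (max i j) \<Gamma> A C" if lr: "lr (max i j) \<Gamma> B C" for C
  proof -
    have "B \<searrow> Pi r (SetS i) (SetS j) U' T'" using pi(1) by (simp add: pi_rel_def ev_def)
    from lr_piD[OF lr this] obtain U'' T'' where BC: "pi_rel r i j \<Gamma> B C U' T' U'' T''" by auto
    have "pi_rel r i j \<Gamma> A C U T U'' T''"
      unfolding pi_rel_def
    proof (intro conjI allI impI)
      show "teq \<Gamma> U U'' (Set' i)" using pi(1) BC by (auto simp: pi_rel_def intro: teq_trans)
      have "teq ((r, U) # \<Gamma>) T' T'' (Set' j)"
        using pi(1) BC unfolding pi_rel_def by (blast intro: teq_ctx_conv teq_sym)
      then show "teq ((r, U) # \<Gamma>) T T'' (Set' j)" using pi(1) by (auto simp: pi_rel_def intro: teq_trans)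
    next
      fix \<Delta> \<rho> assume r: "ren \<Delta> \<rho> \<Gamma>"
      then show "lr i \<Delta> (rn \<rho> U) (rn \<rho> U'')" using pi.IH(1) pi_rel_ren(1)[OF BC] by blast
      fix v v' assume v: "args r \<Delta> (rn \<rho> U) v v'"
      from pi.IH(2)[OF r v] pi_rel_ren(2)[OF BC r args(2)[OF r v]]
      show "lr j \<Delta> (inst \<rho> v T) (inst \<rho> v' T'')" by blast
    qed (use pi(1) BC in \<open>auto simp: pi_rel_def\<close>)
    then show ?thesis by (rule pi_rel)
  qed
  have "pi_tm r \<Gamma> A U T t1 t3" if "pi_tm r \<Gamma> A U T t1 t2" "pi_tm r \<Gamma> A U T t2 t3" for t1 t2 t3
    unfolding pi_tm_def
  proof (intro conjI allI impI)
    show "teq \<Gamma> t1 t3 A" using that by (auto simp: pi_tm_def intro: teq_trans)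
    fix \<Delta> \<rho> v v' assume r: "ren \<Delta> \<rho> \<Gamma>" and v: "args r \<Delta> (rn \<rho> U) v v'"
    have "tmr \<Delta> (inst \<rho> v' T) (App r (rn \<rho> t2) v') (App r (rn \<rho> t3) v')"
      using that(2) r args(1)[OF r v] by (simp add: pi_tm_def)
    \<comment> \<open>The instances of \<open>T\<close> at \<open>v\<close> and at \<open>v'\<close>
      are both related to the instance of \<open>T'\<close> at \<open>v'\<close>, so two exchanges
      carry the pair from one to the other.\<close>
    then have "tmr \<Delta> (inst \<rho> v T) (App r (rn \<rho> t2) v') (App r (rn \<rho> t3) v')"
      using tmr_swap[OF pi_rel_ren(2)[OF pi(1) r v]]
        tmr_swap[OF pi_rel_ren(2)[OF pi(1) r args(1)[OF r v]]] by blast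
    moreover have "tmr \<Delta> (inst \<rho> v T) (App r (rn \<rho> t1) v) (App r (rn \<rho> t2) v')"
      using that(1) r v by (simp add: pi_tm_def)
    ultimately show "tmr \<Delta> (inst \<rho> v T) (App r (rn \<rho> t1) v) (App r (rn \<rho> t3) v')"
      using pi.IH(2)[OF r v] by blast
  qed
  with lr_trans show ?case unfolding pi_rel(2)[OF pi(1)] by blast
qed

lemma lr_trans: "lr n \<Gamma> A B \<Longrightarrow> lr n \<Gamma> B C \<Longrightarrow> lr n \<Gamma> A C"
  and tmr_trans: "lr n \<Gamma> A B \<Longrightarrow> tmr \<Gamma> A t u \<Longrightarrow> tmr \<Gamma> A u v \<Longrightarrow> tmr \<Gamma> A t v"
  using lr_tmr_trans by blast+

lemma lr_refl: "lr n \<Gamma> A B \<Longrightarrow> lr n \<Gamma> A A"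
  using lr_sym lr_trans by blast

lemma tmr_sym: "lr n \<Gamma> A B \<Longrightarrow> tmr \<Gamma> A t u \<Longrightarrow> tmr \<Gamma> A u t"
  using lr_refl tmr_swap by blast

lemma tmr_refl: "lr n \<Gamma> A B \<Longrightarrow> tmr \<Gamma> A t u \<Longrightarrow> tmr \<Gamma> A t t"
  using tmr_sym tmr_trans by blast

lemma tmr_conv: "lr n \<Gamma> A B \<Longrightarrow> tmr \<Gamma> A t u \<longleftrightarrow> tmr \<Gamma> B t u"
  using tmr_swap tmr_sym lr_sym by blast

lemma args_refl: "lr n \<Delta> V W \<Longrightarrow> args r \<Delta> V v v' \<Longrightarrow> args r \<Delta> V v v"
  by (cases r) (auto intro: tmr_refl)

lemma inst_rn: "inst \<rho>' v (rn (case_nat 0 (\<lambda>x. Suc (\<rho> x))) T) = inst (\<lambda>x. \<rho>' (\<rho> x)) v T"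
  by (auto simp: sb_rn intro!: sb_cong split: nat.split)

lemma subst_rn_up: "subst v (rn (case_nat 0 (\<lambda>x. Suc (\<rho> x))) T) = inst \<rho> v T"
  by (auto simp: subst_eq_sb sb_rn intro!: sb_cong split: nat.split)

text \<open>Kripke monotonicity. The clause for function types already quantifies over renamings, so
  composition of renamings settles it; induction hypotheses are used only at sorts, whose terms are
  types of the level below.\<close>

lemma lr_ren: "lr n \<Gamma> A B \<Longrightarrow> \<forall>\<Delta> \<rho>. ren \<Delta> \<rho> \<Gamma> \<longrightarrow> lr n \<Delta> (rn \<rho> A) (rn \<rho> B) \<and>
    (\<forall>t u. tmr \<Gamma> A t u \<longrightarrow> tmr \<Delta> (rn \<rho> A) (rn \<rho> t) (rn \<rho> u))"
proof (induction rule: lr_induct)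
  case (ne n \<Gamma> A B N N')
  show ?case
  proof (intro allI impI)
    fix \<Delta> \<rho> assume r: "ren \<Delta> \<rho> \<Gamma>"
    have "ne_rel n \<Delta> (rn \<rho> A) (rn \<rho> B) (rn \<rho> N) (rn \<rho> N')"
      using ne r teq_rn[of \<Gamma> A B "Set' n"] by (auto simp: ne_rel_def intro: ev_rn)
    then show "lr n \<Delta> (rn \<rho> A) (rn \<rho> B) \<and>
      (\<forall>t u. tmr \<Gamma> A t u \<longrightarrow> tmr \<Delta> (rn \<rho> A) (rn \<rho> t) (rn \<rho> u))"
      using ne_rel(2)[OF ne] r by (simp add: ne_rel teq_rn)
  qed
next
  case (srt k \<Gamma> A B)
  show ?case
  proof (intro allI impI)
    fix \<Delta> \<rho> assume r: "ren \<Delta> \<rho> \<Gamma>"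
    have "srt_rel k \<Delta> (rn \<rho> A) (rn \<rho> B)"
      using srt(1) ev_rn[OF _ r, of _ _ "Set' k"] by (auto simp: srt_rel_def)
    then show "lr (Suc k) \<Delta> (rn \<rho> A) (rn \<rho> B) \<and>
      (\<forall>t u. tmr \<Gamma> A t u \<longrightarrow> tmr \<Delta> (rn \<rho> A) (rn \<rho> t) (rn \<rho> u))"
      using srt_rel(2)[OF srt(1)] r srt.IH by (auto simp: srt_rel intro: teq_rn)
  qed
next
  case (pi r i j \<Gamma> A B U T U' T')
  show ?case
  proof (intro allI impI)
    fix \<Delta> \<rho> assume r: "ren \<Delta> \<rho> \<Gamma>"
    let ?up = "case_nat 0 (\<lambda>x. Suc (\<rho> x))"
    have U: "teq \<Delta> (rn \<rho> U) (rn \<rho> U') (Set' i)"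
      using teq_rn[of \<Gamma> U U' "Set' i", OF _ r] pi(1) by (simp add: pi_rel_def)
    have T: "teq ((r, rn \<rho> U) # \<Delta>) (rn ?up T) (rn ?up T') (Set' j)"
      using teq_rn[OF _ ren_up[OF r teq_left[OF U]], of r T T' "Set' j"] pi(1)
      by (simp add: pi_rel_def)
    have AB: "pi_rel r i j \<Delta> (rn \<rho> A) (rn \<rho> B) (rn \<rho> U) (rn ?up T) (rn \<rho> U') (rn ?up T')"
      unfolding pi_rel_def
    proof (intro conjI allI impI U T)
      show "ev (max i j) \<Delta> (rn \<rho> A) (Pi r (SetS i) (SetS j) (rn \<rho> U) (rn ?up T))"
        and "ev (max i j) \<Delta> (rn \<rho> B) (Pi r (SetS i) (SetS j) (rn \<rho> U') (rn ?up T'))"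
        using pi(1) ev_rn[OF _ r] unfolding pi_rel_def rn.simps[symmetric] by blast+
    next
      fix \<Delta>' \<rho>' assume r': "ren \<Delta>' \<rho>' \<Delta>"
      show "lr i \<Delta>' (rn \<rho>' (rn \<rho> U)) (rn \<rho>' (rn \<rho> U'))"
        unfolding rn_rn by (rule pi_rel_ren(1)[OF pi(1) ren_comp[OF r' r]])
      fix v v' assume "args r \<Delta>' (rn \<rho>' (rn \<rho> U)) v v'"
      then show "lr j \<Delta>' (inst \<rho>' v (rn ?up T)) (inst \<rho>' v' (rn ?up T'))"
        unfolding rn_rn inst_rn by (rule pi_rel_ren(2)[OF pi(1) ren_comp[OF r' r]])
    qed
    have "pi_tm r \<Delta> (rn \<rho> A) (rn \<rho> U) (rn ?up T) (rn \<rho> t) (rn \<rho> u)" if "pi_tm r \<Gamma> A U T t u" for t u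
      using that r ren_comp[OF _ r] unfolding pi_tm_def rn_rn inst_rn by (blast intro: teq_rn)
    then show "lr (max i j) \<Delta> (rn \<rho> A) (rn \<rho> B) \<and>
      (\<forall>t u. tmr \<Gamma> A t u \<longrightarrow> tmr \<Delta> (rn \<rho> A) (rn \<rho> t) (rn \<rho> u))"
      using pi_rel(2)[OF pi(1)] pi_rel[OF AB] by simp
  qed
qed

lemma lr_rn: "lr n \<Gamma> A B \<Longrightarrow> ren \<Delta> \<rho> \<Gamma> \<Longrightarrow> lr n \<Delta> (rn \<rho> A) (rn \<rho> B)"
  and tmr_rn: "lr n \<Gamma> A B \<Longrightarrow> ren \<Delta> \<rho> \<Gamma> \<Longrightarrow> tmr \<Gamma> A t u \<Longrightarrow> tmr \<Delta> (rn \<rho> A) (rn \<rho> t) (rn \<rho> u)"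
  using lr_ren by blast+

lemma pi_rel_App:
  assumes AB: "pi_rel r i j \<Gamma> A B U T U' T'" and r: "ren \<Delta> \<rho> \<Gamma>"
    and v: "args r \<Delta> (rn \<rho> U) v v'" and t: "teq \<Gamma> t u A"
  shows "teq \<Delta> (App r (rn \<rho> t) v) (App r (rn \<rho> u) v') (inst \<rho> v T)"
proof -
  let ?up = "case_nat 0 (\<lambda>x. Suc (\<rho> x))"
  have "teq \<Gamma> t u (Pi r (SetS i) (SetS j) U T)"
    using t AB by (auto simp: pi_rel_def ev_def intro: teq_conv)
  from teq_rn[OF this r]
  have tu: "teq \<Delta> (rn \<rho> t) (rn \<rho> u) (Pi r (SetS i) (SetS j) (rn \<rho> U) (rn ?up T))" by simp
  have "\<Delta> \<turnstile> rn \<rho> U \<^bold>: Set' i" using pi_rel_ren(1)[OF AB r] lr_teq teq_left by blast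
  from rn_typing[OF _ ren_up[OF r this], of r T "Set' j"] AB
  have "(r, rn \<rho> U) # \<Delta> \<turnstile> rn ?up T \<^bold>: Set' j" by (auto simp: pi_rel_def teq_def)
  from teq_App[OF tu this args_targ[OF pi_rel_ren(1)[OF AB r] v]]
  show ?thesis by (simp add: subst_rn_up)
qed

text \<open>Applying a neutral term gives a neutral term, so the claim descends through function
  types to the clauses where declarative equality decides. It is what makes variables related to
  themselves.\<close>

lemma tmr_neutral: "lr n \<Gamma> A B \<Longrightarrow> \<forall>t u. neutral t \<longrightarrow> neutral u \<longrightarrow> teq \<Gamma> t u A \<longrightarrow> tmr \<Gamma> A t u"
proof (induction rule: lr_induct)
  case (ne n \<Gamma> A B N N')
  then show ?case by (simp add: ne_rel)
next
  case (srt k \<Gamma> A B)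
  have "lr k \<Gamma> t u" if "neutral t" "neutral u" "teq \<Gamma> t u A" for t u
  proof -
    have "teq \<Gamma> t u (Set' k)"
      using that srt(1) by (auto simp: srt_rel_def ev_def intro: teq_conv)
    with that have "ne_rel k \<Gamma> t u t u"
      by (auto simp: ne_rel_def ev_def eval_ne intro: teq_refl dest: teq_left teq_right)
    then show ?thesis by (rule ne_rel)
  qed
  then show ?case by (simp add: srt_rel(2)[OF srt(1)])
next
  case (pi r i j \<Gamma> A B U T U' T')
  then show ?case
    by (simp add: pi_rel(2)[OF pi(1)] pi_tm_def pi_rel_App[OF pi(1)])
qed

lemma lr_whr:
  assumes "lr n \<Gamma> A B" and A0: "whr A0 A" "teq \<Gamma> A0 A (Set' n)"
  shows "lr n \<Gamma> A0 B"
  using assms(1)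
proof (cases rule: lr_cases)
  case (ne N N')
  with A0 have "ne_rel n \<Gamma> A0 B N N'" by (auto simp: ne_rel_def intro: ev_whr teq_trans)
  then show ?thesis by (rule ne_rel)
next
  case (srt k)
  with A0 have "srt_rel k \<Gamma> A0 B" by (auto simp: srt_rel_def intro: ev_whr)
  then show ?thesis unfolding srt(1) by (rule srt_rel)
next
  case (pi r i j U T U' T')
  with A0 have "pi_rel r i j \<Gamma> A0 B U T U' T'" by (auto simp: pi_rel_def intro: ev_whr)
  then show ?thesis unfolding pi(1) by (rule pi_rel)
qed

text \<open>A head step persists under renaming and application, which handles function types; at a
  sort the terms are types and \<open>lr_whr\<close> applies.\<close>

lemma tmr_whr_aux: "lr n \<Gamma> A B \<Longrightarrow>
    \<forall>t0 t u. whr t0 t \<longrightarrow> teq \<Gamma> t0 t A \<longrightarrow> tmr \<Gamma> A t u \<longrightarrow> tmr \<Gamma> A t0 u"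
proof (induction rule: lr_induct)
  case (ne n \<Gamma> A B N N')
  then show ?case by (auto simp: ne_rel intro: teq_trans)
next
  case (srt k \<Gamma> A B)
  have "lr k \<Gamma> t0 u" if "whr t0 t" "teq \<Gamma> t0 t A" "lr k \<Gamma> t u" for t0 t u
  proof -
    have "teq \<Gamma> t0 t (Set' k)" using that srt(1) by (auto simp: srt_rel_def ev_def intro: teq_conv)
    with that lr_whr show ?thesis by blast
  qed
  then show ?case unfolding srt_rel(2)[OF srt(1)] by (blast intro: teq_trans)
next
  case (pi r i j \<Gamma> A B U T U' T')
  have "pi_tm r \<Gamma> A U T t0 u" if "whr t0 t" "teq \<Gamma> t0 t A" "pi_tm r \<Gamma> A U T t u" for t0 t u
    unfolding pi_tm_def
  proof (intro conjI allI impI)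
    show "teq \<Gamma> t0 u A" using that by (auto simp: pi_tm_def intro: teq_trans)
    fix \<Delta> \<rho> v v' assume r: "ren \<Delta> \<rho> \<Gamma>" and v: "args r \<Delta> (rn \<rho> U) v v'"
    have "whr (App r (rn \<rho> t0) v) (App r (rn \<rho> t) v)" using that by (blast intro: whr_app whr_rn)
    moreover have "teq \<Delta> (App r (rn \<rho> t0) v) (App r (rn \<rho> t) v) (inst \<rho> v T)"
      by (rule pi_rel_App[OF pi(1) r args_refl[OF pi_rel_ren(1)[OF pi(1) r] v] that(2)])
    moreover have "tmr \<Delta> (inst \<rho> v T) (App r (rn \<rho> t) v) (App r (rn \<rho> u) v')"
      using that r v by (simp add: pi_tm_def)
    ultimately show "tmr \<Delta> (inst \<rho> v T) (App r (rn \<rho> t0) v) (App r (rn \<rho> u) v')"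
      using pi.IH(2)[OF r v] by blast
  qed
  then show ?case unfolding pi_rel(2)[OF pi(1)] by blast
qed

lemma tmr_whr: "lr n \<Gamma> A B \<Longrightarrow> whr t0 t \<Longrightarrow> teq \<Gamma> t0 t A \<Longrightarrow> tmr \<Gamma> A t u \<Longrightarrow> tmr \<Gamma> A t0 u"
  using tmr_whr_aux by blast

section \<open>Typed equalities for abstractions: congruence, beta and eta\<close>

lemma teq_Lam:
  assumes U: "teq \<Gamma> U U' (Set' i)" and T: "(r, U) # \<Gamma> \<turnstile> T \<^bold>: Set' j" and t: "teq ((r, U) # \<Gamma>) t t' T"
  shows "teq \<Gamma> (Lam r U t) (Lam r U' t') (Pi r (SetS i) (SetS j) U T)"
  unfolding teq_def
proof (intro conjI)
  have T': "(r, U') # \<Gamma> \<turnstile> T \<^bold>: Set' j"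
    by (rule teq_left[OF teq_ctx_conv[OF teq_refl[OF T] U]])
  show "\<Gamma> \<turnstile> Lam r U t \<^bold>= Lam r U' t' \<^bold>: Pi r (SetS i) (SetS j) U T"
    by (rule eq_lam[OF teq_equal[OF U] T teq_equal[OF t]])
  show "\<Gamma> \<turnstile> Lam r U t \<^bold>: Pi r (SetS i) (SetS j) U T"
    by (rule ty_lam[OF teq_left[OF t] ty_pi[OF teq_left[OF U] T Rule_max]])
  have "\<Gamma> \<turnstile> Lam r U' t' \<^bold>: Pi r (SetS i) (SetS j) U' T"
    by (rule ty_lam[OF teq_right[OF teq_ctx_conv[OF t U]] ty_pi[OF teq_right[OF U] T' Rule_max]])
  then show "\<Gamma> \<turnstile> Lam r U' t' \<^bold>: Pi r (SetS i) (SetS j) U T"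
    by (rule ty_conv) (rule teq_equal[OF teq_sym[OF teq_Pi[OF U teq_refl[OF T]]]])
qed

lemma teq_beta:
  assumes U: "\<Gamma> \<turnstile> U \<^bold>: Set' i" and T: "(r, U) # \<Gamma> \<turnstile> T \<^bold>: Set' j"
    and t: "(r, U) # \<Gamma> \<turnstile> t \<^bold>: T" and u: "ctx_for r \<Gamma> \<turnstile> u \<^bold>: U"
  shows "teq \<Gamma> (App r (Lam r U t) u) (subst u t) (subst u T)"
  unfolding teq_def
proof (intro conjI)
  show "\<Gamma> \<turnstile> App r (Lam r U t) u \<^bold>: subst u T"
    by (rule ty_app[OF ty_lam[OF t ty_pi[OF U T Rule_max]] u])
qed (use eq_beta[OF t u] subst_typing[OF t u] in auto)

lemma eta_body_typing:
  assumes t: "\<Gamma> \<turnstile> t \<^bold>: Pi r s s' U T" and U: "\<Gamma> \<turnstile> U \<^bold>: Srt s1"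
  shows "(r, U) # \<Gamma> \<turnstile> App r (lift t) (Var 0) \<^bold>: T"
proof -
  have wf: "\<turnstile> (r, U) # \<Gamma>" using U wf_typing by (blast intro: wf_cons)
  from rn_typing[OF t ren_Suc[OF wf]]
  have "(r, U) # \<Gamma> \<turnstile> lift t \<^bold>: Pi r s s' (lift U) (rn (case_nat 0 (\<lambda>x. Suc (Suc x))) T)"
    by (simp add: lift_eq_rn)
  from ty_app[OF this ty_var0[OF wf]] show ?thesis by (simp only: subst_Var0_rn)
qed

lemma teq_eta:
  assumes t: "\<Gamma> \<turnstile> t \<^bold>: Pi r (SetS i) (SetS j) U T" and U: "\<Gamma> \<turnstile> U \<^bold>: Set' i"
    and T: "(r, U) # \<Gamma> \<turnstile> T \<^bold>: Set' j"
  shows "teq \<Gamma> t (Lam r U (App r (lift t) (Var 0))) (Pi r (SetS i) (SetS j) U T)"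
  unfolding teq_def
  using t eq_eta[OF t] ty_lam[OF eta_body_typing[OF t U] ty_pi[OF U T Rule_max]] by blast

text \<open>Packages, in a later world, the two hypotheses of head expansion: the step itself and
  the typed equation along it.\<close>

lemma beta_expansion:
  assumes V: "\<Delta> \<turnstile> V \<^bold>: Set' i" and S: "(r, V) # \<Delta> \<turnstile> S \<^bold>: Set' j"
    and b: "(r, V) # \<Delta> \<turnstile> b \<^bold>: S" and r: "ren \<Delta>' \<rho> \<Delta>" and v: "ctx_for r \<Delta>' \<turnstile> v \<^bold>: rn \<rho> V"
  shows "whr (App r (rn \<rho> (Lam r V b)) v) (inst \<rho> v b)"
    and "teq \<Delta>' (App r (rn \<rho> (Lam r V b)) v) (inst \<rho> v b) (inst \<rho> v S)"
proof -
  let ?up = "case_nat 0 (\<lambda>x. Suc (\<rho> x))"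
  show "whr (App r (rn \<rho> (Lam r V b)) v) (inst \<rho> v b)"
    using whr_beta[of r "rn \<rho> V" "rn ?up b" v] by (simp add: subst_rn_up)
  have V': "\<Delta>' \<turnstile> rn \<rho> V \<^bold>: Set' i" using rn_typing[OF V r] by simp
  note up = ren_up[OF r V', of r]
  have "teq \<Delta>' (App r (Lam r (rn \<rho> V) (rn ?up b)) v) (subst v (rn ?up b)) (subst v (rn ?up S))"
    by (rule teq_beta[OF V' _ _ v]) (use rn_typing[OF S up] rn_typing[OF b up] in simp_all)
  then show "teq \<Delta>' (App r (rn \<rho> (Lam r V b)) v) (inst \<rho> v b) (inst \<rho> v S)"
    by (simp add: subst_rn_up)
qed

subsection \<open>Validity\<close>

definition rel_tm :: "ctx \<Rightarrow> exp \<Rightarrow> exp \<Rightarrow> exp \<Rightarrow> exp \<Rightarrow> bool" where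
  "rel_tm \<Delta> A B t u \<longleftrightarrow> (\<exists>n. lr n \<Delta> A B) \<and> tmr \<Delta> A t u"

text \<open>Each member of an irrelevant pair is typed at its own instance of the type, and the two
  instances need not be related; symmetry and reflexivity then require no conversion.
  \<open>args_var_rel\<close> passes to the one-type form of \<open>arg_rel\<close> when the
  instances are related.\<close>

primrec var_rel :: "ann \<Rightarrow> ctx \<Rightarrow> exp \<Rightarrow> exp \<Rightarrow> exp \<Rightarrow> exp \<Rightarrow> bool" where
  "var_rel Rel \<Delta> A B t u = rel_tm \<Delta> A B t u"
| "var_rel Irr \<Delta> A B t u = (resurrect \<Delta> \<turnstile> t \<^bold>: A \<and> resurrect \<Delta> \<turnstile> u \<^bold>: B)"

definition sub_rel :: "ctx \<Rightarrow> (nat \<Rightarrow> exp) \<Rightarrow> (nat \<Rightarrow> exp) \<Rightarrow> ctx \<Rightarrow> bool" where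
  "sub_rel \<Delta> \<sigma> \<sigma>' \<Gamma> \<longleftrightarrow> \<turnstile> \<Delta> \<and>
     (\<forall>x r T. in_ctx x r T \<Gamma> \<longrightarrow> var_rel r \<Delta> (sb \<sigma> T) (sb \<sigma>' T) (\<sigma> x) (\<sigma>' x))"

text \<open>Relatedness of the two instances of \<open>T\<close> is part of the demand: symmetry and
  transitivity of validity have to move terms from one instance to the other.\<close>

definition valid :: "ctx \<Rightarrow> exp \<Rightarrow> exp \<Rightarrow> exp \<Rightarrow> bool" where
  "valid \<Gamma> t t' T \<longleftrightarrow>
     (\<forall>\<Delta> \<sigma> \<sigma>'. sub_rel \<Delta> \<sigma> \<sigma>' \<Gamma> \<longrightarrow> rel_tm \<Delta> (sb \<sigma> T) (sb \<sigma>' T) (sb \<sigma> t) (sb \<sigma>' t'))"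

lemma rel_tm_sym: "rel_tm \<Delta> A B t u \<Longrightarrow> rel_tm \<Delta> B A u t"
  unfolding rel_tm_def using lr_sym tmr_swap by blast

lemma rel_tm_left: "rel_tm \<Delta> A B t u \<Longrightarrow> rel_tm \<Delta> A A t t"
  unfolding rel_tm_def using lr_refl tmr_refl by blast

lemma sub_rel_sym: "sub_rel \<Delta> \<sigma> \<sigma>' \<Gamma> \<Longrightarrow> sub_rel \<Delta> \<sigma>' \<sigma> \<Gamma>"
proof -
  have "var_rel r \<Delta> A B t u \<Longrightarrow> var_rel r \<Delta> B A u t" for r A B t u
    by (cases r) (auto intro: rel_tm_sym)
  then show "sub_rel \<Delta> \<sigma> \<sigma>' \<Gamma> \<Longrightarrow> sub_rel \<Delta> \<sigma>' \<sigma> \<Gamma>" unfolding sub_rel_def by blast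
qed

lemma sub_rel_left: "sub_rel \<Delta> \<sigma> \<sigma>' \<Gamma> \<Longrightarrow> sub_rel \<Delta> \<sigma> \<sigma> \<Gamma>"
proof -
  have "var_rel r \<Delta> A B t u \<Longrightarrow> var_rel r \<Delta> A A t t" for r A B t u
    by (cases r) (auto intro: rel_tm_left)
  then show "sub_rel \<Delta> \<sigma> \<sigma>' \<Gamma> \<Longrightarrow> sub_rel \<Delta> \<sigma> \<sigma> \<Gamma>" unfolding sub_rel_def by blast
qed

lemma sub_rel_right: "sub_rel \<Delta> \<sigma> \<sigma>' \<Gamma> \<Longrightarrow> sub_rel \<Delta> \<sigma>' \<sigma>' \<Gamma>"
  by (blast intro: sub_rel_sym sub_rel_left)

lemma sub_rel_wf: "sub_rel \<Delta> \<sigma> \<sigma>' \<Gamma> \<Longrightarrow> \<turnstile> \<Delta>"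
  by (simp add: sub_rel_def)

lemma sub_rel_sbok: "sub_rel \<Delta> \<sigma> \<sigma>' \<Gamma> \<Longrightarrow> sbok \<Delta> \<sigma> \<Gamma>"
proof -
  have "var_rel r \<Delta> A B t u \<Longrightarrow> ctx_for r \<Delta> \<turnstile> t \<^bold>: A" for r A B t u
    by (cases r) (auto simp: rel_tm_def dest: tmr_teq teq_left)
  then show "sub_rel \<Delta> \<sigma> \<sigma>' \<Gamma> \<Longrightarrow> sbok \<Delta> \<sigma> \<Gamma>" unfolding sub_rel_def sbok_def by blast
qed

lemma sub_rel_ren:
  assumes "sub_rel \<Delta> \<sigma> \<sigma>' \<Gamma>" "ren \<Delta>' \<rho> \<Delta>"
  shows "sub_rel \<Delta>' (\<lambda>x. rn \<rho> (\<sigma> x)) (\<lambda>x. rn \<rho> (\<sigma>' x)) \<Gamma>"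
proof -
  have "var_rel r \<Delta> A B t u \<Longrightarrow> var_rel r \<Delta>' (rn \<rho> A) (rn \<rho> B) (rn \<rho> t) (rn \<rho> u)" for r A B t u
    using assms(2)
    by (cases r) (auto simp: rel_tm_def intro: lr_rn tmr_rn rn_typing ren_resurrect)
  with assms show ?thesis unfolding sub_rel_def rn_sb[symmetric] using ren_wf by blast
qed

lemma sub_rel_Cons:
  assumes "sub_rel \<Delta> \<sigma> \<sigma>' \<Gamma>" "var_rel r \<Delta> (sb \<sigma> U) (sb \<sigma>' U) v v'"
  shows "sub_rel \<Delta> (case_nat v \<sigma>) (case_nat v' \<sigma>') ((r, U) # \<Gamma>)"
  unfolding sub_rel_def
proof (intro conjI allI impI)
  show "\<turnstile> \<Delta>" using assms(1) by (rule sub_rel_wf)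
  fix x r' T assume "in_ctx x r' T ((r, U) # \<Gamma>)"
  then show "var_rel r' \<Delta> (sb (case_nat v \<sigma>) T) (sb (case_nat v' \<sigma>') T)
      (case_nat v \<sigma> x) (case_nat v' \<sigma>' x)"
    by (cases rule: in_ctx_ConsE) (use assms in \<open>simp_all add: lift_eq_rn sb_rn sub_rel_def\<close>)
qed

lemma sub_rel_tl:
  assumes "sub_rel \<Delta> \<tau> \<tau>' ((r, U) # \<Gamma>)"
  shows "sub_rel \<Delta> (\<lambda>x. \<tau> (Suc x)) (\<lambda>x. \<tau>' (Suc x)) \<Gamma>"
    and "var_rel r \<Delta> (sb (\<lambda>x. \<tau> (Suc x)) U) (sb (\<lambda>x. \<tau>' (Suc x)) U) (\<tau> 0) (\<tau>' 0)"
proof -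
  have *: "var_rel r' \<Delta> (sb \<tau> T) (sb \<tau>' T) (\<tau> x) (\<tau>' x)" if "in_ctx x r' T ((r, U) # \<Gamma>)" for x r' T
    using assms that by (simp add: sub_rel_def)
  show "sub_rel \<Delta> (\<lambda>x. \<tau> (Suc x)) (\<lambda>x. \<tau>' (Suc x)) \<Gamma>"
    unfolding sub_rel_def using sub_rel_wf[OF assms] *[OF in_ctx_there] by (simp add: lift_eq_rn sb_rn)
  show "var_rel r \<Delta> (sb (\<lambda>x. \<tau> (Suc x)) U) (sb (\<lambda>x. \<tau>' (Suc x)) U) (\<tau> 0) (\<tau>' 0)"
    using *[OF in_ctx_here] by (simp add: lift_eq_rn sb_rn)
qed

lemma args_var_rel:
  assumes "lr n \<Delta> A B"
  shows "args r \<Delta> A v v' \<longleftrightarrow> var_rel r \<Delta> A B v v'"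
proof (cases r)
  case Irr
  have "resurrect \<Delta> \<turnstile> A \<^bold>= B \<^bold>: Set' n"
    using lr_teq[OF assms] by (auto simp: teq_def intro: resurrect_equal)
  with Irr show ?thesis by (auto intro: ty_conv eq_sym)
qed (use assms in \<open>auto simp: rel_tm_def\<close>)

lemma sub_rel_up:
  assumes s: "sub_rel \<Delta> \<sigma> \<sigma>' \<Gamma>" and U: "lr n \<Delta> (sb \<sigma> U) (sb \<sigma>' U)"
  shows "sub_rel ((r, sb \<sigma> U) # \<Delta>) (up \<sigma>) (up \<sigma>') ((r, U) # \<Gamma>)"
proof -
  have wf: "\<turnstile> (r, sb \<sigma> U) # \<Delta>"
    using sub_rel_wf[OF s] teq_left[OF lr_teq[OF U]] by (rule wf_cons)
  note U' = lr_rn[OF U ren_Suc[OF wf]]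
  \<comment> \<open>If relevant, the fresh variable is related to itself as a neutral term; if
    irrelevant, its typing in the resurrected context is all that is asked.\<close>
  have "args r ((r, sb \<sigma> U) # \<Delta>) (rn Suc (sb \<sigma> U)) (Var 0) (Var 0)"
    using ty_var0[OF wf] U'
    by (cases r) (auto simp: lift_eq_rn intro: tmr_neutral[rule_format] teq_refl)
  then have "var_rel r ((r, sb \<sigma> U) # \<Delta>) (rn Suc (sb \<sigma> U)) (rn Suc (sb \<sigma>' U)) (Var 0) (Var 0)"
    using args_var_rel[OF U'] by blast
  then show ?thesis
    unfolding up_def by (intro sub_rel_Cons sub_rel_ren[OF s ren_Suc[OF wf]]) (simp add: rn_sb)
qed

lemma validD: "valid \<Gamma> t t' T \<Longrightarrow> sub_rel \<Delta> \<sigma> \<sigma>' \<Gamma> \<Longrightarrow> rel_tm \<Delta> (sb \<sigma> T) (sb \<sigma>' T) (sb \<sigma> t) (sb \<sigma>' t')"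
  by (simp add: valid_def)

lemma valid_lr: "valid \<Gamma> t t' T \<Longrightarrow> sub_rel \<Delta> \<sigma> \<sigma>' \<Gamma> \<Longrightarrow> \<exists>n. lr n \<Delta> (sb \<sigma> T) (sb \<sigma>' T)"
  and valid_tmr: "valid \<Gamma> t t' T \<Longrightarrow> sub_rel \<Delta> \<sigma> \<sigma>' \<Gamma> \<Longrightarrow> tmr \<Delta> (sb \<sigma> T) (sb \<sigma> t) (sb \<sigma>' t')"
  by (auto simp: valid_def rel_tm_def)

lemma valid_teq: "valid \<Gamma> t t' T \<Longrightarrow> sub_rel \<Delta> \<sigma> \<sigma>' \<Gamma> \<Longrightarrow> teq \<Delta> (sb \<sigma> t) (sb \<sigma>' t') (sb \<sigma> T)"
  using valid_lr valid_tmr tmr_teq by blast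

lemma valid_sym:
  assumes "valid \<Gamma> t t' T"
  shows "valid \<Gamma> t' t T"
  unfolding valid_def
proof (intro allI impI)
  fix \<Delta> \<sigma> \<sigma>' assume "sub_rel \<Delta> \<sigma> \<sigma>' \<Gamma>"
  then show "rel_tm \<Delta> (sb \<sigma> T) (sb \<sigma>' T) (sb \<sigma> t') (sb \<sigma>' t)"
    by (rule rel_tm_sym[OF validD[OF assms sub_rel_sym]])
qed

lemma valid_trans:
  assumes 1: "valid \<Gamma> t1 t2 T" and 2: "valid \<Gamma> t2 t3 T"
  shows "valid \<Gamma> t1 t3 T"
  unfolding valid_def
proof (intro allI impI)
  fix \<Delta> \<sigma> \<sigma>' assume s: "sub_rel \<Delta> \<sigma> \<sigma>' \<Gamma>"
  from valid_lr[OF 1 s] obtain n where n: "lr n \<Delta> (sb \<sigma> T) (sb \<sigma>' T)" by blast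
  \<comment> \<open>The second equation is instantiated with the right substitution on both sides,
    so that the middle terms coincide; its type is then moved back to the left instance.\<close>
  from valid_tmr[OF 2 sub_rel_right[OF s]]
  have "tmr \<Delta> (sb \<sigma> T) (sb \<sigma>' t2) (sb \<sigma>' t3)" using tmr_conv[OF n] by blast
  with tmr_trans[OF n valid_tmr[OF 1 s]] n
  show "rel_tm \<Delta> (sb \<sigma> T) (sb \<sigma>' T) (sb \<sigma> t1) (sb \<sigma>' t3)" by (auto simp: rel_tm_def)
qed

lemma valid_left: "valid \<Gamma> t t' T \<Longrightarrow> valid \<Gamma> t t T"
  and valid_right: "valid \<Gamma> t t' T \<Longrightarrow> valid \<Gamma> t' t' T"
  by (blast intro: valid_sym valid_trans)+

lemma rel_tm_Set:
  assumes "\<turnstile> \<Delta>"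
  shows "rel_tm \<Delta> (Set' k) (Set' k) t u \<longleftrightarrow> lr k \<Delta> t u"
proof -
  have s: "srt_rel k \<Delta> (Set' k) (Set' k)"
    using assms by (auto simp: srt_rel_def ev_def intro: eval_Srt teq_refl Set'_typing)
  show ?thesis using srt_rel[OF s] lr_teq by (auto simp: rel_tm_def)
qed

lemma valid_Set: "valid \<Gamma> A B (Set' k) \<longleftrightarrow> (\<forall>\<Delta> \<sigma> \<sigma>'. sub_rel \<Delta> \<sigma> \<sigma>' \<Gamma> \<longrightarrow> lr k \<Delta> (sb \<sigma> A) (sb \<sigma>' B))"
  unfolding valid_def using rel_tm_Set sub_rel_wf by (metis sb.simps(1))

lemma valid_SetD: "valid \<Gamma> A B (Set' k) \<Longrightarrow> sub_rel \<Delta> \<sigma> \<sigma>' \<Gamma> \<Longrightarrow> lr k \<Delta> (sb \<sigma> A) (sb \<sigma>' B)"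
  by (simp add: valid_Set)

lemma valid_conv:
  assumes t: "valid \<Gamma> t t' T" and T: "valid \<Gamma> T T' (Set' k)"
  shows "valid \<Gamma> t t' T'"
  unfolding valid_def
proof (intro allI impI)
  fix \<Delta> \<sigma> \<sigma>' assume s: "sub_rel \<Delta> \<sigma> \<sigma>' \<Gamma>"
  show "rel_tm \<Delta> (sb \<sigma> T') (sb \<sigma>' T') (sb \<sigma> t) (sb \<sigma>' t')"
    using valid_SetD[OF valid_right[OF T] s] tmr_conv[OF valid_SetD[OF T sub_rel_left[OF s]]] valid_tmr[OF t s]
    by (auto simp: rel_tm_def)
qed

lemma inst_sb_up: "inst \<rho> v (sb (up \<sigma>) T) = sb (case_nat v (\<lambda>x. rn \<rho> (\<sigma> x))) T"
  by (auto simp: sb_sb rn_eq_sb sb_rn intro!: sb_cong split: nat.split)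

lemma valid_pi_rel:
  assumes U: "valid \<Gamma> U U' (Set' i)" and T: "valid ((r, U) # \<Gamma>) T T' (Set' j)"
    and s: "sub_rel \<Delta> \<sigma> \<sigma>' \<Gamma>"
  shows "pi_rel r i j \<Delta> (sb \<sigma> (Pi r (SetS i) (SetS j) U T)) (sb \<sigma>' (Pi r (SetS i) (SetS j) U' T'))
    (sb \<sigma> U) (sb (up \<sigma>) T) (sb \<sigma>' U') (sb (up \<sigma>') T')"
proof -
  note UU' = valid_SetD[OF U s] and UU = valid_SetD[OF valid_left[OF U] s]
  note TT' = lr_teq[OF valid_SetD[OF T sub_rel_up[OF s UU]]]
  note PP' = teq_Pi[OF lr_teq[OF UU'] TT']
  show ?thesis
    unfolding pi_rel_def sb.simps
  proof (intro conjI allI impI lr_teq[OF UU'] TT')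
    show "ev (max i j) \<Delta> (Pi r (SetS i) (SetS j) (sb \<sigma> U) (sb (up \<sigma>) T))
        (Pi r (SetS i) (SetS j) (sb \<sigma> U) (sb (up \<sigma>) T))"
      unfolding ev_def using PP' by (blast intro: eval_Pi teq_refl teq_left)
    show "ev (max i j) \<Delta> (Pi r (SetS i) (SetS j) (sb \<sigma>' U') (sb (up \<sigma>') T'))
        (Pi r (SetS i) (SetS j) (sb \<sigma>' U') (sb (up \<sigma>') T'))"
      unfolding ev_def using PP' by (blast intro: eval_Pi teq_refl teq_right)
  next
    fix \<Delta>' \<rho> assume r: "ren \<Delta>' \<rho> \<Delta>"
    show "lr i \<Delta>' (rn \<rho> (sb \<sigma> U)) (rn \<rho> (sb \<sigma>' U'))" by (rule lr_rn[OF UU' r])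
    fix v v' assume "args r \<Delta>' (rn \<rho> (sb \<sigma> U)) v v'"
    \<comment> \<open>The extended context stores \<open>U\<close>, so the arguments must be related
      over the two instances of \<open>U\<close>, not over one of \<open>U\<close> and one of
      \<open>U'\<close>.\<close>
    then have "var_rel r \<Delta>' (rn \<rho> (sb \<sigma> U)) (rn \<rho> (sb \<sigma>' U)) v v'"
      using args_var_rel[OF lr_rn[OF UU r]] by blast
    from valid_SetD[OF T sub_rel_Cons[OF sub_rel_ren[OF s r] this[unfolded rn_sb]]]
    show "lr j \<Delta>' (inst \<rho> v (sb (up \<sigma>) T)) (inst \<rho> v' (sb (up \<sigma>') T'))"
      by (simp only: inst_sb_up)
  qed
qed

lemma valid_Pi:
  assumes "valid \<Gamma> U U' (Set' i)" "valid ((r, U) # \<Gamma>) T T' (Set' j)"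
  shows "valid \<Gamma> (Pi r (SetS i) (SetS j) U T) (Pi r (SetS i) (SetS j) U' T') (Set' (max i j))"
  unfolding valid_Set using pi_rel(1)[OF valid_pi_rel[OF assms]] by blast

lemma lr_PiD:
  assumes "lr n \<Delta> (Pi r s s' U T) (Pi r2 s2 s2' U' T')"
  shows "\<exists>i j. s = SetS i \<and> s' = SetS j \<and> n = max i j \<and> r2 = r \<and> s2 = s \<and> s2' = s' \<and>
    pi_rel r i j \<Delta> (Pi r s s' U T) (Pi r s s' U' T') U T U' T'"
proof -
  from lr_piD[OF assms eval_Pi] obtain i j U'' T'' where s: "s = SetS i" "s' = SetS j" "n = max i j"
    and p: "pi_rel r i j \<Delta> (Pi r s s' U T) (Pi r2 s2 s2' U' T') U T U'' T''" by blast
  have "Pi r2 s2 s2' U' T' \<searrow> Pi r (SetS i) (SetS j) U'' T''"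
    using p by (simp add: pi_rel_def ev_def)
  from eval_fun[OF eval_Pi this] s p show ?thesis by auto
qed

lemma pi_rel_id:
  assumes p: "pi_rel r i j \<Delta> A B U T U' T'" and wf: "\<turnstile> \<Delta>"
  shows "lr i \<Delta> U U'"
    and "args r \<Delta> U v v' \<Longrightarrow> lr j \<Delta> (subst v T) (subst v' T')"
    and "tmr \<Delta> A t u \<Longrightarrow> args r \<Delta> U v v' \<Longrightarrow> tmr \<Delta> (subst v T) (App r t v) (App r u v')"
proof -
  show "lr i \<Delta> U U'" using pi_rel_ren(1)[OF p ren_id[OF wf]] by simp
  show "args r \<Delta> U v v' \<Longrightarrow> lr j \<Delta> (subst v T) (subst v' T')"
    using pi_rel_ren(2)[OF p ren_id[OF wf], of v v'] by (simp add: subst_eq_sb)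
  assume "tmr \<Delta> A t u" "args r \<Delta> U v v'"
  then have "pi_tm r \<Delta> A U T t u" "args r \<Delta> (rn (\<lambda>x. x) U) v v'" using pi_rel(2)[OF p] by simp_all
  then have "tmr \<Delta> (inst (\<lambda>x. x) v T) (App r (rn (\<lambda>x. x) t) v) (App r (rn (\<lambda>x. x) u) v')"
    using ren_id[OF wf] unfolding pi_tm_def by blast
  then show "tmr \<Delta> (subst v T) (App r t v) (App r u v')" by (simp add: subst_eq_sb)
qed

text \<open>The typing rule for abstractions provides only the function type as a whole. Validity of
  its components is recovered semantically, since a type related to a function type has related
  components.\<close>

lemma valid_PiD:
  assumes P: "valid \<Gamma> (Pi r s s' U T) (Pi r s s' U T) (Set' k)" and s0: "sub_rel \<Delta>0 \<sigma>0 \<sigma>0' \<Gamma>"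
  obtains i j where "s = SetS i" "s' = SetS j" "valid \<Gamma> U U (Set' i)" "valid ((r, U) # \<Gamma>) T T (Set' j)"
proof -
  have *: "\<exists>i j. s = SetS i \<and> s' = SetS j \<and>
      pi_rel r i j \<Delta> (sb \<sigma> (Pi r s s' U T)) (sb \<sigma>' (Pi r s s' U T))
        (sb \<sigma> U) (sb (up \<sigma>) T) (sb \<sigma>' U) (sb (up \<sigma>') T)"
    if "sub_rel \<Delta> \<sigma> \<sigma>' \<Gamma>" for \<Delta> \<sigma> \<sigma>'
    using lr_PiD[OF valid_SetD[OF P that, unfolded sb.simps]] by auto
  from *[OF s0] obtain i j where ij: "s = SetS i" "s' = SetS j" by blast
  have p: "pi_rel r i j \<Delta> (sb \<sigma> (Pi r s s' U T)) (sb \<sigma>' (Pi r s s' U T))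
        (sb \<sigma> U) (sb (up \<sigma>) T) (sb \<sigma>' U) (sb (up \<sigma>') T)"
    if "sub_rel \<Delta> \<sigma> \<sigma>' \<Gamma>" for \<Delta> \<sigma> \<sigma>'
    using *[OF that] ij by auto
  show ?thesis
  proof (rule that[OF ij])
    show "valid \<Gamma> U U (Set' i)"
      unfolding valid_Set using pi_rel_id(1)[OF p] sub_rel_wf by blast
    show "valid ((r, U) # \<Gamma>) T T (Set' j)"
      unfolding valid_Set
    proof (intro allI impI)
      fix \<Delta> \<tau> \<tau>' assume t: "sub_rel \<Delta> \<tau> \<tau>' ((r, U) # \<Gamma>)"
      let ?\<sigma> = "\<lambda>x. \<tau> (Suc x)" and ?\<sigma>' = "\<lambda>x. \<tau>' (Suc x)"
      note wf = sub_rel_wf[OF t] and p = p[OF sub_rel_tl(1)[OF t]]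
      have "args r \<Delta> (sb ?\<sigma> U) (\<tau> 0) (\<tau>' 0)"
        using sub_rel_tl(2)[OF t] args_var_rel[OF pi_rel_id(1)[OF p wf]] by blast
      from pi_rel_id(2)[OF p wf this]
      have "lr j \<Delta> (sb (case_nat (\<tau> 0) ?\<sigma>) T) (sb (case_nat (\<tau>' 0) ?\<sigma>') T)"
        by (simp only: subst_sb_up)
      \<comment> \<open>A substitution on the extended context is reassembled from its head, which
        serves as the argument, and its tail.\<close>
      moreover have "case_nat (f 0) (\<lambda>x. f (Suc x)) = f" for f :: "nat \<Rightarrow> exp"
        by (rule ext) (simp split: nat.split)
      ultimately show "lr j \<Delta> (sb \<tau> T) (sb \<tau>' T)" by simp
    qed
  qed
qed

lemma tmr_whr_right:
  assumes AB: "lr n \<Gamma> A B" and "whr u0 u" "teq \<Gamma> u0 u B" "tmr \<Gamma> A t u"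
  shows "tmr \<Gamma> A t u0"
  using tmr_whr[OF lr_sym[OF AB] assms(2,3)] tmr_swap[OF AB] assms(4) by blast

lemma ctx_for_args_typing:
  assumes "lr n \<Delta> V W" "args r \<Delta> V v v'"
  shows "ctx_for r \<Delta> \<turnstile> v \<^bold>: V" "ctx_for r \<Delta> \<turnstile> v' \<^bold>: W"
proof -
  show "ctx_for r \<Delta> \<turnstile> v \<^bold>: V" by (rule targ_left[OF args_targ[OF assms]])
  have "ctx_for r \<Delta> \<turnstile> v' \<^bold>: V" by (rule targ_right[OF args_targ[OF assms]])
  then show "ctx_for r \<Delta> \<turnstile> v' \<^bold>: W"
    using ctx_for_equal[OF teq_equal[OF lr_teq[OF assms(1)]]] by (rule ty_conv)
qed

text \<open>Extending the substitutions by related arguments relates the two bodies; the applied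
  abstractions are head expansions of them.\<close>

lemma valid_Lam:
  assumes U: "valid \<Gamma> U U' (Set' i)" and T: "valid ((r, U) # \<Gamma>) T T (Set' j)"
    and t: "valid ((r, U) # \<Gamma>) t t' T"
  shows "valid \<Gamma> (Lam r U t) (Lam r U' t') (Pi r (SetS i) (SetS j) U T)"
  unfolding valid_def
proof (intro allI impI)
  fix \<Delta> \<sigma> \<sigma>' assume s: "sub_rel \<Delta> \<sigma> \<sigma>' \<Gamma>"
  note P = valid_pi_rel[OF valid_left[OF U] T s]
  note UU' = valid_SetD[OF U s] and UU = valid_SetD[OF valid_left[OF U] s]
  note up = sub_rel_up[OF s UU, of r]
  have s': "sub_rel \<Delta> \<sigma>' \<sigma>' \<Gamma>" by (rule sub_rel_right[OF s])
  note up' = sub_rel_up[OF s' valid_SetD[OF valid_left[OF U] s'], of r]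
  have UU'2: "teq \<Delta> (sb \<sigma>' U) (sb \<sigma>' U') (Set' i)" by (rule lr_teq[OF valid_SetD[OF U s']])
  have T1: "(r, sb \<sigma> U) # \<Delta> \<turnstile> sb (up \<sigma>) T \<^bold>: Set' j"
    by (rule teq_left[OF lr_teq[OF valid_SetD[OF T up]]])
  \<comment> \<open>The right abstraction is annotated with \<open>U'\<close>, so codomain and body
    are retyped over the instance of \<open>U'\<close> before its beta step can be typed.\<close>
  have T2: "(r, sb \<sigma>' U') # \<Delta> \<turnstile> sb (up \<sigma>') T \<^bold>: Set' j"
    by (rule teq_left[OF teq_ctx_conv[OF lr_teq[OF valid_SetD[OF T up']] UU'2]])
  have t2: "(r, sb \<sigma>' U') # \<Delta> \<turnstile> sb (up \<sigma>') t' \<^bold>: sb (up \<sigma>') T"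
    by (rule teq_left[OF teq_ctx_conv[OF valid_teq[OF valid_right[OF t] up'] UU'2]])
  have "pi_tm r \<Delta> (sb \<sigma> (Pi r (SetS i) (SetS j) U T)) (sb \<sigma> U) (sb (up \<sigma>) T)
      (sb \<sigma> (Lam r U t)) (sb \<sigma>' (Lam r U' t'))"
    unfolding pi_tm_def sb.simps
  proof (intro conjI allI impI)
    show "teq \<Delta> (Lam r (sb \<sigma> U) (sb (up \<sigma>) t)) (Lam r (sb \<sigma>' U') (sb (up \<sigma>') t'))
        (Pi r (SetS i) (SetS j) (sb \<sigma> U) (sb (up \<sigma>) T))"
      by (rule teq_Lam[OF lr_teq[OF UU'] T1 valid_teq[OF t up]])
    fix \<Delta>' \<rho> v v' assume r: "ren \<Delta>' \<rho> \<Delta>" and v: "args r \<Delta>' (rn \<rho> (sb \<sigma> U)) v v'"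
    note b1 = beta_expansion[OF teq_left[OF lr_teq[OF UU']] T1 teq_left[OF valid_teq[OF t up]] r
        ctx_for_args_typing(1)[OF lr_rn[OF UU' r] v]]
    note b2 = beta_expansion[OF teq_right[OF lr_teq[OF UU']] T2 t2 r
        ctx_for_args_typing(2)[OF lr_rn[OF UU' r] v]]
    note TT = pi_rel_ren(2)[OF P r v]
    have "var_rel r \<Delta>' (rn \<rho> (sb \<sigma> U)) (rn \<rho> (sb \<sigma>' U)) v v'"
      using args_var_rel[OF lr_rn[OF UU r]] v by blast
    from valid_tmr[OF t sub_rel_Cons[OF sub_rel_ren[OF s r] this[unfolded rn_sb]]]
    have "tmr \<Delta>' (inst \<rho> v (sb (up \<sigma>) T)) (inst \<rho> v (sb (up \<sigma>) t)) (inst \<rho> v' (sb (up \<sigma>') t'))"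
      by (simp only: inst_sb_up)
    then show "tmr \<Delta>' (inst \<rho> v (sb (up \<sigma>) T)) (App r (rn \<rho> (Lam r (sb \<sigma> U) (sb (up \<sigma>) t))) v)
        (App r (rn \<rho> (Lam r (sb \<sigma>' U') (sb (up \<sigma>') t'))) v')"
      by (rule tmr_whr_right[OF TT b2 tmr_whr[OF TT b1]])
  qed
  with pi_rel[OF P]
  show "rel_tm \<Delta> (sb \<sigma> (Pi r (SetS i) (SetS j) U T)) (sb \<sigma>' (Pi r (SetS i) (SetS j) U T))
      (sb \<sigma> (Lam r U t)) (sb \<sigma>' (Lam r U' t'))"
    by (auto simp: rel_tm_def)
qed

text \<open>Irrelevant arguments keep their syntactic typing. Validity in the resurrected context
  could not be used, since it would ask for related images of irrelevant variables, where
  \<open>sub_rel\<close> offers typed ones only.\<close>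

primrec valid_arg :: "ann \<Rightarrow> ctx \<Rightarrow> exp \<Rightarrow> exp \<Rightarrow> exp \<Rightarrow> bool" where
  "valid_arg Rel \<Gamma> U u u' = valid \<Gamma> u u' U"
| "valid_arg Irr \<Gamma> U u u' = (resurrect \<Gamma> \<turnstile> u \<^bold>: U \<and> resurrect \<Gamma> \<turnstile> u' \<^bold>: U)"

lemma valid_arg_left: "valid_arg r \<Gamma> U u u' \<Longrightarrow> valid_arg r \<Gamma> U u u"
  by (cases r) (auto intro: valid_left)

lemma valid_arg_args:
  assumes u: "valid_arg r \<Gamma> U u u'" and s: "sub_rel \<Delta> \<sigma> \<sigma>' \<Gamma>" and U: "lr n \<Delta> (sb \<sigma> U) (sb \<sigma>' U)"
  shows "args r \<Delta> (sb \<sigma> U) (sb \<sigma> u) (sb \<sigma>' u')"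
proof (cases r)
  case Rel
  with u s show ?thesis by (auto intro: valid_tmr)
next
  case Irr
  have "resurrect \<Delta> \<turnstile> sb \<sigma> u \<^bold>: sb \<sigma> U" "resurrect \<Delta> \<turnstile> sb \<sigma>' u' \<^bold>: sb \<sigma>' U"
    using u Irr sub_rel_sbok[OF s] sub_rel_sbok[OF sub_rel_sym[OF s]]
    by (auto intro: sb_typing sbok_resurrect)
  then show ?thesis unfolding args_var_rel[OF U] Irr by simp
qed

lemma valid_App:
  assumes t: "valid \<Gamma> t t' (Pi r s s' U T)" and u: "valid_arg r \<Gamma> U u u'"
  shows "valid \<Gamma> (App r t u) (App r t' u') (subst u T)"
  unfolding valid_def
proof (intro allI impI)
  fix \<Delta> \<sigma> \<sigma>' assume s: "sub_rel \<Delta> \<sigma> \<sigma>' \<Gamma>"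
  note wf = sub_rel_wf[OF s]
  from valid_lr[OF t s] lr_PiD obtain i j where
    P: "pi_rel r i j \<Delta> (sb \<sigma> (Pi r s s' U T)) (sb \<sigma>' (Pi r s s' U T))
      (sb \<sigma> U) (sb (up \<sigma>) T) (sb \<sigma>' U) (sb (up \<sigma>') T)"
    unfolding sb.simps by blast
  note UU = pi_rel_id(1)[OF P wf]
  show "rel_tm \<Delta> (sb \<sigma> (subst u T)) (sb \<sigma>' (subst u T)) (sb \<sigma> (App r t u)) (sb \<sigma>' (App r t' u'))"
    \<comment> \<open>The result type mentions \<open>u\<close> on both sides, whereas the terms
      pair \<open>u\<close> with \<open>u'\<close>; hence two different argument pairs.\<close>
    using pi_rel_id(2)[OF P wf valid_arg_args[OF valid_arg_left[OF u] s UU]]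
      pi_rel_id(3)[OF P wf valid_tmr[OF t s] valid_arg_args[OF u s UU]]
    unfolding rel_tm_def sb_subst sb.simps by blast
qed

lemma valid_beta:
  assumes t: "valid ((r, U) # \<Gamma>) t t T" and u: "valid_arg r \<Gamma> U u u" and U: "valid \<Gamma> U U (Set' i)"
  shows "valid \<Gamma> (App r (Lam r U t) u) (subst u t) (subst u T)"
  unfolding valid_def
proof (intro allI impI)
  fix \<Delta> \<sigma> \<sigma>' assume s: "sub_rel \<Delta> \<sigma> \<sigma>' \<Gamma>"
  note UU = valid_SetD[OF U s]
  note up = sub_rel_up[OF s UU, of r]
  note v = valid_arg_args[OF u s UU]
  obtain j where T: "lr j ((r, sb \<sigma> U) # \<Delta>) (sb (up \<sigma>) T) (sb (up \<sigma>') T)"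
    using valid_lr[OF t up] by blast
  have v_ty: "ctx_for r \<Delta> \<turnstile> sb \<sigma> u \<^bold>: rn (\<lambda>x. x) (sb \<sigma> U)"
    using ctx_for_args_typing(1)[OF UU v] by simp
  note b = beta_expansion[OF teq_left[OF lr_teq[OF UU]] teq_left[OF lr_teq[OF T]]
      teq_left[OF valid_teq[OF t up]] ren_id[OF sub_rel_wf[OF s]] v_ty]
  have "var_rel r \<Delta> (sb \<sigma> U) (sb \<sigma>' U) (sb \<sigma> u) (sb \<sigma>' u)" using v args_var_rel[OF UU] by blast
  from validD[OF t sub_rel_Cons[OF s this]]
  have "rel_tm \<Delta> (subst (sb \<sigma> u) (sb (up \<sigma>) T)) (subst (sb \<sigma>' u) (sb (up \<sigma>') T))
     (subst (sb \<sigma> u) (sb (up \<sigma>) t)) (subst (sb \<sigma>' u) (sb (up \<sigma>') t))"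
    by (simp only: subst_sb_up)
  moreover have "whr (App r (Lam r (sb \<sigma> U) (sb (up \<sigma>) t)) (sb \<sigma> u)) (subst (sb \<sigma> u) (sb (up \<sigma>) t))"
    and "teq \<Delta> (App r (Lam r (sb \<sigma> U) (sb (up \<sigma>) t)) (sb \<sigma> u)) (subst (sb \<sigma> u) (sb (up \<sigma>) t))
      (subst (sb \<sigma> u) (sb (up \<sigma>) T))"
    using b by (simp_all only: rn_id subst_eq_sb)
  ultimately show "rel_tm \<Delta> (sb \<sigma> (subst u T)) (sb \<sigma>' (subst u T))
      (sb \<sigma> (App r (Lam r U t) u)) (sb \<sigma>' (subst u t))"
    unfolding sb_subst sb.simps rel_tm_def using tmr_whr by blast
qed

lemma valid_eta:
  assumes t: "valid \<Gamma> t t (Pi r s s' U T)"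
  shows "valid \<Gamma> t (Lam r U (App r (lift t) (Var 0))) (Pi r s s' U T)"
  unfolding valid_def
proof (intro allI impI)
  fix \<Delta> \<sigma> \<sigma>' assume s: "sub_rel \<Delta> \<sigma> \<sigma>' \<Gamma>"
  note wf = sub_rel_wf[OF s]
  let ?A = "sb \<sigma> (Pi r s s' U T)" and ?B = "sb \<sigma>' (Pi r s s' U T)"
  let ?b = "App r (lift (sb \<sigma>' t)) (Var 0)"
  from valid_lr[OF t s] lr_PiD obtain i j where ij: "s = SetS i" "s' = SetS j"
    and P: "pi_rel r i j \<Delta> ?A ?B (sb \<sigma> U) (sb (up \<sigma>) T) (sb \<sigma>' U) (sb (up \<sigma>') T)"
    unfolding sb.simps by blast
  note UU = pi_rel_id(1)[OF P wf] and AB = lr_teq[OF pi_rel(1)[OF P]]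
  have U: "\<Delta> \<turnstile> sb \<sigma>' U \<^bold>: Set' i" by (rule teq_right[OF lr_teq[OF UU]])
  have T: "(r, sb \<sigma>' U) # \<Delta> \<turnstile> sb (up \<sigma>') T \<^bold>: Set' j"
    using P teq_right[OF teq_ctx_conv] by (auto simp: pi_rel_def)
  have t': "\<Delta> \<turnstile> sb \<sigma>' t \<^bold>: Pi r (SetS i) (SetS j) (sb \<sigma>' U) (sb (up \<sigma>') T)"
    using valid_teq[OF t sub_rel_right[OF s]] by (simp add: teq_def ij)
  have tt: "pi_tm r \<Delta> ?A (sb \<sigma> U) (sb (up \<sigma>) T) (sb \<sigma> t) (sb \<sigma>' t)"
    using valid_tmr[OF t s] pi_rel(2)[OF P] by blast
  have "pi_tm r \<Delta> ?A (sb \<sigma> U) (sb (up \<sigma>) T) (sb \<sigma> t) (Lam r (sb \<sigma>' U) ?b)"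
    unfolding pi_tm_def
  proof (intro conjI allI impI)
    have "teq \<Delta> (sb \<sigma>' t) (Lam r (sb \<sigma>' U) ?b) ?B"
      using teq_eta[OF t' U T] by (simp add: ij)
    from teq_conv'[OF this AB] tt show "teq \<Delta> (sb \<sigma> t) (Lam r (sb \<sigma>' U) ?b) ?A"
      unfolding pi_tm_def by (blast intro: teq_trans)
    fix \<Delta>' \<rho> v v' assume r: "ren \<Delta>' \<rho> \<Delta>" and v: "args r \<Delta>' (rn \<rho> (sb \<sigma> U)) v v'"
    \<comment> \<open>Instantiating the body of the expansion cancels the weakening, so applying the
      expansion takes one head step to applying the original function.\<close>
    have b: "inst \<rho> v' ?b = App r (rn \<rho> (sb \<sigma>' t)) v'"
      by (simp add: lift_eq_rn sb_rn) (simp add: rn_eq_sb)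
    show "tmr \<Delta>' (inst \<rho> v (sb (up \<sigma>) T)) (App r (rn \<rho> (sb \<sigma> t)) v)
        (App r (rn \<rho> (Lam r (sb \<sigma>' U) ?b)) v')"
      using tmr_whr_right[OF pi_rel_ren(2)[OF P r v] beta_expansion[OF U T eta_body_typing[OF t' U] r
            ctx_for_args_typing(2)[OF lr_rn[OF UU r] v], unfolded b]] tt r v
      unfolding pi_tm_def by blast
  qed
  then show "rel_tm \<Delta> ?A ?B (sb \<sigma> t) (sb \<sigma>' (Lam r U (App r (lift t) (Var 0))))"
    using pi_rel[OF P] by (auto simp: rel_tm_def sb_lift)
qed

subsection \<open>The fundamental theorem\<close>

definition valid_type :: "ctx \<Rightarrow> exp \<Rightarrow> bool" where
  "valid_type \<Gamma> U \<longleftrightarrow> (\<exists>k. valid \<Gamma> U U (Set' k))"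

lemma valid_argI:
  "ctx_for r \<Gamma> \<turnstile> u \<^bold>: U \<Longrightarrow> valid (ctx_for r \<Gamma>) u u U \<Longrightarrow> valid_arg r \<Gamma> U u u"
  by (cases r) auto

lemma sub_rel_id: "\<turnstile> \<Gamma> \<Longrightarrow> ctx_all valid_type \<Gamma> \<Longrightarrow> sub_rel \<Gamma> Var Var \<Gamma>"
proof (induction \<Gamma>)
  case Nil
  then show ?case by (auto simp: sub_rel_def elim: in_ctx_NilE)
next
  case (Cons a \<Gamma>)
  obtain r U where a: "a = (r, U)" by (cases a)
  with Cons have s: "sub_rel \<Gamma> Var Var \<Gamma>" by (auto elim: wf_consE)
  from Cons.prems a obtain k where "valid \<Gamma> U U (Set' k)" by (auto simp: valid_type_def)
  from sub_rel_up[OF s valid_SetD[OF this s], of r] show ?case by (simp add: a up_Var)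
qed

text \<open>Validity of the context entries is carried along because the beta rule does not repeat
  that its domain is a type, and because it makes the identity substitution related to
  itself.\<close>

lemma fundamental:
  "\<turnstile> \<Gamma> \<Longrightarrow> ctx_all valid_type \<Gamma>"
  "\<Gamma> \<turnstile> t \<^bold>: T \<Longrightarrow> ctx_all valid_type \<Gamma> \<and> valid \<Gamma> t t T"
  "\<Gamma> \<turnstile> t \<^bold>= t' \<^bold>: T \<Longrightarrow> ctx_all valid_type \<Gamma> \<and> valid \<Gamma> t t' T"
proof (induction rule: wf_ctx_typing_equal.inducts)
  case (wf_cons \<Gamma> T s r)
  then show ?case by (cases s) (auto simp: valid_type_def)
next
  case (ty_sort \<Gamma> s s')
  then obtain i where i: "s = SetS i" "s' = SetS (Suc i)" by (auto simp: Axiom_def)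
  have "lr (Suc i) \<Delta> (Set' i) (Set' i)" if "\<turnstile> \<Delta>" for \<Delta>
    by (rule srt_rel) (use that in \<open>auto simp: srt_rel_def ev_def intro: eval_Srt teq_refl Set'_typing\<close>)
  then have "valid \<Gamma> (Set' i) (Set' i) (Set' (Suc i))" by (auto simp: valid_Set dest: sub_rel_wf)
  with ty_sort i show ?case by simp
next
  case (ty_pi \<Gamma> U s1 r T s2 s3)
  then show ?case by (auto simp: Rule_def intro: valid_Pi)
next
  case (ty_var \<Gamma> x U)
  then show ?case by (fastforce simp: valid_def sub_rel_def)
next
  case (ty_lam r U \<Gamma> t T s s' s3)
  then have ctx: "ctx_all valid_type \<Gamma>" by blast
  obtain k where k: "s3 = SetS k" by (cases s3)
  have "sub_rel \<Gamma> Var Var \<Gamma>" using sub_rel_id wf_typing ty_lam.hyps(2) ctx by blast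
  from ty_lam.IH(2) valid_PiD[OF _ this] obtain i j where
    "s = SetS i" "s' = SetS j" "valid \<Gamma> U U (Set' i)" "valid ((r, U) # \<Gamma>) T T (Set' j)"
    unfolding k by blast
  with ctx ty_lam.IH(1) show ?case by (auto intro: valid_Lam)
next
  case (ty_app \<Gamma> t r s s' U T u)
  then show ?case by (auto intro: valid_App valid_argI)
next
  case (ty_conv \<Gamma> t T T' s)
  then show ?case by (cases s) (auto intro: valid_conv)
next
  case (eq_beta r U \<Gamma> t T u)
  \<comment> \<open>The domain of the redex is valid because it is the last entry of the context in
    which the body is typed.\<close>
  then obtain k where "valid \<Gamma> U U (Set' k)" by (auto simp: valid_type_def)
  with eq_beta show ?case by (auto intro: valid_beta valid_argI)
next
  case (eq_eta \<Gamma> t r s s' U T)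
  then show ?case by (auto intro: valid_eta)
next
  case (eq_sym \<Gamma> t t' T)
  then show ?case by (auto intro: valid_sym)
next
  case (eq_trans \<Gamma> t1 t2 T t3)
  then show ?case by (auto intro: valid_trans)
next
  case (eq_pi \<Gamma> U U' s1 r T T' s2 s3)
  then show ?case by (auto simp: Rule_def intro: valid_Pi)
next
  case (eq_lam \<Gamma> U U' s1 r T s2 t t')
  then show ?case by (cases s1; cases s2) (auto intro: valid_Lam)
next
  case (eq_app_rel \<Gamma> t t' s s' U T u u')
  then show ?case using valid_App[of \<Gamma> t t' Rel] by auto
next
  case (eq_app_irr \<Gamma> t t' s s' U T u u')
  then show ?case using valid_App[of \<Gamma> t t' Irr] by auto
next
  case (eq_conv \<Gamma> t t' T T' s)
  then show ?case by (cases s) (auto intro: valid_conv)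
qed auto

section \<open>Declarative consequences at the identity substitution\<close>

lemma valid_equal_id:
  assumes "\<Gamma> \<turnstile> t \<^bold>= t' \<^bold>: T"
  shows "rel_tm \<Gamma> T T t t'"
  using validD[OF conjunct2[OF fundamental(3)[OF assms]] sub_rel_id] fundamental(3)[OF assms] wf_equal[OF assms]
  by simp

lemma equal_teq: "\<Gamma> \<turnstile> t \<^bold>= t' \<^bold>: T \<Longrightarrow> teq \<Gamma> t t' T"
  using valid_equal_id tmr_teq unfolding rel_tm_def by blast

lemma typing_type: "\<Gamma> \<turnstile> t \<^bold>: T \<Longrightarrow> \<exists>s. \<Gamma> \<turnstile> T \<^bold>: Srt s"
  using valid_equal_id[OF eq_refl] lr_teq teq_left unfolding rel_tm_def by blast

lemma equal_lr: "\<Gamma> \<turnstile> A \<^bold>= B \<^bold>: Set' k \<Longrightarrow> lr k \<Gamma> A B"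
  using valid_equal_id rel_tm_Set wf_equal by blast

subsection \<open>Injectivity of function types and uniqueness of sorts\<close>

lemma ty_equalI: "\<Gamma> \<turnstile> A \<^bold>= B \<^bold>: Srt s \<Longrightarrow> \<Gamma> \<turnstile> A \<^bold>= B"
  by (auto simp: ty_equal_def)

lemma ty_equal_lr: "\<Gamma> \<turnstile> A \<^bold>= B \<Longrightarrow> \<exists>k. lr k \<Gamma> A B"
  unfolding ty_equal_def by (metis equal_lr sort.exhaust)

lemma ty_equal_refl: "\<Gamma> \<turnstile> A \<^bold>: Srt s \<Longrightarrow> \<Gamma> \<turnstile> A \<^bold>= A"
  by (auto simp: ty_equal_def intro: eq_refl)

lemma ty_equal_sym: "\<Gamma> \<turnstile> A \<^bold>= B \<Longrightarrow> \<Gamma> \<turnstile> B \<^bold>= A"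
  by (auto simp: ty_equal_def intro: eq_sym)

lemma ty_equal_eval_Srt:
  assumes "\<Gamma> \<turnstile> A \<^bold>= B" "A \<searrow> Srt s"
  shows "B \<searrow> Srt s"
proof -
  obtain k where "s = SetS k" by (cases s)
  then show ?thesis
    using ty_equal_lr[OF assms(1)] lr_srtD assms(2) by (auto simp: srt_rel_def ev_def)
qed

text \<open>Injectivity phrased through evaluation, so that it can be iterated along types that are
  not literally function types.\<close>

lemma ty_equal_eval_Pi:
  assumes "\<Gamma> \<turnstile> A \<^bold>= B" "A \<searrow> Pi r s s' U T"
  shows "\<exists>U' T'. B \<searrow> Pi r s s' U' T' \<and> \<Gamma> \<turnstile> U \<^bold>= U' \<^bold>: Srt s \<and> (r, U) # \<Gamma> \<turnstile> T \<^bold>= T' \<^bold>: Srt s'"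
proof -
  obtain k where "lr k \<Gamma> A B" using ty_equal_lr[OF assms(1)] by blast
  from lr_piD[OF this assms(2)] show ?thesis
    by (auto simp: pi_rel_def ev_def teq_def)
qed

text \<open>Chains of type equalities at possibly different sorts.  They collapse to single equalities,
  but only once sorts are known to be unique (\<open>chain_ty_equal\<close>).\<close>

abbreviation chain :: "ctx \<Rightarrow> exp \<Rightarrow> exp \<Rightarrow> bool" where
  "chain \<Gamma> \<equiv> tranclp (ty_equal \<Gamma>)"

lemma chain_sym: "chain \<Gamma> A B \<Longrightarrow> chain \<Gamma> B A"
  by (induction rule: tranclp_induct) (auto intro: ty_equal_sym tranclp_into_tranclp2)

lemma chain_eval_Srt: "chain \<Gamma> A B \<Longrightarrow> A \<searrow> Srt s \<Longrightarrow> B \<searrow> Srt s"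
  by (induction rule: tranclp_induct) (auto intro: ty_equal_eval_Srt)

lemma equal_ctx_conv:
  "(r, U) # \<Gamma> \<turnstile> t \<^bold>= t' \<^bold>: T \<Longrightarrow> \<Gamma> \<turnstile> U \<^bold>= U' \<^bold>: Srt s \<Longrightarrow> (r, U') # \<Gamma> \<turnstile> t \<^bold>= t' \<^bold>: T"
  by (blast intro: equal_teq teq_equal teq_ctx_conv)

lemma typing_ctx_conv:
  "(r, U) # \<Gamma> \<turnstile> t \<^bold>: T \<Longrightarrow> \<Gamma> \<turnstile> U \<^bold>= U' \<^bold>: Srt s \<Longrightarrow> (r, U') # \<Gamma> \<turnstile> t \<^bold>: T"
  by (blast intro: equal_teq teq_refl teq_left teq_ctx_conv)

lemma chain_eval_Pi: "chain \<Gamma> A B \<Longrightarrow> A \<searrow> Pi r s s' U T \<Longrightarrow>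
    \<exists>U' T'. B \<searrow> Pi r s s' U' T' \<and> \<Gamma> \<turnstile> U \<^bold>= U' \<^bold>: Srt s \<and> (r, U) # \<Gamma> \<turnstile> T \<^bold>= T' \<^bold>: Srt s'"
proof (induction rule: tranclp_induct)
  case (base B)
  then show ?case by (rule ty_equal_eval_Pi)
next
  case (step B C)
  then obtain U' T' where B: "B \<searrow> Pi r s s' U' T'" "\<Gamma> \<turnstile> U \<^bold>= U' \<^bold>: Srt s"
    "(r, U) # \<Gamma> \<turnstile> T \<^bold>= T' \<^bold>: Srt s'" by blast
  from ty_equal_eval_Pi[OF step(2) B(1)] obtain U'' T'' where C: "C \<searrow> Pi r s s' U'' T''"
    "\<Gamma> \<turnstile> U' \<^bold>= U'' \<^bold>: Srt s" "(r, U') # \<Gamma> \<turnstile> T' \<^bold>= T'' \<^bold>: Srt s'" by blast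
  from equal_ctx_conv[OF C(3) eq_sym[OF B(2)]] B C show ?case by (blast intro: eq_trans)
qed

lemma chain_Pi:
  assumes "chain \<Gamma> (Pi r s s' U T) (Pi r2 s2 s2' U' T')"
  shows "r2 = r \<and> s2 = s \<and> s2' = s' \<and> \<Gamma> \<turnstile> U \<^bold>= U' \<^bold>: Srt s \<and> (r, U) # \<Gamma> \<turnstile> T \<^bold>= T' \<^bold>: Srt s'"
  using chain_eval_Pi[OF assms eval_Pi] eval_fun[OF eval_Pi] by blast

text \<open>Chains are transitive but not reflexive by definition, so an empty conversion must be
  justified by well-formedness of the type; with empty chains allowed, \<open>chain_ty_equal\<close>
  would fail for ill-formed types.\<close>

lemma type_chain_refl: "\<Gamma> \<turnstile> t \<^bold>: T \<Longrightarrow> chain \<Gamma> T T"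
  using typing_type ty_equal_refl by blast

text \<open>Records what the last rule other than conversion says, so that one induction serves the
  inversion lemmas for all four forms that need one.\<close>

definition generation :: "ctx \<Rightarrow> exp \<Rightarrow> exp \<Rightarrow> bool" where
  "generation \<Gamma> t T \<longleftrightarrow> (case t of
      Srt s \<Rightarrow> \<exists>s'. T = Srt s'
    | Pi r s s' U S \<Rightarrow> \<Gamma> \<turnstile> U \<^bold>: Srt s \<and> (r, U) # \<Gamma> \<turnstile> S \<^bold>: Srt s'
    | Var x \<Rightarrow> in_ctx x Rel T \<Gamma>
    | Lam r U u \<Rightarrow> \<exists>s s' s3 S. T = Pi r s s' U S \<and> (r, U) # \<Gamma> \<turnstile> u \<^bold>: S \<and> \<Gamma> \<turnstile> T \<^bold>: Srt s3
    | App r f u \<Rightarrow> \<exists>s s' U S. \<Gamma> \<turnstile> f \<^bold>: Pi r s s' U S \<and> ctx_for r \<Gamma> \<turnstile> u \<^bold>: U \<and> T = subst u S)"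

lemma generation:
  "\<turnstile> \<Gamma> \<Longrightarrow> True"
  "\<Gamma> \<turnstile> t \<^bold>: T \<Longrightarrow> \<exists>T0. generation \<Gamma> t T0 \<and> chain \<Gamma> T0 T"
  "\<Gamma> \<turnstile> t \<^bold>= t' \<^bold>: T \<Longrightarrow> True"
proof (induction rule: wf_ctx_typing_equal.inducts)
  case (ty_sort \<Gamma> s s')
  then show ?case
    by (fastforce simp: generation_def intro: type_chain_refl wf_ctx_typing_equal.ty_sort)
next
  case (ty_pi \<Gamma> U s1 r T s2 s3)
  then show ?case
    by (fastforce simp: generation_def intro: type_chain_refl wf_ctx_typing_equal.ty_pi)
next
  case (ty_var \<Gamma> x U)
  then show ?case
    by (fastforce simp: generation_def intro: type_chain_refl wf_ctx_typing_equal.ty_var)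
next
  case (ty_lam r U \<Gamma> t T s s' s3)
  have "generation \<Gamma> (Lam r U t) (Pi r s s' U T)" using ty_lam by (auto simp: generation_def)
  with wf_ctx_typing_equal.ty_lam[OF ty_lam.hyps] show ?case by (blast intro: type_chain_refl)
next
  case (ty_app \<Gamma> t r s s' U T u)
  have "generation \<Gamma> (App r t u) (subst u T)" using ty_app by (auto simp: generation_def)
  with wf_ctx_typing_equal.ty_app[OF ty_app.hyps] show ?case by (blast intro: type_chain_refl)
next
  case (ty_conv \<Gamma> t T T' s)
  then show ?case by (blast intro: ty_equalI tranclp.trancl_into_trancl)
qed simp_all

lemma inv_Var: "\<Gamma> \<turnstile> Var x \<^bold>: T \<Longrightarrow> \<exists>U. in_ctx x Rel U \<Gamma> \<and> chain \<Gamma> U T"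
  by (auto dest!: generation(2) simp: generation_def)

lemma inv_Pi: "\<Gamma> \<turnstile> Pi r s s' U T \<^bold>: A \<Longrightarrow> \<Gamma> \<turnstile> U \<^bold>: Srt s \<and> (r, U) # \<Gamma> \<turnstile> T \<^bold>: Srt s'"
  by (auto dest!: generation(2) simp: generation_def)

lemma inv_Lam: "\<Gamma> \<turnstile> Lam r U t \<^bold>: T \<Longrightarrow> \<exists>s s' s3 S. (r, U) # \<Gamma> \<turnstile> t \<^bold>: S \<and>
    \<Gamma> \<turnstile> Pi r s s' U S \<^bold>: Srt s3 \<and> chain \<Gamma> (Pi r s s' U S) T"
  using generation(2)[of \<Gamma> "Lam r U t" T] unfolding generation_def exp.case by blast

lemma inv_App: "\<Gamma> \<turnstile> App r t u \<^bold>: T \<Longrightarrow> \<exists>s s' U S. \<Gamma> \<turnstile> t \<^bold>: Pi r s s' U S \<and>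
    ctx_for r \<Gamma> \<turnstile> u \<^bold>: U \<and> chain \<Gamma> (subst u S) T"
  using generation(2)[of \<Gamma> "App r t u" T] unfolding generation_def exp.case by blast

text \<open>The head variable fixes the type up to conversion, and injectivity of function types
  propagates this along the arguments.\<close>

lemma neutral_type_chain: "neutral n \<Longrightarrow> \<Gamma> \<turnstile> n \<^bold>: T \<Longrightarrow> \<Gamma> \<turnstile> n \<^bold>: T' \<Longrightarrow> chain \<Gamma> T T'"
proof (induction n arbitrary: T T')
  case (Var x)
  then obtain U U' where "in_ctx x Rel U \<Gamma>" "chain \<Gamma> U T" "in_ctx x Rel U' \<Gamma>" "chain \<Gamma> U' T'"
    using inv_Var by meson
  then show ?case using in_ctx_fun by (blast intro: chain_sym tranclp_trans)
next
  case (App r n u)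
  obtain s s' U S where 1: "\<Gamma> \<turnstile> n \<^bold>: Pi r s s' U S" "ctx_for r \<Gamma> \<turnstile> u \<^bold>: U" "chain \<Gamma> (subst u S) T"
    using inv_App[OF App.prems(2)] by blast
  obtain s2 s2' U' S' where 2: "\<Gamma> \<turnstile> n \<^bold>: Pi r s2 s2' U' S'" "chain \<Gamma> (subst u S') T'"
    using inv_App[OF App.prems(3)] by blast
  have "chain \<Gamma> (Pi r s s' U S) (Pi r s2 s2' U' S')" using App 1 2 by simp
  then have "(r, U) # \<Gamma> \<turnstile> S \<^bold>= S' \<^bold>: Srt s'" using chain_Pi by blast
  from subst_equal[OF this 1(2)] have "chain \<Gamma> (subst u S) (subst u S')"
    by (auto intro: ty_equalI)
  with 1 2 show ?case by (blast intro: chain_sym tranclp_trans)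
qed simp_all

text \<open>A sort or function type shows its level in its weak head normal form. A neutral type
  does not; there the chain between two of its sorts evaluates to the same sort.\<close>

lemma lr_level_unique:
  assumes "lr n \<Gamma> A B" "lr m \<Gamma> A B'"
  shows "m = n"
  using assms(1)
proof (cases rule: lr_cases)
  case (ne N N')
  then have N: "A \<searrow> N" "neutral N" "\<Gamma> \<turnstile> N \<^bold>: Set' n" by (auto simp: ne_rel_def ev_def teq_def)
  with lr_neD[OF assms(2)] have "\<Gamma> \<turnstile> N \<^bold>: Set' m" by (auto simp: ne_rel_def ev_def teq_def)
  from neutral_type_chain[OF N(2,3) this] have "Set' m \<searrow> Set' n"
    by (rule chain_eval_Srt) (rule eval_Srt)
  from eval_fun[OF eval_Srt this] show ?thesis by simp
next
  case (srt k)
  then show ?thesis using lr_srtD[OF assms(2)] by (auto simp: srt_rel_def ev_def)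
next
  case (pi r i j U T U' T')
  then have "A \<searrow> Pi r (SetS i) (SetS j) U T" by (simp add: pi_rel_def ev_def)
  from lr_piD[OF assms(2) this] pi(1) show ?thesis by auto
qed

lemma sort_unique: "\<Gamma> \<turnstile> A \<^bold>: Srt s \<Longrightarrow> \<Gamma> \<turnstile> A \<^bold>: Srt s' \<Longrightarrow> s' = s"
  by (cases s; cases s') (auto dest!: eq_refl equal_lr intro: lr_level_unique)

lemma ty_equal_trans:
  assumes "\<Gamma> \<turnstile> A \<^bold>= B" "\<Gamma> \<turnstile> B \<^bold>= C"
  shows "\<Gamma> \<turnstile> A \<^bold>= C"
proof -
  obtain s s' where s: "\<Gamma> \<turnstile> A \<^bold>= B \<^bold>: Srt s" "\<Gamma> \<turnstile> B \<^bold>= C \<^bold>: Srt s'"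
    using assms by (auto simp: ty_equal_def)
  then have "s' = s" using equal_teq teq_left teq_right sort_unique by meson
  with s show ?thesis by (auto intro: ty_equalI eq_trans)
qed

lemma chain_ty_equal: "chain \<Gamma> A B \<Longrightarrow> \<Gamma> \<turnstile> A \<^bold>= B"
  by (induction rule: tranclp_induct) (auto intro: ty_equal_trans)

lemma Pi_inj:
  "\<Gamma> \<turnstile> Pi r s s' U T \<^bold>= Pi r2 s2 s2' U' T' \<Longrightarrow>
     r2 = r \<and> s2 = s \<and> s2' = s' \<and> \<Gamma> \<turnstile> U \<^bold>= U' \<^bold>: Srt s \<and> (r, U) # \<Gamma> \<turnstile> T \<^bold>= T' \<^bold>: Srt s'"
  by (rule chain_Pi) (rule tranclp.r_into_trancl)

lemma ty_equal_typing: "\<Gamma> \<turnstile> t \<^bold>: T \<Longrightarrow> \<Gamma> \<turnstile> T \<^bold>= T' \<Longrightarrow> \<Gamma> \<turnstile> t \<^bold>: T'"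
  by (auto simp: ty_equal_def intro: ty_conv)

lemma ty_equal_equal: "\<Gamma> \<turnstile> t \<^bold>= t' \<^bold>: T \<Longrightarrow> \<Gamma> \<turnstile> T \<^bold>= T' \<Longrightarrow> \<Gamma> \<turnstile> t \<^bold>= t' \<^bold>: T'"
  by (auto simp: ty_equal_def intro: eq_conv)

subsection \<open>Subject reduction\<close>

text \<open>Subject reduction in equational form. Active application is read as ordinary
  application, which makes the two parts of the mutual induction compose by transitivity.\<close>

lemma eval_equal:
  "t \<searrow> a \<Longrightarrow> \<forall>\<Gamma> T. \<Gamma> \<turnstile> t \<^bold>: T \<longrightarrow> \<Gamma> \<turnstile> t \<^bold>= a \<^bold>: T"
  "f @[r] u \<searrow> a \<Longrightarrow> \<forall>\<Gamma> T. \<Gamma> \<turnstile> App r f u \<^bold>: T \<longrightarrow> \<Gamma> \<turnstile> App r f u \<^bold>= a \<^bold>: T"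
proof (induction rule: eval_eval_app.inducts)
  case (eval_whnf a)
  then show ?case by (blast intro: eq_refl)
next
  case (eval_App t f r u a)
  show ?case
  proof (intro allI impI)
    fix \<Gamma> T assume "\<Gamma> \<turnstile> App r t u \<^bold>: T"
    from inv_App[OF this] obtain s s' U S where
      t: "\<Gamma> \<turnstile> t \<^bold>: Pi r s s' U S" and u: "ctx_for r \<Gamma> \<turnstile> u \<^bold>: U" and T: "chain \<Gamma> (subst u S) T" by blast
    have "\<Gamma> \<turnstile> t \<^bold>= f \<^bold>: Pi r s s' U S" using eval_App.IH(1) t by blast
    from eq_app_targ[OF this targ_refl[OF u]]
    have "\<Gamma> \<turnstile> App r t u \<^bold>= App r f u \<^bold>: T" using chain_ty_equal[OF T] by (rule ty_equal_equal)
    then show "\<Gamma> \<turnstile> App r t u \<^bold>= a \<^bold>: T"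
      using eval_App.IH(2) teq_right[OF equal_teq] by (blast intro: eq_trans)
  qed
next
  case (eval_app_lam u t a r U)
  show ?case
  proof (intro allI impI)
    fix \<Gamma> T assume "\<Gamma> \<turnstile> App r (Lam r U t) u \<^bold>: T"
    from inv_App[OF this] obtain s s' V S where
      l: "\<Gamma> \<turnstile> Lam r U t \<^bold>: Pi r s s' V S" and u: "ctx_for r \<Gamma> \<turnstile> u \<^bold>: V" and T: "chain \<Gamma> (subst u S) T"
      by blast
    from inv_Lam[OF l] obtain s2 s2' S' where t: "(r, U) # \<Gamma> \<turnstile> t \<^bold>: S'"
      and P: "chain \<Gamma> (Pi r s2 s2' U S') (Pi r s s' V S)" by blast
    \<comment> \<open>Injectivity at work: the annotation of the abstraction and the domain at which
      the argument is typed come from different inversions and must be identified before beta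
      applies.\<close>
    from chain_Pi[OF P] have UV: "\<Gamma> \<turnstile> V \<^bold>= U \<^bold>: Srt s" and S: "(r, U) # \<Gamma> \<turnstile> S' \<^bold>= S \<^bold>: Srt s'"
      by (auto intro: eq_sym)
    have u': "ctx_for r \<Gamma> \<turnstile> u \<^bold>: U" using u ctx_for_equal[OF UV] by (rule ty_conv)
    have "\<Gamma> \<turnstile> subst u S' \<^bold>= T"
      using subst_equal[OF S u'] chain_ty_equal[OF T] by (auto intro: ty_equal_trans ty_equalI)
    with eq_beta[OF t u'] have "\<Gamma> \<turnstile> App r (Lam r U t) u \<^bold>= subst u t \<^bold>: T" by (rule ty_equal_equal)
    then show "\<Gamma> \<turnstile> App r (Lam r U t) u \<^bold>= a \<^bold>: T"
      using eval_app_lam.IH teq_right[OF equal_teq] by (blast intro: eq_trans)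
  qed
next
  case (eval_app_ne n r u)
  then show ?case by (blast intro: eq_refl)
qed

lemma eval_ty_equal: "T \<searrow> A \<Longrightarrow> \<Gamma> \<turnstile> t \<^bold>: T \<Longrightarrow> \<Gamma> \<turnstile> T \<^bold>= A"
  using typing_type eval_equal(1) ty_equalI by blast

subsection \<open>Soundness of algorithmic equality\<close>

text \<open>Strengthened for the induction: the two sides may be typed differently, and the inferred
  type is compared with both.\<close>

definition ne_sound :: "ctx \<Rightarrow> exp \<Rightarrow> exp \<Rightarrow> exp \<Rightarrow> bool" where
  "ne_sound \<Delta> n n' U \<longleftrightarrow> (\<forall>T T'. \<Delta> \<turnstile> n \<^bold>: T \<longrightarrow> \<Delta> \<turnstile> n' \<^bold>: T' \<longrightarrow>
     \<Delta> \<turnstile> n \<^bold>= n' \<^bold>: U \<and> \<Delta> \<turnstile> U \<^bold>= T \<and> \<Delta> \<turnstile> U \<^bold>= T')"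

definition tm_sound :: "ctx \<Rightarrow> exp \<Rightarrow> exp \<Rightarrow> exp \<Rightarrow> bool" where
  "tm_sound \<Delta> t t' T \<longleftrightarrow> (\<Delta> \<turnstile> t \<^bold>: T \<longrightarrow> \<Delta> \<turnstile> t' \<^bold>: T \<longrightarrow> \<Delta> \<turnstile> t \<^bold>= t' \<^bold>: T)"

lemma ne_sound_App:
  assumes n: "ne_sound \<Delta> n n' (Pi r s s' U T)" and u: "r = Rel \<Longrightarrow> tm_sound \<Delta> u u' U"
  shows "ne_sound \<Delta> (App r n u) (App r n' u') (subst u T)"
  unfolding ne_sound_def
proof (intro allI impI)
  fix T1 T2 assume "\<Delta> \<turnstile> App r n u \<^bold>: T1" "\<Delta> \<turnstile> App r n' u' \<^bold>: T2"
  from this[THEN inv_App] obtain s1 s1' U1 S1 s2 s2' U2 S2 where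
    1: "\<Delta> \<turnstile> n \<^bold>: Pi r s1 s1' U1 S1" "ctx_for r \<Delta> \<turnstile> u \<^bold>: U1" "chain \<Delta> (subst u S1) T1" and
    2: "\<Delta> \<turnstile> n' \<^bold>: Pi r s2 s2' U2 S2" "ctx_for r \<Delta> \<turnstile> u' \<^bold>: U2" "chain \<Delta> (subst u' S2) T2" by blast
  from n 1(1) 2(1) have nn': "\<Delta> \<turnstile> n \<^bold>= n' \<^bold>: Pi r s s' U T"
    and P1: "\<Delta> \<turnstile> Pi r s s' U T \<^bold>= Pi r s1 s1' U1 S1"
    and P2: "\<Delta> \<turnstile> Pi r s s' U T \<^bold>= Pi r s2 s2' U2 S2"
    unfolding ne_sound_def by blast+
  note P1 = Pi_inj[OF P1] and P2 = Pi_inj[OF P2]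
  have u1: "ctx_for r \<Delta> \<turnstile> u \<^bold>: U"
    using 1(2) P1 by (blast intro: ty_conv ctx_for_equal eq_sym)
  have u2: "ctx_for r \<Delta> \<turnstile> u' \<^bold>: U"
    using 2(2) P2 by (blast intro: ty_conv ctx_for_equal eq_sym)
  have uu': "targ r \<Delta> U u u'"
    using u u1 u2 by (cases r) (auto simp: tm_sound_def teq_def)
  have T: "(r, U) # \<Delta> \<turnstile> T \<^bold>: Srt s'" using P1 equal_teq teq_left by blast
  have "\<Delta> \<turnstile> subst u T \<^bold>= T1"
    using subst_equal[OF _ u1] P1 chain_ty_equal[OF 1(3)] by (fastforce intro: ty_equal_trans ty_equalI)
  moreover have "\<Delta> \<turnstile> subst u' T \<^bold>= T2"
    using subst_equal[OF _ u2] P2 chain_ty_equal[OF 2(3)] by (fastforce intro: ty_equal_trans ty_equalI)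
  \<comment> \<open>The inferred type contains \<open>u\<close>, the right-hand type
    \<open>u'\<close>. The two instances of \<open>T\<close> are equal by \<open>teq_subst\<close>,
    even for irrelevant arguments, which were never compared.\<close>
  then have "\<Delta> \<turnstile> subst u T \<^bold>= T2"
    using teq_equal[OF teq_subst[OF T uu']] by (blast intro: ty_equal_trans ty_equalI)
  ultimately show "\<Delta> \<turnstile> App r n u \<^bold>= App r n' u' \<^bold>: subst u T \<and> \<Delta> \<turnstile> subst u T \<^bold>= T1 \<and> \<Delta> \<turnstile> subst u T \<^bold>= T2"
    using eq_app_targ[OF nn' uu'] by blast
qed

lemma algorithmic_sound:
  "\<Delta> \<turnstile> T \<Longleftrightarrow>\<^sub>t\<^sub>y T' \<Longrightarrow> \<forall>s. tm_sound \<Delta> T T' (Srt s)"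
  "\<Delta> \<turnstile> T \<longleftrightarrow>\<^sub>t\<^sub>y T' \<Longrightarrow> \<forall>s. tm_sound \<Delta> T T' (Srt s)"
  "\<Delta> \<turnstile> n \<Longleftrightarrow>\<^sub>n\<^sub>e n' \<^bold>: U \<Longrightarrow> ne_sound \<Delta> n n' U"
  "\<Delta> \<turnstile> n \<longleftrightarrow>\<^sub>n\<^sub>e n' \<^bold>: U \<Longrightarrow> ne_sound \<Delta> n n' U"
  "\<Delta> \<turnstile> t \<Longleftrightarrow>\<^sub>t\<^sub>m t' \<^bold>: V \<Longrightarrow> tm_sound \<Delta> t t' V"
  "\<Delta> \<turnstile> t \<longleftrightarrow>\<^sub>t\<^sub>m t' \<^bold>: V \<Longrightarrow> tm_sound \<Delta> t t' V"
proof (induction rule: alg_ty_alg_ty_whnf_alg_ne_alg_ne_whnf_alg_tm_alg_tm_whnf.inducts)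
  case (alg_ty_eval T A T' A' \<Delta>)
  show ?case
    unfolding tm_sound_def
  proof (intro allI impI)
    fix s assume "\<Delta> \<turnstile> T \<^bold>: Srt s" "\<Delta> \<turnstile> T' \<^bold>: Srt s"
    then have TA: "\<Delta> \<turnstile> T \<^bold>= A \<^bold>: Srt s" "\<Delta> \<turnstile> T' \<^bold>= A' \<^bold>: Srt s"
      using alg_ty_eval.hyps eval_equal(1) by blast+
    then have "\<Delta> \<turnstile> A \<^bold>= A' \<^bold>: Srt s"
      using alg_ty_eval.IH equal_teq teq_right unfolding tm_sound_def by blast
    with TA show "\<Delta> \<turnstile> T \<^bold>= T' \<^bold>: Srt s" by (blast intro: eq_sym eq_trans)
  qed
next
  case (alg_ty_sort \<Delta> s)
  then show ?case by (auto simp: tm_sound_def intro: eq_refl)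
next
  case (alg_ty_pi \<Delta> U U' r T T' s s')
  show ?case
    unfolding tm_sound_def
  proof (intro allI impI)
    fix s0 assume P: "\<Delta> \<turnstile> Pi r s s' U T \<^bold>: Srt s0" "\<Delta> \<turnstile> Pi r s s' U' T' \<^bold>: Srt s0"
    note P1 = inv_Pi[OF P(1)] and P2 = inv_Pi[OF P(2)]
    obtain i j where ij: "s = SetS i" "s' = SetS j" by (cases s; cases s')
    have UU': "\<Delta> \<turnstile> U \<^bold>= U' \<^bold>: Srt s" using alg_ty_pi.IH(1) P1 P2 by (auto simp: tm_sound_def)
    \<comment> \<open>Both codomains are compared in the context of the left domain, so the right
      one is first moved there along the equality of domains.\<close>
    have "(r, U) # \<Delta> \<turnstile> T' \<^bold>: Srt s'" using P2 eq_sym[OF UU'] by (blast intro: typing_ctx_conv)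
    then have TT': "(r, U) # \<Delta> \<turnstile> T \<^bold>= T' \<^bold>: Srt s'"
      using alg_ty_pi.IH(2) P1 by (auto simp: tm_sound_def)
    from eq_pi[OF UU'[unfolded ij] TT'[unfolded ij] Rule_max]
    have "\<Delta> \<turnstile> Pi r s s' U T \<^bold>= Pi r s s' U' T' \<^bold>: Set' (max i j)" by (simp add: ij)
    \<comment> \<open>Congruence yields the sort computed from the components; uniqueness of sorts
      identifies it with the prescribed one.\<close>
    moreover from this have "Set' (max i j) = Srt s0"
      using sort_unique[OF P(1)] equal_teq teq_left by blast
    ultimately show "\<Delta> \<turnstile> Pi r s s' U T \<^bold>= Pi r s s' U' T' \<^bold>: Srt s0" by simp
  qed
next
  case (alg_ty_ne N N' \<Delta> T)
  then show ?case unfolding tm_sound_def ne_sound_def by (blast intro: ty_equal_equal)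
next
  case (alg_ne_var x T \<Delta>)
  show ?case
    unfolding ne_sound_def
  proof (intro allI impI)
    fix T1 T2 assume "\<Delta> \<turnstile> Var x \<^bold>: T1" "\<Delta> \<turnstile> Var x \<^bold>: T2"
    note x = this
    from x[THEN inv_Var] have "\<Delta> \<turnstile> T \<^bold>= T1" "\<Delta> \<turnstile> T \<^bold>= T2"
      using in_ctx_fun[OF alg_ne_var] chain_ty_equal by blast+
    moreover have "\<Delta> \<turnstile> Var x \<^bold>= Var x \<^bold>: T"
      using ty_var[OF wf_typing[OF x(1)] alg_ne_var] by (rule eq_refl)
    ultimately show "\<Delta> \<turnstile> Var x \<^bold>= Var x \<^bold>: T \<and> \<Delta> \<turnstile> T \<^bold>= T1 \<and> \<Delta> \<turnstile> T \<^bold>= T2" by blast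
  qed
next
  case (alg_ne_app_rel n n' \<Delta> s s' U T u u')
  then show ?case by (blast intro: ne_sound_App)
next
  case (alg_ne_app_irr n n' \<Delta> s s' U T u u')
  then show ?case by (blast intro: ne_sound_App)
next
  case (alg_ne_eval n n' \<Delta> T A)
  show ?case
    unfolding ne_sound_def
  proof (intro allI impI)
    fix T1 T2 assume "\<Delta> \<turnstile> n \<^bold>: T1" "\<Delta> \<turnstile> n' \<^bold>: T2"
    then have n: "\<Delta> \<turnstile> n \<^bold>= n' \<^bold>: T" "\<Delta> \<turnstile> T \<^bold>= T1" "\<Delta> \<turnstile> T \<^bold>= T2"
      using alg_ne_eval.IH unfolding ne_sound_def by blast+
    have "\<Delta> \<turnstile> T \<^bold>= A"
      by (rule eval_ty_equal[OF \<open>T \<searrow> A\<close> teq_left[OF equal_teq[OF n(1)]]])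
    with n show "\<Delta> \<turnstile> n \<^bold>= n' \<^bold>: A \<and> \<Delta> \<turnstile> A \<^bold>= T1 \<and> \<Delta> \<turnstile> A \<^bold>= T2"
      by (blast intro: ty_equal_equal ty_equal_trans ty_equal_sym)
  qed
next
  case (alg_tm_eval T A \<Delta> t t')
  then show ?case
    unfolding tm_sound_def by (blast intro: eval_ty_equal ty_equal_typing ty_equal_equal ty_equal_sym)
next
  case (alg_tm_pi r U \<Delta> t t' T s s')
  show ?case
    unfolding tm_sound_def
  proof (intro impI)
    assume t: "\<Delta> \<turnstile> t \<^bold>: Pi r s s' U T" and t': "\<Delta> \<turnstile> t' \<^bold>: Pi r s s' U T"
    from typing_type[OF t] inv_Pi have U: "\<Delta> \<turnstile> U \<^bold>: Srt s" and T: "(r, U) # \<Delta> \<turnstile> T \<^bold>: Srt s'"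
      by blast+
    \<comment> \<open>The algorithm compares eta-expanded bodies. Congruence of abstraction and two
      uses of eta return to the functions themselves.\<close>
    have "(r, U) # \<Delta> \<turnstile> App r (lift t) (Var 0) \<^bold>= App r (lift t') (Var 0) \<^bold>: T"
      using alg_tm_pi.IH eta_body_typing[OF t U] eta_body_typing[OF t' U] unfolding tm_sound_def by blast
    from eq_lam[OF eq_refl[OF U] T this] eq_eta[OF t] eq_eta[OF t']
    show "\<Delta> \<turnstile> t \<^bold>= t' \<^bold>: Pi r s s' U T" by (blast intro: eq_sym eq_trans)
  qed
next
  case (alg_tm_sort \<Delta> T T' s)
  then show ?case by blast
next
  case (alg_tm_ne N t n t' n' \<Delta> T)
  show ?case
    unfolding tm_sound_def
  proof (intro impI)
    assume "\<Delta> \<turnstile> t \<^bold>: N" "\<Delta> \<turnstile> t' \<^bold>: N"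
    then have tn: "\<Delta> \<turnstile> t \<^bold>= n \<^bold>: N" "\<Delta> \<turnstile> t' \<^bold>= n' \<^bold>: N"
      using alg_tm_ne.hyps eval_equal(1) by blast+
    \<comment> \<open>The type inferred for the neutrals is discarded by the algorithm;
      \<open>ne_sound\<close> makes it equal to \<open>N\<close>, so the equation can be
      converted.\<close>
    from tn[THEN equal_teq, THEN teq_right] alg_tm_ne.IH
    have "\<Delta> \<turnstile> n \<^bold>= n' \<^bold>: N" unfolding ne_sound_def by (blast intro: ty_equal_equal)
    with tn show "\<Delta> \<turnstile> t \<^bold>= t' \<^bold>: N" by (blast intro: eq_sym eq_trans)
  qed
qed

theorem theorem5p12:
  "(\<forall>\<Delta> t t' T.
      \<Delta> \<turnstile> t \<^bold>: T \<longrightarrow> \<Delta> \<turnstile> t' \<^bold>: T \<longrightarrow> \<Delta> \<turnstile> t \<Longleftrightarrow>\<^sub>t\<^sub>m t' \<^bold>: T \<longrightarrow>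
      \<Delta> \<turnstile> t \<^bold>= t' \<^bold>: T) \<and>
   (\<forall>\<Delta> n n' T U.
      \<Delta> \<turnstile> n \<^bold>: T \<longrightarrow> \<Delta> \<turnstile> n' \<^bold>: T \<longrightarrow> \<Delta> \<turnstile> n \<Longleftrightarrow>\<^sub>n\<^sub>e n' \<^bold>: U \<longrightarrow>
      \<Delta> \<turnstile> n \<^bold>= n' \<^bold>: U \<and> \<Delta> \<turnstile> U \<^bold>= T)"
  using algorithmic_sound(3,5) unfolding tm_sound_def ne_sound_def by blast

end
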